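(* There is no faithful combinatorial description of $\mathcal{W}_2$.
   Context: A rooted tree on $[n]$ is a set $E$ of ordered pairs (an edge $(v,w)$ means $w$ is a child of $v$) such that exactly one vertex (the root) has no parent, every other vertex has exactly one parent, and all vertices are connected to the root by following parents; $\mathrm{RT}(n)$ is the set of these. $\mathcal{C}_2=C^\infty(\mathbb{R}^2,\mathbb{R}^2)$. For $\tau$ with root $r$ whose children are $v_1,\dots,v_k$, recursively $F(\tau)((f^i)_{i})=\sum_{j_1,\dots,j_k=1}^2 F(\tau_{v_1})(\cdots)_{j_1}\cdots F(\tau_{v_k})(\cdots)_{j_k}\,\partial_{j_1}\cdots\partial_{j_k}f^r$, where $\tau_{v_m}$ is the subtree of $v_m$ and its descendants, evaluated on the $f^i$ indexed by its vertices, $(\cdot)_j$ is the $j$-th coordinate and $\partial_j=\partial/\partial x_j$ (single vertex: $F(\tau)=f^r$). $\mathcal{W}_2(n)$ is the real span of $\{F(\tau):\tau\in\mathrm{RT}(n)\}$ in the $n$-linear maps $\mathcal{C}_2^n\to\mathcal{C}_2$, with $\mathfrak{S}_n$ acting by permuting inputs. A combinatorial description of $\mathcal{W}_2$ is a pair $(\mathrm{CD},H)$: sets $\mathrm{CD}(n)$ with $\mathfrak{S}_n$-actions and $\mathfrak{S}_n$-equivariant maps $H^n:\mathrm{CD}(n)\to\mathcal{W}_2(n)$ whose images span $\mathcal{W}_2(n)$; it is faithful if for every $n$ the set $H^n(\mathrm{CD}(n))$ is a basis of $\mathcal{W}_2(n)$. *)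

theory Defs
  imports "HOL-Analysis.Analysis"
begin

type_synonym R2 = "real^2"
type_synonym vf = "R2 \<Rightarrow> R2"                 (* elements of C_2 (when smooth) *)
type_synonym inputs = "nat \<Rightarrow> vf"             (* tuples (f^i)_{i in [n]}, [n] = {0..<n} *)
type_synonym nmap = "inputs \<Rightarrow> vf"           (* n-linear maps C_2^n -> C_2 *)

text \<open>Partial derivative d/dx_j and iterated partial derivatives.\<close>
definition partial :: "2 \<Rightarrow> vf \<Rightarrow> vf" where
  "partial j f = (\<lambda>x. frechet_derivative f (at x) (axis j 1))"

fun multipartial :: "2 list \<Rightarrow> vf \<Rightarrow> vf" where
  "multipartial [] f = f"
| "multipartial (j # js) f = partial j (multipartial js f)"

text \<open>C-infinity: every iterated partial derivative exists and is (Frechet) differentiable.\<close>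
definition smooth2 :: "vf \<Rightarrow> bool" where
  "smooth2 f \<longleftrightarrow> (\<forall>js. multipartial js f differentiable_on UNIV)"

text \<open>Rooted trees on [n] = {0..<n}: (v,w) in E means w is a child of v.\<close>
definition is_rooted_tree :: "nat \<Rightarrow> (nat \<times> nat) set \<Rightarrow> bool" where
  "is_rooted_tree n E \<longleftrightarrow> E \<subseteq> {0..<n} \<times> {0..<n} \<and>
     (\<exists>r<n. (\<forall>v. (v, r) \<notin> E) \<and> (\<forall>w<n. w \<noteq> r \<longrightarrow> (\<exists>!v. (v, w) \<in> E))
            \<and> (\<forall>w<n. (r, w) \<in> E\<^sup>*))"

definition RT :: "nat \<Rightarrow> (nat \<times> nat) set set" where
  "RT n = {E. is_rooted_tree n E}"

definition tree_root :: "nat \<Rightarrow> (nat \<times> nat) set \<Rightarrow> nat" where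
  "tree_root n E = (THE r. r < n \<and> (\<forall>v. (v, r) \<notin> E))"

definition children :: "(nat \<times> nat) set \<Rightarrow> nat \<Rightarrow> nat set" where
  "children E v = {w. (v, w) \<in> E}"

text \<open>F of the subtree rooted at v, computed with recursion fuel d (fuel n suffices).\<close>
fun Fsub :: "nat \<Rightarrow> (nat \<times> nat) set \<Rightarrow> inputs \<Rightarrow> nat \<Rightarrow> vf" where
  "Fsub 0 E g v = g v"
| "Fsub (Suc d) E g v = (\<lambda>x. \<Sum>J \<in> children E v \<rightarrow>\<^sub>E (UNIV :: 2 set).
      (\<Prod>c \<in> children E v. Fsub d E g c x $ J c) *\<^sub>R
      multipartial (map J (sorted_list_of_set (children E v))) (g v) x)"

text \<open>The n-linear map F(tau) : C_2^n -> C_2, represented as a function on all input tuples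
  which is 0 unless all inputs f^0..f^(n-1) are smooth.\<close>
definition Fmap :: "nat \<Rightarrow> (nat \<times> nat) set \<Rightarrow> nmap" where
  "Fmap n E = (\<lambda>g. if (\<forall>i<n. smooth2 (g i)) then Fsub n E g (tree_root n E) else (\<lambda>x. 0))"

text \<open>Real linear combinations, span and linear independence in the space of such maps.\<close>
definition lincomb :: "nmap set \<Rightarrow> (nmap \<Rightarrow> real) \<Rightarrow> nmap" where
  "lincomb S c = (\<lambda>g x. \<Sum>b\<in>S. c b *\<^sub>R b g x)"

definition rspan :: "nmap set \<Rightarrow> nmap set" where
  "rspan A = {\<Phi>. \<exists>S c. finite S \<and> S \<subseteq> A \<and> \<Phi> = lincomb S c}"

definition rindep :: "nmap set \<Rightarrow> bool" where
  "rindep A \<longleftrightarrow> (\<forall>S c. finite S \<and> S \<subseteq> A \<and> lincomb S c = (\<lambda>g x. 0) \<longrightarrow> (\<forall>b\<in>S. c b = 0))"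

definition W2 :: "nat \<Rightarrow> nmap set" where
  "W2 n = rspan (Fmap n ` RT n)"

text \<open>S_n acts on n-linear maps by permuting inputs.\<close>
definition perm_act :: "(nat \<Rightarrow> nat) \<Rightarrow> nmap \<Rightarrow> nmap" where
  "perm_act \<sigma> \<Phi> = (\<lambda>g. \<Phi> (g \<circ> \<sigma>))"

text \<open>A set with an S_n-action (S_n = permutations of {0..<n}).\<close>
definition is_Sn_action :: "nat \<Rightarrow> 'c set \<Rightarrow> ((nat \<Rightarrow> nat) \<Rightarrow> 'c \<Rightarrow> 'c) \<Rightarrow> bool" where
  "is_Sn_action n X act \<longleftrightarrow>
     (\<forall>\<sigma> x. \<sigma> permutes {0..<n} \<and> x \<in> X \<longrightarrow> act \<sigma> x \<in> X) \<and>
     (\<forall>x\<in>X. act id x = x) \<and>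
     (\<forall>\<sigma> \<tau> x. \<sigma> permutes {0..<n} \<and> \<tau> permutes {0..<n} \<and> x \<in> X \<longrightarrow>
        act (\<sigma> \<circ> \<tau>) x = act \<sigma> (act \<tau> x))"

definition is_comb_description ::
    "(nat \<Rightarrow> 'c set) \<Rightarrow> (nat \<Rightarrow> (nat \<Rightarrow> nat) \<Rightarrow> 'c \<Rightarrow> 'c) \<Rightarrow> (nat \<Rightarrow> 'c \<Rightarrow> nmap) \<Rightarrow> bool" where
  "is_comb_description CD act H \<longleftrightarrow>
     (\<forall>n\<ge>1. is_Sn_action n (CD n) (act n) \<and>
        H n ` CD n \<subseteq> W2 n \<and>
        (\<forall>\<sigma> x. \<sigma> permutes {0..<n} \<and> x \<in> CD n \<longrightarrow> H n (act n \<sigma> x) = perm_act \<sigma> (H n x)) \<and>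
        rspan (H n ` CD n) = W2 n)"

definition is_faithful_comb_description ::
    "(nat \<Rightarrow> 'c set) \<Rightarrow> (nat \<Rightarrow> (nat \<Rightarrow> nat) \<Rightarrow> 'c \<Rightarrow> 'c) \<Rightarrow> (nat \<Rightarrow> 'c \<Rightarrow> nmap) \<Rightarrow> bool" where
  "is_faithful_comb_description CD act H \<longleftrightarrow>
     is_comb_description CD act H \<and> (\<forall>n\<ge>1. rindep (H n ` CD n))"

end

theory Submission
  imports Defs "HOL-Combinatorics.Permutations"
begin

text \<open>
  A basis of \<open>W\<^sub>2(7)\<close> that is permuted by the symmetric group would force every permutation to have
  a nonnegative trace, namely the number of basis elements that it fixes.  The permutation
  \<open>\<sigma> = (0 1 2)(3 4)(5 6)\<close> has trace \<open>-4\<close>.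

  Expanding \<open>F(\<tau>)\<close> in coordinates gives a sum over colourings of the vertices by \<open>{1, 2}\<close>, in which
  every vertex contributes a partial derivative that depends only on the numbers of its children of
  either colour.  Evaluation at monomial vector fields separates these contributions.  So
  \<open>\<Sum> k(\<tau>) F(\<tau>) = 0\<close> holds iff for every set \<open>S\<close> of vertices the coefficients of the trees with
  the same out-degrees and the same multiset of parents of \<open>S\<close> sum to \<open>0\<close>; these sums are called rows below.

  In particular \<open>W\<^sub>2(7)\<close> is graded by the out-degrees, and only the five blocks with \<open>\<sigma>\<close>-invariant
  out-degrees contribute to the trace.  Since \<open>\<sigma>\<close> fixes no vertex it fixes no tree, hence the trace
  on such a block is minus the trace on the relations: \<open>0\<close> (twice, there are no relations),
  \<open>-2\<close> (three vertices with two children) and \<open>-1\<close> (twice).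
\<close>

text \<open>Relations exist because there are only two colours. If three vertices exchange their
  parents, then in every colouring two of the three agree, so the alternating sum over the exchanges
  cancels in every row. The six-term relations of the certificates are of this kind.

  The hypothetical basis need not be homogeneous for the out-degrees, so its elements cannot be
  sorted into blocks. The trace is therefore moved to the trees: every matrix \<open>P\<close> that
  projects formal combinations of trees along the relations computes it, and \<open>P\<close> may be
  replaced by its homogeneous part, since a relation splits into relations inside the blocks. What
  remains are blocks of 20, 90 and 180 trees out of 7^6.

  Inside a block, a list of valid relations could be incomplete, which would falsify the trace. Each
  certificate therefore also gives, for every tree that is not a pivot, a row that forces its
  coefficient to vanish once the coefficients of the pivots do. So the listed relations are a basis
  of all relations of the block.\<close>

section \<open>Symmetry of iterated partial derivatives\<close>

text \<open>The second difference on the left is symmetric in \<open>u\<close> and \<open>v\<close>,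
  whereas \<open>C\<close> is an iterated derivative in one fixed order. The mean value theorem is
  applied along \<open>u\<close> to the difference of two parallel lines and then along
  \<open>v\<close>.\<close>

lemma mixed_difference:
  fixes \<phi> :: "'a::real_vector \<Rightarrow> real"
  assumes 1: "\<And>y. ((\<lambda>t. \<phi> (y + t *\<^sub>R u)) has_real_derivative A y) (at 0)"
    and 2: "\<And>y. ((\<lambda>t. A (y + t *\<^sub>R v)) has_real_derivative C y) (at 0)"
    and h: "0 < h"
  shows "\<exists>\<xi> \<eta>. 0 < \<xi> \<and> \<xi> < h \<and> 0 < \<eta> \<and> \<eta> < h \<and>
     \<phi> (x + h *\<^sub>R u + h *\<^sub>R v) - \<phi> (x + h *\<^sub>R u) - \<phi> (x + h *\<^sub>R v) + \<phi> x
       = h\<^sup>2 * C (x + \<xi> *\<^sub>R u + \<eta> *\<^sub>R v)"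
proof -
  \<comment> \<open>The hypotheses give derivatives at parameter 0 for every base point; moving the
    base point along the line gives them at every parameter, as \<open>MVT2\<close>
    requires.\<close>
  have shift: "((\<lambda>t. g (y + t *\<^sub>R w)) has_real_derivative G (y + t *\<^sub>R w)) (at t)"
    if "\<And>y. ((\<lambda>t. g (y + t *\<^sub>R w)) has_real_derivative G y) (at 0)" for g G :: "'a \<Rightarrow> real" and w y t
  proof -
    have "((\<lambda>s. g ((y + t *\<^sub>R w) + s *\<^sub>R w)) has_real_derivative G (y + t *\<^sub>R w)) (at (t + - t))"
      using that[of "y + t *\<^sub>R w"] by simp
    then have "((\<lambda>s. g ((y + t *\<^sub>R w) + (s + - t) *\<^sub>R w)) has_real_derivative G (y + t *\<^sub>R w)) (at t)"
      by (subst (asm) DERIV_shift) (simp add: add.commute)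
    then show ?thesis by (simp add: algebra_simps)
  qed
  define g where "g = (\<lambda>t. \<phi> ((x + h *\<^sub>R v) + t *\<^sub>R u) - \<phi> (x + t *\<^sub>R u))"
  have "\<exists>\<xi>>0. \<xi> < h \<and> g h - g 0 = (h - 0) * (A ((x + h *\<^sub>R v) + \<xi> *\<^sub>R u) - A (x + \<xi> *\<^sub>R u))"
    unfolding g_def by (rule MVT2[OF h]) (intro DERIV_diff shift[OF 1])
  then obtain \<xi> where \<xi>: "0 < \<xi>" "\<xi> < h"
    "g h - g 0 = h * (A ((x + h *\<^sub>R v) + \<xi> *\<^sub>R u) - A (x + \<xi> *\<^sub>R u))" by auto
  have "\<exists>\<eta>>0. \<eta> < h \<and> A ((x + \<xi> *\<^sub>R u) + h *\<^sub>R v) - A ((x + \<xi> *\<^sub>R u) + 0 *\<^sub>R v)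
      = (h - 0) * C ((x + \<xi> *\<^sub>R u) + \<eta> *\<^sub>R v)"
    by (rule MVT2[OF h]) (rule shift[OF 2])
  then obtain \<eta> where \<eta>: "0 < \<eta>" "\<eta> < h"
    "A ((x + h *\<^sub>R v) + \<xi> *\<^sub>R u) - A (x + \<xi> *\<^sub>R u) = h * C (x + \<xi> *\<^sub>R u + \<eta> *\<^sub>R v)"
    by (auto simp: algebra_simps)
  show ?thesis
    using \<xi> \<eta> by (intro exI[of _ \<xi>] exI[of _ \<eta>]) (simp add: g_def power2_eq_square algebra_simps)
qed

lemma partial_has_derivative:
  assumes "f differentiable (at y)"
  shows "((\<lambda>t. f (y + t *\<^sub>R axis j 1) $ i) has_real_derivative partial j f y $ i) (at 0)"
proof -
  define F where "F = frechet_derivative f (at y)"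
  have F: "(f has_derivative F) (at (y + 0 *\<^sub>R axis j 1))"
    unfolding F_def using assms by (simp add: frechet_derivative_works)
  interpret F: linear F using F by (rule has_derivative_linear)
  have "((\<lambda>t. f (y + t *\<^sub>R axis j 1)) has_derivative (\<lambda>t. F (t *\<^sub>R axis j 1))) (at 0)"
    by (rule has_derivative_compose[where f = "\<lambda>t. y + t *\<^sub>R axis j 1", OF _ F])
      (auto intro!: derivative_eq_intros)
  then have "((\<lambda>t. f (y + t *\<^sub>R axis j 1) $ i) has_derivative (\<lambda>t. F (t *\<^sub>R axis j 1) $ i)) (at 0)"
    by (rule bounded_linear.has_derivative[OF bounded_linear_vec_nth])
  moreover have "(\<lambda>t. F (t *\<^sub>R axis j 1) $ i) = (*) (partial j f y $ i)"
    by (simp add: F.scaleR fun_eq_iff) (simp add: partial_def F_def mult.commute)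
  ultimately show ?thesis
    by (simp add: has_field_derivative_def)
qed

text \<open>Schwarz's theorem. Applied in both orders, \<open>mixed_difference\<close> yields equal
  values of the two mixed partials at two points close to \<open>x\<close>; the mixed partials are
  continuous because they are differentiable, so the equality passes to the limit.\<close>

lemma partial_commute:
  assumes f: "f differentiable_on UNIV" "\<And>j. partial j f differentiable_on UNIV"
    "\<And>j k. partial k (partial j f) differentiable_on UNIV"
  shows "partial a (partial b f) = partial b (partial a f)"
proof (intro ext vec_eq_iff[THEN iffD2] allI)
  fix x :: R2 and i :: 2
  define C where "C = (\<lambda>j k y. partial j (partial k f) y $ i)"
  have cont: "isCont (C j k) x" for j k
    using f(3)[of j k] unfolding C_def differentiable_on_def
    by (intro continuous_intros) (auto intro: differentiable_imp_continuous_within)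
  have d: "((\<lambda>t. f (y + t *\<^sub>R axis j 1) $ i) has_real_derivative partial j f y $ i) (at 0)"
    "((\<lambda>t. partial j f (y + t *\<^sub>R axis k 1) $ i) has_real_derivative C k j y) (at 0)" for j k y
    using f by (auto intro!: partial_has_derivative simp: differentiable_on_def C_def)
  define p where "p = (\<lambda>j k (s::real \<times> real). x + fst s *\<^sub>R axis j 1 + snd s *\<^sub>R (axis k 1 :: R2))"
  have "\<exists>s t. \<bar>fst s\<bar> < h \<and> \<bar>snd s\<bar> < h \<and> \<bar>fst t\<bar> < h \<and> \<bar>snd t\<bar> < h \<and> C a b (p b a s) = C b a (p a b t)"
    if h: "0 < h" for h :: real
  proof -
    obtain s1 s2 where s: "0 < s1" "s1 < h" "0 < s2" "s2 < h"
      "f (x + h *\<^sub>R axis b 1 + h *\<^sub>R axis a 1) $ i - f (x + h *\<^sub>R axis b 1) $ i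
        - f (x + h *\<^sub>R axis a 1) $ i + f x $ i = h\<^sup>2 * C a b (p b a (s1, s2))"
      unfolding p_def fst_conv snd_conv
      using mixed_difference[where \<phi> = "\<lambda>y. f y $ i", OF d(1)[where j = b] d(2)[where j = b and k = a] h, where x = x]
      by auto
    obtain t1 t2 where t: "0 < t1" "t1 < h" "0 < t2" "t2 < h"
      "f (x + h *\<^sub>R axis a 1 + h *\<^sub>R axis b 1) $ i - f (x + h *\<^sub>R axis a 1) $ i
        - f (x + h *\<^sub>R axis b 1) $ i + f x $ i = h\<^sup>2 * C b a (p a b (t1, t2))"
      unfolding p_def fst_conv snd_conv
      using mixed_difference[where \<phi> = "\<lambda>y. f y $ i", OF d(1)[where j = a] d(2)[where j = a and k = b] h, where x = x]
      by auto
    have "h\<^sup>2 * C a b (p b a (s1, s2)) = h\<^sup>2 * C b a (p a b (t1, t2))"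
      unfolding s(5)[symmetric] t(5)[symmetric] by (simp add: add_ac)
    then have "C a b (p b a (s1, s2)) = C b a (p a b (t1, t2))"
      using h by simp
    with s t show ?thesis
      by (intro exI[of _ "(s1, s2)"] exI[of _ "(t1, t2)"]) simp
  qed
  note ex = this
  \<comment> \<open>A pair \<open>st\<close> holds the parameters of the two intermediate points for
    the step width \<open>1 / (n + 1)\<close>; both points tend to \<open>x\<close>.\<close>
  define good where "good = (\<lambda>n st. \<bar>fst (fst st)\<bar> < inverse (real (Suc n)) \<and> \<bar>snd (fst st)\<bar> < inverse (real (Suc n)) \<and>
      \<bar>fst (snd st)\<bar> < inverse (real (Suc n)) \<and> \<bar>snd (snd st)\<bar> < inverse (real (Suc n)) \<and>
      C a b (p b a (fst st)) = C b a (p a b (snd st)))"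
  have "\<exists>st. good n st" for n
  proof -
    obtain s t where "\<bar>fst s\<bar> < inverse (real (Suc n)) \<and> \<bar>snd s\<bar> < inverse (real (Suc n)) \<and>
      \<bar>fst t\<bar> < inverse (real (Suc n)) \<and> \<bar>snd t\<bar> < inverse (real (Suc n)) \<and> C a b (p b a s) = C b a (p a b t)"
      using ex[of "inverse (real (Suc n))"] by auto
    then show ?thesis unfolding good_def by (intro exI[of _ "(s, t)"]) simp
  qed
  then obtain st where "\<And>n. good n (st n)" by metis
  note st = this[unfolded good_def]
  have z: "(\<lambda>n. g (st n)) \<longlonglongrightarrow> 0" if "\<And>n. \<bar>g (st n)\<bar> < inverse (Suc n)" for g :: "_ \<Rightarrow> real"
    by (rule Lim_null_comparison[OF _ LIMSEQ_inverse_real_of_nat]) (use that in \<open>auto intro!: always_eventually less_imp_le\<close>)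
  have lim: "(\<lambda>n. p j k (g (st n))) \<longlonglongrightarrow> x"
    if "\<And>n. \<bar>fst (g (st n))\<bar> < inverse (real (Suc n))" "\<And>n. \<bar>snd (g (st n))\<bar> < inverse (real (Suc n))" for g j k
  proof -
    have "(\<lambda>n. p j k (g (st n))) \<longlonglongrightarrow> x + 0 *\<^sub>R axis j 1 + 0 *\<^sub>R axis k 1"
      unfolding p_def by (intro tendsto_intros z that)
    then show ?thesis by simp
  qed
  have "(\<lambda>n. C a b (p b a (fst (st n)))) \<longlonglongrightarrow> C a b x"
    by (rule isCont_tendsto_compose[OF cont lim]) (simp_all only: st)
  moreover have "(\<lambda>n. C b a (p a b (snd (st n)))) \<longlonglongrightarrow> C b a x"
    by (rule isCont_tendsto_compose[OF cont lim]) (simp_all only: st)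
  moreover have "C a b (p b a (fst (st n))) = C b a (p a b (snd (st n)))" for n
    by (simp only: st)
  ultimately have "(\<lambda>n. C b a (p a b (snd (st n)))) \<longlonglongrightarrow> C a b x" by simp
  then have "C a b x = C b a x"
    using \<open>(\<lambda>n. C b a (p a b (snd (st n)))) \<longlonglongrightarrow> C b a x\<close> by (rule LIMSEQ_unique)
  then show "partial a (partial b f) x $ i = partial b (partial a f) x $ i"
    by (simp add: C_def)
qed

lemma multipartial_append: "multipartial (as @ bs) f = multipartial as (multipartial bs f)"
  by (induction as) auto

lemma smooth2_multipartial: "smooth2 f \<Longrightarrow> smooth2 (multipartial js f)"
  by (simp add: smooth2_def flip: multipartial_append)

lemma smooth2_partial_commute:
  assumes "smooth2 f"
  shows "partial a (partial b f) = partial b (partial a f)"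
proof (rule partial_commute)
  show "f differentiable_on UNIV" "partial j f differentiable_on UNIV"
    "partial k (partial j f) differentiable_on UNIV" for j k
    using assms[unfolded smooth2_def, rule_format, of "[]"] assms[unfolded smooth2_def, rule_format, of "[j]"]
      assms[unfolded smooth2_def, rule_format, of "[k, j]"] by simp_all
qed

text \<open>\<open>Fsub\<close> differentiates in the order of the labels of the children.
  Independence of the order is what reduces a vertex to the numbers of its children of either
  colour.\<close>

lemma multipartial_mset_cong:
  assumes "smooth2 f" "mset js = mset js'"
  shows "multipartial js f = multipartial js' f"
  using assms(2)
proof (induction js arbitrary: js')
  case (Cons i js)
  then have "i \<in> set js'" by (metis list.set_intros(1) mset_eq_setD)
  then obtain as bs where js': "js' = as @ i # bs" by (meson split_list)
  have move: "multipartial (as @ i # bs) f = multipartial (i # as @ bs) f" for as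
  proof (induction as)
    case (Cons a as)
    then show ?case
      using smooth2_partial_commute[OF smooth2_multipartial[OF assms(1), of "as @ bs"], of a i] by simp
  qed simp
  show ?case
    using Cons.IH[of "as @ bs"] Cons.prems move[of as] by (simp add: js')
qed simp

section \<open>Trees as parent lists\<close>

text \<open>A tree on \<open>{0..<n}\<close> is encoded by the list of the parents of its vertices, where the root has parent \<open>n\<close>.\<close>
definition par :: "nat list \<Rightarrow> nat \<Rightarrow> nat" where
  "par p v = (if v < length p then p ! v else length p)"

text \<open>\<open>par\<close> fixes the virtual vertex \<open>n\<close>, so the last conjunct says
  that following parents leads out of the tree through the root, which excludes cycles. A vertex has
  depth less than \<open>n\<close>, so \<open>n\<close> steps are enough.\<close>

definition ptree :: "nat \<Rightarrow> nat list \<Rightarrow> bool" where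
  "ptree n p \<longleftrightarrow> length p = n \<and> set p \<subseteq> {..n} \<and> (\<exists>!r. r < n \<and> p ! r = n) \<and> (\<forall>w<n. (par p ^^ n) w = n)"

definition edges :: "nat list \<Rightarrow> (nat \<times> nat) set" where
  "edges p = {(p ! w, w) |w. w < length p \<and> p ! w < length p}"

definition proot :: "nat list \<Rightarrow> nat" where
  "proot p = (THE r. r < length p \<and> p ! r = length p)"

lemma ptree_length: "ptree n p \<Longrightarrow> length p = n"
  by (simp add: ptree_def)

lemma ptree_le: "ptree n p \<Longrightarrow> w < n \<Longrightarrow> p ! w \<le> n"
  unfolding ptree_def by (metis atMost_iff nth_mem subsetD)

lemma proot: assumes "ptree n p" shows "proot p < n" "p ! proot p = n"
    "\<And>w. w < n \<Longrightarrow> p ! w = n \<longleftrightarrow> w = proot p"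
proof -
  have ex: "\<exists>!r. r < length p \<and> p ! r = length p" using assms by (simp add: ptree_def)
  show "proot p < n" "p ! proot p = n" using theI'[OF ex] assms by (auto simp: proot_def ptree_def)
  then show "\<And>w. w < n \<Longrightarrow> p ! w = n \<longleftrightarrow> w = proot p" using ex assms by (auto simp: ptree_def)
qed

lemma finite_ptree: "finite {p. ptree n p}"
proof (rule finite_subset)
  show "{p. ptree n p} \<subseteq> {p. set p \<subseteq> {..n} \<and> length p = n}" by (auto simp: ptree_def)
qed (simp add: finite_lists_length_eq)

lemma par_funpow_stable: "(par p ^^ k) w = length p \<Longrightarrow> k \<le> l \<Longrightarrow> (par p ^^ l) w = length p"
proof -
  have "(par p ^^ m) (length p) = length p" for m by (induction m) (auto simp: par_def)
  moreover have "par p ^^ l = par p ^^ (l - k) \<circ> par p ^^ k" if "k \<le> l"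
    using that by (simp flip: funpow_add)
  ultimately show "(par p ^^ k) w = length p \<Longrightarrow> k \<le> l \<Longrightarrow> (par p ^^ l) w = length p"
    by simp
qed

lemma edges_in_RT:
  assumes p: "ptree n p"
  shows "edges p \<in> RT n"
proof -
  note len = ptree_length[OF p] note r = proot[OF p]
  have reach: "(par p ^^ k) w = n \<Longrightarrow> w < n \<Longrightarrow> (proot p, w) \<in> (edges p)\<^sup>*" for k w
  proof (induction k arbitrary: w)
    case (Suc k)
    show ?case
    proof (cases "w = proot p")
      case False
      then have lt: "p ! w < n" using r(3)[of w] ptree_le[OF p, of w] Suc.prems by simp
      then have "(p ! w, w) \<in> edges p" using Suc.prems len by (auto simp: edges_def)
      moreover have "(proot p, p ! w) \<in> (edges p)\<^sup>*"
        using Suc.IH[of "p ! w"] Suc.prems(1)[unfolded funpow_Suc_right o_apply] Suc.prems(2) lt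
        by (simp add: par_def[of p w] len)
      ultimately show ?thesis by (rule rtrancl_into_rtrancl[rotated])
    qed simp
  qed simp
  have "\<exists>!v. (v, w) \<in> edges p" if "w < n" "w \<noteq> proot p" for w
    using r(3)[of w] ptree_le[OF p, of w] that len by (auto simp: edges_def)
  moreover have "(v, proot p) \<notin> edges p" for v using r(2) len by (auto simp: edges_def)
  moreover have "(proot p, w) \<in> (edges p)\<^sup>*" if "w < n" for w
    using reach[of n w] p that by (auto simp: ptree_def)
  moreover have "edges p \<subseteq> {0..<n} \<times> {0..<n}" using len by (auto simp: edges_def)
  ultimately show ?thesis
    unfolding RT_def is_rooted_tree_def mem_Collect_eq using r(1)
    by (intro conjI exI[of _ "proot p"] allI impI) simp_all
qed

lemma RT_eq_edges:
  assumes "E \<in> RT n"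
  shows "\<exists>p. ptree n p \<and> edges p = E"
proof -
  obtain r where sub: "E \<subseteq> {0..<n} \<times> {0..<n}" and r: "r < n" "\<And>v. (v, r) \<notin> E"
    "\<And>w. w < n \<Longrightarrow> w \<noteq> r \<Longrightarrow> \<exists>!v. (v, w) \<in> E" "\<And>w. w < n \<Longrightarrow> (r, w) \<in> E\<^sup>*"
    using assms unfolding RT_def is_rooted_tree_def by blast
  define P where "P = (\<lambda>w. if w = r then n else THE v. (v, w) \<in> E)"
  have P: "(v, w) \<in> E \<longleftrightarrow> v = P w" if "w < n" "w \<noteq> r" for v w
    using theI'[OF r(3)[OF that]] r(3)[OF that] that by (auto simp: P_def)
  have Plt: "P w < n" if "w < n" "w \<noteq> r" for w
    using P[OF that, of "P w"] sub by auto
  define p where "p = map P [0..<n]"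
  have len: "length p = n" and nth: "\<And>w. w < n \<Longrightarrow> p ! w = P w" by (simp_all add: p_def)
  have Er: "v < n \<and> w < n \<and> w \<noteq> r" if "(v, w) \<in> E" for v w using that sub r(2) by auto
  have "(v, w) \<in> edges p \<longleftrightarrow> w < n \<and> w \<noteq> r \<and> v = P w" for v w
    using Plt[of w] by (auto simp: edges_def len nth) (simp add: P_def)
  moreover have "(v, w) \<in> E \<longleftrightarrow> w < n \<and> w \<noteq> r \<and> v = P w" for v w
    using P[of w v] Er[of v w] by blast
  ultimately have E: "edges p = E" by auto
  have pw: "(par p ^^ Suc k) w = n" if "(r, w) \<in> E ^^ k" "w < n" for k w
    using that
  proof (induction k arbitrary: w)
    case 0
    then show ?case using r(1) by (simp add: par_def len nth P_def)
  next
    case (Suc k)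
    then obtain v where v: "(r, v) \<in> E ^^ k" "(v, w) \<in> E" by auto
    then have "par p w = v" "v < n" using Er[OF v(2)] P by (auto simp: par_def len nth)
    then show ?case using Suc.IH[OF v(1)] by (simp add: funpow_Suc_right del: funpow.simps(2))
  qed
  \<comment> \<open>A path from the root can be chosen no longer than the number of edges, and there
    are at most \<open>n - 1\<close> edges, one for each vertex other than the root. The additional
    step goes from the root to \<open>n\<close>.\<close>
  have fin: "finite E" using sub by (rule finite_subset) simp
  have "E \<subseteq> (\<lambda>w. (P w, w)) ` ({..<n} - {r})"
  proof (rule subrelI)
    fix v w assume vw: "(v, w) \<in> E"
    then have "v = P w" "w \<in> {..<n} - {r}" using P[of w v] Er[OF vw] by auto
    then show "(v, w) \<in> (\<lambda>w. (P w, w)) ` ({..<n} - {r})" by (rule_tac image_eqI[of _ _ w]) simp_all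
  qed
  then have "card E \<le> card ({..<n} - {r})" by (rule surj_card_le[rotated]) simp
  then have card: "Suc (card E) \<le> n" using r(1) by simp
  have "(par p ^^ n) w = n" if w: "w < n" for w
  proof -
    obtain k where k: "(r, w) \<in> E ^^ k" "k \<le> card E"
      using r(4)[OF w] rtrancl_finite_eq_relpow[OF fin] by auto
    show ?thesis using par_funpow_stable[where p = p and k = "Suc k" and w = w and l = n] pw[OF k(1) w] k(2) card len by simp
  qed
  moreover have root: "p ! q = n \<longleftrightarrow> q = r" if "q < n" for q
    using Plt[of q] nth[OF that] that by (cases "q = r") (simp_all add: P_def)
  then have "\<exists>!q. q < n \<and> p ! q = n" using r(1) by blast
  moreover have "P w \<le> n" if "w < n" for w
    using Plt[of w] that by (cases "w = r") (simp_all add: P_def)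
  then have "set p \<subseteq> {..n}" by (auto simp: p_def)
  ultimately show ?thesis using E len unfolding ptree_def by blast
qed

lemma RT_image: "RT n = edges ` {p. ptree n p}"
  using edges_in_RT RT_eq_edges by blast

lemma tree_root_edges:
  assumes p: "ptree n p" shows "tree_root n (edges p) = proot p"
  unfolding tree_root_def
proof (rule the_equality)
  show "proot p < n \<and> (\<forall>v. (v, proot p) \<notin> edges p)"
    using proot(1,2)[OF p] ptree_length[OF p] unfolding edges_def by simp
  fix r assume r: "r < n \<and> (\<forall>v. (v, r) \<notin> edges p)"
  show "r = proot p"
  proof (rule ccontr)
    assume "r \<noteq> proot p"
    then have "p ! r < n" using proot(3)[OF p, of r] ptree_le[OF p, of r] r by simp
    then have "(p ! r, r) \<in> edges p" using r ptree_length[OF p] by (auto simp: edges_def)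
    with r show False by blast
  qed
qed

lemma children_edges:
  assumes p: "ptree n p" shows "v < n \<Longrightarrow> children (edges p) v = {w. w < n \<and> p ! w = v}"
  using ptree_length[OF p] by (auto simp: children_def edges_def)

section \<open>Expanding tree maps over colourings\<close>

lemma sum_PiE_Un:
  assumes "A \<inter> B = {}"
  shows "(\<Sum>j\<in>PiE A X. \<Sum>h\<in>PiE B X. \<phi> j h) = (\<Sum>f\<in>PiE (A \<union> B) X. \<phi> (restrict f A) (restrict f B))"
  unfolding sum.cartesian_product
proof (rule sum.reindex_bij_witness[where i = "\<lambda>f. (restrict f A, restrict f B)"
      and j = "\<lambda>(j, h) x. if x \<in> A then j x else h x"], goal_cases)
  case (1 a)
  then show ?case using assms by (auto simp: fun_eq_iff PiE_def extensional_def restrict_def)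
next
  case (2 a)
  then show ?case by (auto simp: PiE_def extensional_def Pi_def)
next
  case (3 b)
  then show ?case by (auto simp: fun_eq_iff PiE_def extensional_def restrict_def)
next
  case (4 b)
  then show ?case by (auto simp: PiE_def)
next
  case (5 a)
  have "restrict (\<lambda>x. if x \<in> A then fst a x else snd a x) A = fst a"
    "restrict (\<lambda>x. if x \<in> A then fst a x else snd a x) B = snd a"
    using 5 assms by (auto simp: fun_eq_iff PiE_def extensional_def restrict_def)
  then show ?case by (simp add: case_prod_unfold)
qed

text \<open>This expands one level of the recursion: since no vertex has two parents, separate
  colourings of the children of several vertices amount to one colouring of all these
  children.\<close>

lemma prod_sum_PiE_disjoint:
  fixes h :: "'a \<Rightarrow> ('b \<Rightarrow> 'c) \<Rightarrow> 'd::comm_semiring_1"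
  assumes "finite A" "disjoint_family_on C A"
  shows "(\<Prod>a\<in>A. \<Sum>J\<in>C a \<rightarrow>\<^sub>E X. h a J) = (\<Sum>J\<in>(\<Union>a\<in>A. C a) \<rightarrow>\<^sub>E X. \<Prod>a\<in>A. h a (restrict J (C a)))"
  using assms
proof (induction A)
  case (insert a A)
  define U where "U = (\<Union>a\<in>A. C a)"
  have disj: "C a \<inter> U = {}" and fam: "disjoint_family_on C A"
    using insert.prems insert.hyps unfolding U_def disjoint_family_on_def by auto
  have "(\<Prod>a\<in>insert a A. \<Sum>J\<in>C a \<rightarrow>\<^sub>E X. h a J)
      = (\<Sum>J\<in>C a \<rightarrow>\<^sub>E X. h a J) * (\<Sum>J\<in>U \<rightarrow>\<^sub>E X. \<Prod>a\<in>A. h a (restrict J (C a)))"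
    unfolding prod.insert[OF insert.hyps] insert.IH[OF fam] U_def ..
  also have "\<dots> = (\<Sum>J\<in>C a \<rightarrow>\<^sub>E X. \<Sum>J'\<in>U \<rightarrow>\<^sub>E X. h a J * (\<Prod>a\<in>A. h a (restrict J' (C a))))"
    by (simp add: sum_product)
  also have "\<dots> = (\<Sum>f\<in>C a \<union> U \<rightarrow>\<^sub>E X. h a (restrict f (C a)) * (\<Prod>a\<in>A. h a (restrict (restrict f U) (C a))))"
    by (rule sum_PiE_Un[OF disj])
  also have "\<dots> = (\<Sum>f\<in>C a \<union> U \<rightarrow>\<^sub>E X. h a (restrict f (C a)) * (\<Prod>a\<in>A. h a (restrict f (C a))))"
  proof (intro sum.cong refl arg_cong2[of _ _ _ _ "(*)"] prod.cong)
    fix f b assume "b \<in> A"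
    then have "U \<inter> C b = C b" by (auto simp: U_def)
    then show "h b (restrict (restrict f U) (C b)) = h b (restrict f (C b))" by simp
  qed
  finally show ?case unfolding prod.insert[OF insert.hyps] UN_insert U_def .
qed simp

section \<open>Partial derivatives in terms of colour counts\<close>

definition mixed_partial :: "vf \<Rightarrow> nat \<Rightarrow> nat \<Rightarrow> vf" where
  "mixed_partial f a b = multipartial (replicate a 1 @ replicate b 2) f"

lemma image_mset_two:
  fixes j :: "'a \<Rightarrow> 2"
  assumes "finite C"
  shows "image_mset j (mset_set C) = replicate_mset (card {w \<in> C. j w = 1}) 1 + replicate_mset (card {w \<in> C. j w \<noteq> 1}) 2"
  using assms
proof (induction C)
  case (insert c C)
  have 1: "{w \<in> insert c C. Q w} = (if Q c then insert c {w \<in> C. Q w} else {w \<in> C. Q w})" for Q by auto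
  show ?case
    using insert exhaust_2[of "j c"] unfolding 1 by (auto simp: card_insert_if)
qed simp

lemma multipartial_children:
  assumes "smooth2 f" "finite C"
  shows "multipartial (map j (sorted_list_of_set C)) f = mixed_partial f (card {w \<in> C. j w = 1}) (card {w \<in> C. j w \<noteq> 1})"
proof -
  have "mset (sorted_list_of_set C) = mset_set C"
    using mset_set_set[of "sorted_list_of_set C"] assms by simp
  then show ?thesis
    unfolding mixed_partial_def
    by (intro multipartial_mset_cong) (use assms image_mset_two[of C j] in simp_all)
qed

definition lower :: "nat list \<Rightarrow> nat \<Rightarrow> nat set" where
  "lower p k = {w. w < length p \<and> (par p ^^ k) w = length p}"

text \<open>The tree is expanded by depth; \<open>lower p k\<close> consists of the vertices of
  depth less than \<open>k\<close>. These already contribute partial derivatives, while the vertices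
  of depth exactly \<open>k\<close> still carry their recursive values, with the remaining fuel
  \<open>n - k\<close>. At \<open>k = n\<close> no recursive value is left.\<close>

lemma Fsub_expand:
  assumes p: "ptree n p" and "k \<le> n"
  shows "Fsub n (edges p) g (proot p) x $ i =
    (\<Sum>j\<in>lower p (Suc k) \<rightarrow>\<^sub>E UNIV. of_bool (j (proot p) = i) *
      (\<Prod>u\<in>lower p k. multipartial (map j (sorted_list_of_set (children (edges p) u))) (g u) x $ j u) *
      (\<Prod>c\<in>lower p (Suc k) - lower p k. Fsub (n - k) (edges p) g c x $ j c))"
  using assms(2)
proof (induction k)
  case 0
  have "lower p (Suc 0) = {proot p}" "lower p 0 = {}"
    using proot[OF p] ptree_length[OF p] by (auto simp: lower_def par_def)
  moreover have "{proot p} \<rightarrow>\<^sub>E UNIV = (\<lambda>c. \<lambda>_\<in>{proot p}. c) ` (UNIV :: 2 set)"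
    by (auto simp: PiE_def extensional_def image_iff fun_eq_iff)
  moreover have "inj (\<lambda>c. \<lambda>_\<in>{proot p}. c :: 2)"
    by (rule injI) (metis restrict_apply' singletonI)
  ultimately show ?case
    by (simp add: sum.reindex of_bool_def if_distrib[of "\<lambda>t. t * _"] cong: if_cong)
next
  case (Suc k)
  define r where "r = proot p"
  define U where "U = lower p"
  define L where "L = (\<lambda>k. U (Suc k) - U k)"
  define C where "C = children (edges p)"
  define d where "d = n - Suc k"
  define M where "M = (\<lambda>u j. multipartial (map j (sorted_list_of_set (C u))) (g u) x $ (j u))"
  define G where "G = (\<lambda>c j. Fsub d (edges p) g c x $ (j c))"
  have d: "n - k = Suc d" using Suc.prems by (simp add: d_def)
  note len = ptree_length[OF p]
  have fin: "finite (U k)" for k by (simp add: U_def lower_def)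
  then have finL: "finite (L k)" for k by (simp add: L_def)
  have mono: "U k \<subseteq> U (Suc k)" for k
    using par_funpow_stable[of k p _ "Suc k"] by (auto simp: U_def lower_def)
  have C: "C u = {w. w < n \<and> p ! w = u}" if "u < n" for u
    using children_edges[OF p that] by (simp add: C_def)
  have Ult: "u < n" if "u \<in> U k" for u k using that by (simp add: U_def lower_def len)
  have rU: "r \<in> U (Suc k)" for k
  proof -
    have "(par p ^^ Suc 0) r = length p" using proot[OF p] by (simp add: r_def par_def len)
    then have "(par p ^^ Suc k) r = length p" by (rule par_funpow_stable) simp
    then show ?thesis using proot(1)[OF p] by (simp add: U_def lower_def len r_def)
  qed
  have step: "w \<in> U (Suc m) \<longleftrightarrow> w < n \<and> (p ! w = n \<or> p ! w \<in> U m)" for w m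
  proof (cases "w < n")
    case True
    have "(par p ^^ m) (length p) = length p"
      using par_funpow_stable[of 0 p "length p" m] by simp
    with True show ?thesis
      using ptree_le[OF p True] unfolding U_def lower_def funpow_Suc_right
      by (auto simp: par_def[of p w] len)
  qed (simp add: U_def lower_def len)
  have CU: "C u \<subseteq> U (Suc m)" if "u \<in> U m" for u m
    using that Ult[OF that] by (auto simp: C step)
  have Lsub: "L k \<subseteq> U (Suc k)" by (auto simp: L_def)
  have disj: "disjoint_family_on C (L k)"
  proof -
    have "p ! w = c" if "c \<in> L k" "w \<in> C c" for c w
    proof -
      have "c < n" using that(1) Lsub Ult by blast
      with that(2) show ?thesis by (simp add: C)
    qed
    then show ?thesis by (auto simp: disjoint_family_on_def)
  qed
  have UL: "(\<Union>c\<in>L k. C c) = L (Suc k)"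
  proof (intro set_eqI iffI)
    fix w assume "w \<in> (\<Union>c\<in>L k. C c)"
    then obtain c where c: "c \<in> U (Suc k)" "c \<notin> U k" "w \<in> C c" by (auto simp: L_def)
    then have "w < n" "p ! w = c" "c < n" using Ult[OF c(1)] by (auto simp: C)
    then show "w \<in> L (Suc k)" using c by (auto simp: L_def step[of w])
  next
    fix w assume "w \<in> L (Suc k)"
    then have w: "w < n" "p ! w \<in> U (Suc k)" "p ! w \<notin> U k" "p ! w \<noteq> n"
      by (auto simp: L_def step[of w])
    then have "w \<in> C (p ! w)" using Ult[OF w(2)] by (simp add: C)
    with w show "w \<in> (\<Union>c\<in>L k. C c)" by (auto simp: L_def)
  qed
  have un: "U (Suc k) \<union> L (Suc k) = U (Suc (Suc k))" "U (Suc k) \<inter> L (Suc k) = {}"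
    "U k \<union> L k = U (Suc k)" "U k \<inter> L k = {}"
    using mono[of "Suc k"] mono[of k] by (auto simp: L_def)
  have Fc: "Fsub (Suc d) (edges p) g c x $ l = (\<Sum>J\<in>C c \<rightarrow>\<^sub>E UNIV. (\<Prod>c'\<in>C c. G c' J) *
        multipartial (map J (sorted_list_of_set (C c))) (g c) x $ l)" for c l
    by (simp add: C_def G_def)
  have finC: "finite (C c)" if "c \<in> L k" for c
    using Lsub CU[of c "Suc k"] fin that by (meson finite_subset subset_iff)
  have restr: "map (restrict f A) (sorted_list_of_set B) = map f (sorted_list_of_set B)"
    if "B \<subseteq> A" "finite B" for f :: "nat \<Rightarrow> 2" and A B
    using that by auto
  \<comment> \<open>Unfolding the values at depth \<open>k\<close> brings in a colouring of the
    children of each such vertex; by \<open>disj\<close> these merge into one colouring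
    \<open>J\<close> of the vertices at depth \<open>k + 1\<close>.\<close>
  have level: "(\<Prod>c\<in>L k. Fsub (Suc d) (edges p) g c x $ j c) =
      (\<Sum>J\<in>L (Suc k) \<rightarrow>\<^sub>E UNIV. \<Prod>c\<in>L k. (\<Prod>c'\<in>C c. G c' J) *
        multipartial (map J (sorted_list_of_set (C c))) (g c) x $ j c)" for j
    unfolding Fc
    apply (subst prod_sum_PiE_disjoint[OF finL disj])
    unfolding UL
    by (intro sum.cong prod.cong arg_cong2[of _ _ _ _ "(*)"] refl) (simp_all add: G_def restr finC)
  have "Fsub n (edges p) g r x $ i = (\<Sum>j\<in>U (Suc k) \<rightarrow>\<^sub>E UNIV. of_bool (j r = i) * (\<Prod>u\<in>U k. M u j) *
      (\<Prod>c\<in>L k. Fsub (Suc d) (edges p) g c x $ j c))"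
    using Suc.IH Suc.prems unfolding d r_def U_def C_def M_def L_def by (simp only: Suc_leD)
  then have "Fsub n (edges p) g r x $ i =
    (\<Sum>j\<in>U (Suc k) \<rightarrow>\<^sub>E UNIV. \<Sum>J\<in>L (Suc k) \<rightarrow>\<^sub>E UNIV. of_bool (j r = i) * (\<Prod>u\<in>U k. M u j) *
      (\<Prod>c\<in>L k. (\<Prod>c'\<in>C c. G c' J) * multipartial (map J (sorted_list_of_set (C c))) (g c) x $ j c))"
    unfolding level sum_distrib_left .
  also have "\<dots> = (\<Sum>f\<in>U (Suc (Suc k)) \<rightarrow>\<^sub>E UNIV. of_bool (restrict f (U (Suc k)) r = i) *
      (\<Prod>u\<in>U k. M u (restrict f (U (Suc k)))) *
      (\<Prod>c\<in>L k. (\<Prod>c'\<in>C c. G c' (restrict f (L (Suc k)))) *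
         multipartial (map (restrict f (L (Suc k))) (sorted_list_of_set (C c))) (g c) x $ restrict f (U (Suc k)) c))"
    unfolding sum_PiE_Un[OF un(2)] un(1) ..
  also have "\<dots> = (\<Sum>f\<in>U (Suc (Suc k)) \<rightarrow>\<^sub>E UNIV. of_bool (f r = i) * (\<Prod>u\<in>U k. M u f) *
      (\<Prod>c\<in>L k. (\<Prod>c'\<in>C c. G c' f) * M c f))"
  proof (intro sum.cong arg_cong2[of _ _ _ _ "(*)"] prod.cong refl)
    fix f
    show "of_bool (restrict f (U (Suc k)) r = i) = (of_bool (f r = i) :: real)" using rU by simp
    show "M u (restrict f (U (Suc k))) = M u f" if "u \<in> U k" for u
    proof -
      have "u \<in> U (Suc k)" "C u \<subseteq> U (Suc k)" "finite (C u)"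
        using that mono[of k] CU[OF that] fin by (auto intro: finite_subset)
      then show ?thesis by (simp add: M_def restr)
    qed
    fix c assume c: "c \<in> L k"
    have cL: "C c \<subseteq> L (Suc k)" using c UL by blast
    show "G c' (restrict f (L (Suc k))) = G c' f" if "c' \<in> C c" for c'
      using cL that by (auto simp: G_def)
    show "multipartial (map (restrict f (L (Suc k))) (sorted_list_of_set (C c))) (g c) x $ restrict f (U (Suc k)) c = M c f"
      unfolding restr[OF cL finC[OF c]] M_def using c Lsub by auto
  qed
  also have "\<dots> = (\<Sum>f\<in>U (Suc (Suc k)) \<rightarrow>\<^sub>E UNIV. of_bool (f r = i) * (\<Prod>u\<in>U (Suc k). M u f) * (\<Prod>c\<in>L (Suc k). G c f))"
  proof (intro sum.cong refl)
    fix f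
    have "(\<Prod>c\<in>L k. \<Prod>c'\<in>C c. G c' f) = (\<Prod>c\<in>L (Suc k). G c f)"
      unfolding UL[symmetric] using finL finC disj
      by (subst prod.UNION_disjoint) (auto simp: disjoint_family_on_def)
    moreover have "(\<Prod>u\<in>U (Suc k). M u f) = (\<Prod>u\<in>U k. M u f) * (\<Prod>c\<in>L k. M c f)"
      unfolding un(3)[symmetric] using fin finL un(4) by (rule prod.union_disjoint)
    ultimately show "of_bool (f r = i) * (\<Prod>u\<in>U k. M u f) * (\<Prod>c\<in>L k. (\<Prod>c'\<in>C c. G c' f) * M c f)
       = of_bool (f r = i) * (\<Prod>u\<in>U (Suc k). M u f) * (\<Prod>c\<in>L (Suc k). G c f)"
      by (simp add: prod.distrib mult_ac)
  qed
  finally show ?case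
    unfolding r_def U_def C_def M_def G_def L_def d_def .
qed

section \<open>Colour profiles and the coordinate formula\<close>

definition plus_count :: "nat list \<Rightarrow> nat set \<Rightarrow> nat \<Rightarrow> nat" where
  "plus_count p S u = card {w. w < length p \<and> w \<in> S \<and> p ! w = u}"

text \<open>\<open>S\<close> is the set of vertices of colour \<open>1\<close>; the value at \<open>n\<close> tells the colour of the root.\<close>
definition profile :: "nat set \<Rightarrow> nat list \<Rightarrow> (nat \<Rightarrow> nat) \<times> (nat \<Rightarrow> nat)" where
  "profile S p = (plus_count p S, plus_count p (- S))"

text \<open>The tree enters only through its profile, the last argument. The indicator keeps the
  colourings in which the root has colour \<open>i\<close>; this is visible at \<open>n\<close>,
  because the root is the only vertex with parent \<open>n\<close>.\<close>

definition weight :: "nat \<Rightarrow> inputs \<Rightarrow> R2 \<Rightarrow> 2 \<Rightarrow> (nat \<Rightarrow> 2) \<Rightarrow> (nat \<Rightarrow> nat) \<times> (nat \<Rightarrow> nat) \<Rightarrow> real" where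
  "weight n g x i j = (\<lambda>(a, b). of_bool ((if i = 1 then a n else b n) = 1) * (\<Prod>u<n. mixed_partial (g u) (a u) (b u) x $ j u))"

definition tree_field :: "nat list \<Rightarrow> nmap" where
  "tree_field p = Fmap (length p) (edges p)"

lemma tree_field_formula:
  assumes p: "ptree n p" and g: "\<And>i. i < n \<Longrightarrow> smooth2 (g i)"
  shows "tree_field p g x $ i = (\<Sum>j\<in>{..<n} \<rightarrow>\<^sub>E UNIV. weight n g x i j (profile {w. j w = 1} p))"
proof -
  note len = ptree_length[OF p]
  have low: "lower p k = {..<n}" if "n \<le> k" for k
    using p par_funpow_stable[of n p _ k] that unfolding lower_def ptree_def by auto
  have "tree_field p g x $ i = Fsub n (edges p) g (proot p) x $ i"
    using g by (simp add: tree_field_def len Fmap_def tree_root_edges[OF p])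
  also have "\<dots> = (\<Sum>j\<in>{..<n} \<rightarrow>\<^sub>E UNIV. of_bool (j (proot p) = i) *
      (\<Prod>u<n. multipartial (map j (sorted_list_of_set (children (edges p) u))) (g u) x $ j u))"
    using Fsub_expand[OF p order_refl, of g x i] by (simp add: low)
  also have "\<dots> = (\<Sum>j\<in>{..<n} \<rightarrow>\<^sub>E UNIV. weight n g x i j (profile {w. j w = 1} p))"
  proof (intro sum.cong refl)
    fix j :: "nat \<Rightarrow> 2" assume "j \<in> {..<n} \<rightarrow>\<^sub>E UNIV"
    have "multipartial (map j (sorted_list_of_set (children (edges p) u))) (g u) x $ j u =
        mixed_partial (g u) (plus_count p {w. j w = 1} u) (plus_count p (- {w. j w = 1}) u) x $ j u" if "u < n" for u
    proof -
      have "{w \<in> children (edges p) u. j w = 1} = {w. w < length p \<and> w \<in> {w. j w = 1} \<and> p ! w = u}"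
        "{w \<in> children (edges p) u. j w \<noteq> 1} = {w. w < length p \<and> w \<in> - {w. j w = 1} \<and> p ! w = u}"
        "finite (children (edges p) u)"
        using children_edges[OF p that] len by auto
      then show ?thesis
        using multipartial_children[OF g[OF that], of "children (edges p) u" j]
        by (simp only: plus_count_def)
    qed
    moreover have "(if i = 1 then plus_count p {w. j w = 1} n else plus_count p (- {w. j w = 1}) n) = 1
        \<longleftrightarrow> j (proot p) = i"
    proof -
      have "{w. w < length p \<and> w \<in> S \<and> p ! w = n} = (if proot p \<in> S then {proot p} else {})" for S
        using proot[OF p] len by auto
      then have "plus_count p S n = of_bool (proot p \<in> S)" for S
        by (simp add: plus_count_def)
      then show ?thesis using exhaust_2[of i] exhaust_2[of "j (proot p)"] by auto
    qed
    ultimately show "of_bool (j (proot p) = i) *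
        (\<Prod>u<n. multipartial (map j (sorted_list_of_set (children (edges p) u))) (g u) x $ j u)
      = weight n g x i j (profile {w. j w = 1} p)"
      by (simp add: weight_def profile_def)
  qed
  finally show ?thesis .
qed

lemma tree_field_not_smooth:
  "\<not> (\<forall>i<length p. smooth2 (g i)) \<Longrightarrow> tree_field p g x = 0"
  by (auto simp: tree_field_def Fmap_def)

section \<open>Relations between tree maps\<close>

text \<open>The factorials normalise the field: at the origin exactly one mixed partial derivative
  is nonzero, the one of order \<open>(a, b)\<close>, and it equals the unit vector
  \<open>axis c 1\<close>.\<close>

definition mono_vf :: "nat \<Rightarrow> nat \<Rightarrow> 2 \<Rightarrow> vf" where
  "mono_vf a b c = (\<lambda>x. ((x $ 1) ^ a / fact a * ((x $ 2) ^ b / fact b)) *\<^sub>R axis c 1)"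

lemma mono_vf_has_derivative:
  "(mono_vf a b c has_derivative (\<lambda>h. (real a * (x $ 1) ^ (a - 1) * h $ 1 / fact a * ((x $ 2) ^ b / fact b)
      + (x $ 1) ^ a / fact a * (real b * (x $ 2) ^ (b - 1) * h $ 2 / fact b)) *\<^sub>R axis c 1)) (at x)"
  unfolding mono_vf_def
  by (auto intro!: derivative_eq_intros bounded_linear.has_derivative[OF bounded_linear_vec_nth]
      simp: fun_eq_iff field_simps)

lemma partial_mono_vf:
  "partial j (mono_vf a b c) =
    (if j = 1 then if a = 0 then \<lambda>x. 0 else mono_vf (a - 1) b c
     else if b = 0 then \<lambda>x. 0 else mono_vf a (b - 1) c)"
proof -
  have f: "of_nat m * y ^ (m - 1) / fact m = (if m = 0 then 0 else y ^ (m - 1) / fact (m - 1))" for m and y :: real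
    by (cases m) (simp_all add: divide_simps)
  have "j \<noteq> 1 \<longleftrightarrow> j = 2" using exhaust_2[of j] by auto
  moreover have "partial j (mono_vf a b c) x = (of_nat a * (x $ 1) ^ (a - 1) / fact a * of_bool (j = 1) * ((x $ 2) ^ b / fact b)
      + (x $ 1) ^ a / fact a * (of_nat b * (x $ 2) ^ (b - 1) / fact b * of_bool (j = 2))) *\<^sub>R axis c 1" for x
    unfolding partial_def frechet_derivative_at[OF mono_vf_has_derivative, symmetric]
    by (simp add: axis_def of_bool_def)
  ultimately show ?thesis
    unfolding f by (auto simp: mono_vf_def fun_eq_iff)
qed

lemma partial_zero: "partial j (\<lambda>x. 0) = (\<lambda>x. 0)"
  by (simp add: partial_def)

lemma smooth2_mono_vf: "smooth2 (mono_vf a b c)"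
proof -
  define Q where "Q = (\<lambda>f. f = (\<lambda>x. 0) \<or> (\<exists>a' b'. f = mono_vf a' b' c))"
  have Q: "Q (mono_vf a' b' c)" "Q (\<lambda>x. 0)" for a' b' by (auto simp: Q_def)
  have "Q (partial j f)" if "Q f" for j f
    using that by (subst (asm) Q_def) (auto simp: partial_mono_vf partial_zero Q)
  then have "Q (multipartial js (mono_vf a b c))" for js
    by (induction js) (simp_all add: Q)
  moreover have "mono_vf a' b' c differentiable_on UNIV" for a' b'
    unfolding differentiable_on_def differentiable_def using mono_vf_has_derivative by blast
  ultimately show ?thesis
    unfolding smooth2_def Q_def by (metis differentiable_on_const)
qed

lemma mixed_partial_mono_vf: "mixed_partial (mono_vf a b c) a' b' 0 = of_bool (a' = a \<and> b' = b) *\<^sub>R axis c 1"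
proof -
  have 2: "multipartial (replicate m 2) (mono_vf a b c) = (if m \<le> b then mono_vf a (b - m) c else (\<lambda>x. 0))" for m
    by (induction m) (auto simp: partial_mono_vf partial_zero)
  have 1: "multipartial (replicate m 1) (mono_vf a b c) = (if m \<le> a then mono_vf (a - m) b c else (\<lambda>x. 0))" for m b
    by (induction m) (auto simp: partial_mono_vf partial_zero)
  have 0: "multipartial (replicate m 1) (\<lambda>x. 0) = (\<lambda>x. 0)" for m
    by (induction m) (simp_all add: partial_zero)
  have "mono_vf m k c 0 = of_bool (m = 0 \<and> k = 0) *\<^sub>R axis c 1" for m k
    by (simp add: mono_vf_def power_0_left)
  then show ?thesis
    unfolding mixed_partial_def multipartial_append 2 by (auto simp: 1 0)
qed

section \<open>Monomial fields as tests for profiles\<close>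

lemma profile_outside: "ptree n p \<Longrightarrow> n < u \<Longrightarrow> plus_count p S u = 0"
  using ptree_le[of n p] ptree_length[of n p] by (fastforce simp: plus_count_def)

lemma plus_count_root: "ptree n p \<Longrightarrow> plus_count p S n = of_bool (proot p \<in> S)"
proof -
  assume p: "ptree n p"
  have "{w. w < length p \<and> w \<in> S \<and> p ! w = n} = (if proot p \<in> S then {proot p} else {})"
    using proot[OF p] ptree_length[OF p] by auto
  then show ?thesis by (simp add: plus_count_def)
qed

lemma profile_cong: "(\<And>w. w < length p \<Longrightarrow> w \<in> S \<longleftrightarrow> w \<in> S') \<Longrightarrow> profile S p = profile S' p"
  unfolding profile_def plus_count_def
  by (intro arg_cong2[of _ _ _ _ Pair] ext arg_cong[of _ _ card]) auto

text \<open>The inputs are read off from \<open>q\<close> coloured by \<open>S\<close>. Their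
  directions kill every colouring other than \<open>S\<close>, and their exponents prescribe the
  numbers of children of either colour at each vertex. Evaluation thus becomes the indicator of one
  row.\<close>

lemma tree_field_mono_vf:
  assumes p: "ptree n p" and q: "ptree n q"
  shows "tree_field p (\<lambda>u. mono_vf (plus_count q S u) (plus_count q (- S) u) (if u \<in> S then 1 else 2)) 0 $ (if proot q \<in> S then 1 else 2)
    = of_bool (profile S p = profile S q)"
proof -
  define c :: "nat \<Rightarrow> 2" where "c = (\<lambda>w. if w \<in> S then 1 else 2)"
  define g where "g = (\<lambda>u. mono_vf (plus_count q S u) (plus_count q (- S) u) (c u))"
  define i :: 2 where "i = (if proot q \<in> S then 1 else 2)"
  define j0 where "j0 = restrict c {..<n}"
  have z: "weight n g 0 i j (profile {w. j w = 1} p) = 0"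
    if "j \<in> {..<n} \<rightarrow>\<^sub>E UNIV" "j \<noteq> j0" for j
  proof -
    have "\<exists>u<n. j u \<noteq> c u"
    proof -
      have "j0 \<in> {..<n} \<rightarrow>\<^sub>E UNIV" by (simp add: j0_def)
      then have "\<exists>u<n. j u \<noteq> j0 u" using that PiE_ext[of j "{..<n}" "\<lambda>_. UNIV" j0] by auto
      then show ?thesis by (auto simp: j0_def)
    qed
    then obtain u where u: "u < n" "j u \<noteq> c u" by blast
    have "mixed_partial (g u) m m' 0 $ j u = 0" for m m'
      using u(2) by (simp add: g_def mixed_partial_mono_vf axis_def)
    then show ?thesis
      using u(1) unfolding weight_def profile_def by (auto intro!: prod_zero)
  qed
  have "tree_field p g 0 $ i = (\<Sum>j\<in>{..<n} \<rightarrow>\<^sub>E UNIV. weight n g 0 i j (profile {w. j w = 1} p))"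
    by (rule tree_field_formula[OF p]) (simp add: g_def smooth2_mono_vf)
  also have "\<dots> = (\<Sum>j\<in>{j0}. weight n g 0 i j (profile {w. j w = 1} p))"
  proof (rule sum.mono_neutral_right)
    show "finite ({..<n} \<rightarrow>\<^sub>E (UNIV :: 2 set))" by (simp add: finite_PiE)
    show "{j0} \<subseteq> {..<n} \<rightarrow>\<^sub>E UNIV" by (simp add: j0_def)
    show "\<forall>j\<in>({..<n} \<rightarrow>\<^sub>E UNIV) - {j0}. weight n g 0 i j (profile {w. j w = 1} p) = 0" using z by blast
  qed
  also have "profile {w. j0 w = 1} p = profile S p"
    by (rule profile_cong) (auto simp: j0_def c_def ptree_length[OF p])
  then have "(\<Sum>j\<in>{j0}. weight n g 0 i j (profile {w. j w = 1} p)) =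
     of_bool ((if i = 1 then plus_count p S n else plus_count p (- S) n) = 1) *
      (\<Prod>u<n. of_bool (plus_count p S u = plus_count q S u \<and> plus_count p (- S) u = plus_count q (- S) u))"
    by (simp add: weight_def profile_def g_def mixed_partial_mono_vf axis_def j0_def)
  also have "(if i = 1 then plus_count p S n else plus_count p (- S) n) = 1 \<longleftrightarrow>
      plus_count p S n = plus_count q S n \<and> plus_count p (- S) n = plus_count q (- S) n"
    by (simp add: plus_count_root[OF p] plus_count_root[OF q] i_def)
  also have "(\<Prod>u<n. of_bool (plus_count p S u = plus_count q S u \<and> plus_count p (- S) u = plus_count q (- S) u))
     = (of_bool (\<forall>u<n. plus_count p S u = plus_count q S u \<and> plus_count p (- S) u = plus_count q (- S) u) :: real)"
    by (induction n) (auto simp: less_Suc_eq)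
  also have "of_bool (plus_count p S n = plus_count q S n \<and> plus_count p (- S) n = plus_count q (- S) n) * \<dots>
     = of_bool (profile S p = profile S q)"
  proof -
    have "plus_count p T = plus_count q T \<longleftrightarrow> (\<forall>u<n. plus_count p T u = plus_count q T u) \<and> plus_count p T n = plus_count q T n" for T
      using profile_outside[OF p] profile_outside[OF q] by (auto simp: fun_eq_iff) (metis nat_neq_iff)
    then show ?thesis by (auto simp: profile_def)
  qed
  finally show ?thesis by (simp add: g_def i_def c_def)
qed

abbreviation trees :: "nat \<Rightarrow> nat list set" where
  "trees n \<equiv> {p. ptree n p}"

text \<open>From left to right, the monomial fields extract one row sum from a relation. From right
  to left, trees with equal profiles have equal weights in each colouring, so every weight is
  multiplied by a row sum.\<close>

theorem relation_iff:
  "(\<forall>g x. (\<Sum>p\<in>trees n. k p *\<^sub>R tree_field p g x) = 0) \<longleftrightarrow>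
   (\<forall>S. \<forall>q\<in>trees n. (\<Sum>p | p \<in> trees n \<and> profile S p = profile S q. k p) = 0)"
proof (intro iffI allI ballI)
  fix S q
  assume L: "\<forall>g x. (\<Sum>p\<in>trees n. k p *\<^sub>R tree_field p g x) = 0" and q: "q \<in> trees n"
  define g where "g = (\<lambda>u. mono_vf (plus_count q S u) (plus_count q (- S) u) (if u \<in> S then 1 else 2))"
  have "(\<Sum>p | p \<in> trees n \<and> profile S p = profile S q. k p) = (\<Sum>p\<in>trees n. k p * of_bool (profile S p = profile S q))"
    unfolding sum.inter_filter[OF finite_ptree] by (intro sum.cong) auto
  also have "\<dots> = (\<Sum>p\<in>trees n. k p * tree_field p g 0 $ (if proot q \<in> S then 1 else 2))"
    using q tree_field_mono_vf[of n _ q S] by (intro sum.cong refl) (simp add: g_def)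
  also have "\<dots> = (\<Sum>p\<in>trees n. k p *\<^sub>R tree_field p g 0) $ (if proot q \<in> S then 1 else 2)"
    by simp
  finally show "(\<Sum>p | p \<in> trees n \<and> profile S p = profile S q. k p) = 0"
    using L by simp
next
  fix g x
  assume R: "\<forall>S. \<forall>q\<in>trees n. (\<Sum>p | p \<in> trees n \<and> profile S p = profile S q. k p) = 0"
  show "(\<Sum>p\<in>trees n. k p *\<^sub>R tree_field p g x) = 0"
  proof (cases "\<forall>i<n. smooth2 (g i)")
    case False
    then show ?thesis
      by (intro sum.neutral ballI) (simp add: tree_field_not_smooth ptree_length)
  next
    case True
    have "(\<Sum>p\<in>trees n. k p * weight n g x i j (profile S p)) = 0" for i j S
    proof -
      have "(\<Sum>p\<in>trees n. k p * weight n g x i j (profile S p)) =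
        (\<Sum>P\<in>profile S ` trees n. \<Sum>p | p \<in> trees n \<and> profile S p = P. k p * weight n g x i j (profile S p))"
        by (rule sum.image_gen) (rule finite_ptree)
      also have "\<dots> = (\<Sum>P\<in>profile S ` trees n. (\<Sum>p | p \<in> trees n \<and> profile S p = P. k p) * weight n g x i j P)"
        by (simp add: sum_distrib_right)
      also have "\<dots> = 0" using R by (intro sum.neutral) auto
      finally show ?thesis .
    qed
    then have "(\<Sum>p\<in>trees n. k p *\<^sub>R tree_field p g x) $ i = 0" for i
      using True by (simp add: tree_field_formula[of n] sum_distrib_left) (subst sum.swap, simp)
    then show ?thesis by (simp add: vec_eq_iff)
  qed
qed

text \<open>The proof goes through the coordinate formula, because relabelling changes the order in
  which \<open>Fsub\<close> differentiates. Colourings are matched by composition with \<sigma>; the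
  virtual parent \<open>n\<close> is fixed by \<sigma>, so the colours of the roots match as
  well.\<close>

lemma tree_field_relabel:
  assumes s: "\<sigma> permutes {0..<n}" and p: "ptree n p" and q: "ptree n q"
    and pq: "\<And>w. w < n \<Longrightarrow> q ! \<sigma> w = \<sigma> (p ! w)"
  shows "tree_field q g = tree_field p (g \<circ> \<sigma>)"
proof
  fix x
  have lt: "\<sigma> w < n \<longleftrightarrow> w < n" for w using permutes_in_image[OF s, of w] by simp
  have sn: "\<sigma> n = n" using permutes_not_in[OF s, of n] by simp
  note inj = permutes_inj[OF s]
  have smooth: "(\<forall>i<n. smooth2 (g i)) \<longleftrightarrow> (\<forall>i<n. smooth2 ((g \<circ> \<sigma>) i))"
    using permutes_surj[OF s] lt unfolding o_apply by (metis surjD)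
  show "tree_field q g x = tree_field p (g \<circ> \<sigma>) x"
  proof (cases "\<forall>i<n. smooth2 (g i)")
    case False
    then show ?thesis
      using smooth ptree_length[OF p] ptree_length[OF q] by (simp only: tree_field_not_smooth not_False_eq_True)
  next
    case True
    define J where "J = ({..<n} \<rightarrow>\<^sub>E (UNIV :: 2 set))"
    have pc: "plus_count q S (\<sigma> u) = plus_count p (\<sigma> -` S) u" for S u
    proof -
      have "{w. w < length q \<and> w \<in> S \<and> q ! w = \<sigma> u} = \<sigma> ` {w. w < length p \<and> w \<in> \<sigma> -` S \<and> p ! w = u}"
      proof (intro set_eqI iffI)
        fix w assume w: "w \<in> {w. w < length q \<and> w \<in> S \<and> q ! w = \<sigma> u}"
        obtain v where v: "w = \<sigma> v" using permutes_surj[OF s] by (meson surjD)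
        then have "v < n" using w lt ptree_length[OF q] by simp
        then have "p ! v = u" using w v pq[of v] inj by (simp add: inj_eq)
        then show "w \<in> \<sigma> ` {w. w < length p \<and> w \<in> \<sigma> -` S \<and> p ! w = u}"
          using v w \<open>v < n\<close> ptree_length[OF p] by auto
      qed (auto simp: lt ptree_length[OF p] ptree_length[OF q] pq)
      then show ?thesis
        unfolding plus_count_def by (simp only: card_image[OF inj_on_subset[OF inj subset_UNIV]])
    qed
    define h where "h = (\<lambda>j. restrict (j \<circ> \<sigma>) {..<n} :: nat \<Rightarrow> 2)"
    define h' where "h' = (\<lambda>j. restrict (j \<circ> inv \<sigma>) {..<n} :: nat \<Rightarrow> 2)"
    have lt': "inv \<sigma> w < n \<longleftrightarrow> w < n" for w
      using permutes_in_image[OF permutes_inv[OF s], of w] by simp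
    have "tree_field q g x $ i = tree_field p (g \<circ> \<sigma>) x $ i" for i
    proof -
      have "tree_field q g x $ i = (\<Sum>j\<in>J. weight n g x i j (profile {w. j w = 1} q))"
        unfolding J_def using True by (intro tree_field_formula[OF q]) simp
      also have "\<dots> = (\<Sum>j\<in>J. weight n (g \<circ> \<sigma>) x i j (profile {w. j w = 1} p))"
      proof (rule sum.reindex_bij_witness[where i = h' and j = h])
        fix j assume j: "j \<in> J"
        show "h' (h j) = j" "h (h' j) = j"
          using j permutes_inverses[OF s]
          by (auto simp: h_def h'_def J_def fun_eq_iff lt lt' PiE_def extensional_def)
        show "h j \<in> J" "h' j \<in> J" by (simp_all add: h_def h'_def J_def)
        have "profile {w. h j w = 1} p = profile (\<sigma> -` {w. j w = 1}) p"
          by (rule profile_cong) (simp add: h_def ptree_length[OF p])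
        moreover have "(\<Prod>u<n. mixed_partial (g u) (plus_count q {w. j w = 1} u) (plus_count q (- {w. j w = 1}) u) x $ j u) =
          (\<Prod>u<n. mixed_partial (g (\<sigma> u)) (plus_count q {w. j w = 1} (\<sigma> u)) (plus_count q (- {w. j w = 1}) (\<sigma> u)) x $ j (\<sigma> u))"
          using prod.permute[OF s] by (simp add: lessThan_atLeast0 o_def)
        ultimately show "weight n (g \<circ> \<sigma>) x i (h j) (profile {w. h j w = 1} p) = weight n g x i j (profile {w. j w = 1} q)"
          using pc[of _ n] by (simp add: weight_def profile_def pc sn vimage_Compl h_def)
      qed
      also have "\<dots> = tree_field p (g \<circ> \<sigma>) x $ i"
        unfolding J_def using True lt by (intro tree_field_formula[OF p, symmetric]) simp
      finally show ?thesis .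
    qed
    then show ?thesis by (simp add: vec_eq_iff)
  qed
qed

section \<open>The trace of a permuted basis\<close>

text \<open>Vectors are given by their values on an index type, on which the symmetry acts by
  precomposition with \<theta>. For tree maps an index will consist of the inputs, a point and a
  coordinate. \<open>X\<close> indexes a spanning family that may satisfy linear relations, in
  contrast to the basis \<open>B\<close>.\<close>

locale permuted_basis =
  fixes X :: "'x set" and F :: "'x \<Rightarrow> 'i \<Rightarrow> real" and s :: "'x \<Rightarrow> 'x"
    and B :: "'b set" and V :: "'b \<Rightarrow> 'i \<Rightarrow> real" and \<pi> :: "'b \<Rightarrow> 'b" and \<theta> :: "'i \<Rightarrow> 'i"
  assumes finX: "finite X"
    and independent: "\<forall>B' c. finite B' \<and> B' \<subseteq> B \<and> (\<forall>i. (\<Sum>b\<in>B'. c b * V b i) = 0) \<longrightarrow> (\<forall>b\<in>B'. c b = 0)"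
    and FB: "\<And>x. x \<in> X \<Longrightarrow> \<exists>B' c. finite B' \<and> B' \<subseteq> B \<and> (\<forall>i. F x i = (\<Sum>b\<in>B'. c b * V b i))"
    and BF: "\<And>b. b \<in> B \<Longrightarrow> \<exists>c. \<forall>i. V b i = (\<Sum>x\<in>X. c x * F x i)"
    and s: "bij_betw s X X" and \<pi>: "bij_betw \<pi> B B" and \<theta>: "surj \<theta>"
    and F_act: "\<And>x i. x \<in> X \<Longrightarrow> F (s x) i = F x (\<theta> i)"
    and V_act: "\<And>b i. b \<in> B \<Longrightarrow> V (\<pi> b) i = V b (\<theta> i)"
begin

lemma indep:
  assumes "finite B'" "B' \<subseteq> B" "\<And>i. (\<Sum>b\<in>B'. c b * V b i) = 0" "b \<in> B'"
  shows "c b = 0"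
proof -
  have "finite B' \<and> B' \<subseteq> B \<and> (\<forall>i. (\<Sum>b\<in>B'. c b * V b i) = 0)" using assms by simp
  then show ?thesis using independent[THEN spec, THEN spec, THEN mp] assms(4) by blast
qed

definition rel :: "('x \<Rightarrow> real) \<Rightarrow> bool" where
  "rel k \<longleftrightarrow> (\<forall>i. (\<Sum>x\<in>X. k x * F x i) = 0)"

definition splitting :: "('x \<Rightarrow> 'x \<Rightarrow> real) \<Rightarrow> bool" where
  "splitting P \<longleftrightarrow> (\<forall>x\<in>X. \<forall>i. F x i = (\<Sum>y\<in>X. P x y * F y i)) \<and>
     (\<forall>k. rel k \<longrightarrow> (\<forall>y\<in>X. (\<Sum>x\<in>X. k x * P x y) = 0))"

lemma relI: "(\<And>i. (\<Sum>x\<in>X. k x * F x i) = 0) \<Longrightarrow> rel k"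
  by (simp add: rel_def)

lemma rel_diff: "rel k \<Longrightarrow> rel k' \<Longrightarrow> rel (\<lambda>x. k x - k' x)"
  by (simp add: rel_def left_diff_distrib sum_subtractf)

lemma rel_sum: "(\<And>i. i \<in> I \<Longrightarrow> rel (k i)) \<Longrightarrow> rel (\<lambda>x. \<Sum>i\<in>I. c i * k i x)"
  unfolding rel_def sum_distrib_right by (subst sum.swap) (simp add: mult.assoc flip: sum_distrib_left)

text \<open>As \<theta> is surjective, every index has the form \<open>\<theta> i'\<close>;
  evaluating there turns the sum into a reindexing of the original relation.\<close>

lemma rel_shift: "rel k \<Longrightarrow> rel (\<lambda>x. k (s x))"
proof (rule relI)
  fix i assume k: "rel k"
  obtain i' where i': "i = \<theta> i'" using \<theta> by (meson surjD)
  have "(\<Sum>x\<in>X. k (s x) * F x i) = (\<Sum>x\<in>X. k (s x) * F (s x) i')"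
    by (intro sum.cong refl) (simp add: F_act i')
  also have "\<dots> = (\<Sum>x\<in>X. k x * F x i')"
    by (rule sum.reindex_bij_betw[OF s])
  finally show "(\<Sum>x\<in>X. k (s x) * F x i) = 0" using k by (simp add: rel_def)
qed

text \<open>The finitely many elements of \<open>B\<close> that occur in chosen expansions of the
  \<open>F x\<close> already span, so any further element of \<open>B\<close> would depend linearly
  on them.\<close>

lemma finB: "finite B"
proof -
  obtain B' c where Bc: "\<And>x. x \<in> X \<Longrightarrow> finite (B' x) \<and> B' x \<subseteq> B \<and> (\<forall>i. F x i = (\<Sum>b\<in>B' x. c x b * V b i))"
    using FB by metis
  define B0 where "B0 = (\<Union>x\<in>X. B' x)"
  have fin0: "finite B0" and sub0: "B0 \<subseteq> B" using Bc finX by (auto simp: B0_def)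
  define c0 where "c0 = (\<lambda>x b. if b \<in> B' x then c x b else 0)"
  have F0: "F x i = (\<Sum>b\<in>B0. c0 x b * V b i)" if "x \<in> X" for x i
  proof -
    have "(\<Sum>b\<in>B0. c0 x b * V b i) = (\<Sum>b\<in>B' x. c0 x b * V b i)"
      using that fin0 by (intro sum.mono_neutral_right) (auto simp: B0_def c0_def)
    then show ?thesis using Bc[OF that] by (simp add: c0_def)
  qed
  have "B \<subseteq> B0"
  proof (rule subsetI, rule ccontr)
    fix b assume b: "b \<in> B" "b \<notin> B0"
    obtain d where d: "\<And>i. V b i = (\<Sum>x\<in>X. d x * F x i)" using BF[OF b(1)] by blast
    define e where "e = (\<lambda>b'. if b' = b then -1 else (\<Sum>x\<in>X. d x * c0 x b'))"
    have "(\<Sum>b'\<in>insert b B0. e b' * V b' i) = 0" for i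
    proof -
      have "V b i = (\<Sum>x\<in>X. \<Sum>b'\<in>B0. d x * c0 x b' * V b' i)"
        unfolding d by (intro sum.cong refl) (simp add: F0 sum_distrib_left mult.assoc)
      also have "\<dots> = (\<Sum>b'\<in>B0. e b' * V b' i)"
        by (subst sum.swap, intro sum.cong refl) (use b in \<open>auto simp: e_def sum_distrib_right\<close>)
      finally show ?thesis using b fin0 by (simp add: e_def)
    qed
    then have "e b = 0" using indep[of "insert b B0" e b] b sub0 fin0 by auto
    then show False by (simp add: e_def)
  qed
  then show ?thesis using fin0 by (rule finite_subset)
qed

lemma coords:
  obtains \<gamma> \<beta> where "\<And>x i. x \<in> X \<Longrightarrow> F x i = (\<Sum>b\<in>B. \<gamma> x b * V b i)"
    and "\<And>b i. b \<in> B \<Longrightarrow> V b i = (\<Sum>x\<in>X. \<beta> b x * F x i)"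
proof -
  have "\<exists>c. \<forall>i. F x i = (\<Sum>b\<in>B. c b * V b i)" if x: "x \<in> X" for x
  proof -
    obtain B' c where c: "finite B'" "B' \<subseteq> B" "\<forall>i. F x i = (\<Sum>b\<in>B'. c b * V b i)"
      using FB[OF x] by blast
    have "F x i = (\<Sum>b\<in>B. (if b \<in> B' then c b else 0) * V b i)" for i
    proof -
      have "(\<Sum>b\<in>B. (if b \<in> B' then c b else 0) * V b i) = (\<Sum>b\<in>B'. (if b \<in> B' then c b else 0) * V b i)"
        using c(2) finB by (intro sum.mono_neutral_right) auto
      then show ?thesis using c(3) by simp
    qed
    then show ?thesis by (intro exI[of _ "\<lambda>b. if b \<in> B' then c b else 0"]) blast
  qed
  then obtain \<gamma> where "\<And>x i. x \<in> X \<Longrightarrow> F x i = (\<Sum>b\<in>B. \<gamma> x b * V b i)" by metis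
  moreover obtain \<beta> where "\<And>b i. b \<in> B \<Longrightarrow> V b i = (\<Sum>x\<in>X. \<beta> b x * F x i)" using BF by metis
  ultimately show ?thesis by (rule that)
qed

lemma coeff_eq:
  assumes "\<And>i. (\<Sum>b\<in>B. c b * V b i) = (\<Sum>b\<in>B. c' b * V b i)" "b \<in> B"
  shows "c b = c' b"
  using indep[of B "\<lambda>b. c b - c' b" b] finB assms by (simp add: left_diff_distrib sum_subtractf)

text \<open>\<open>P\<close> expands a member of the spanning family in the basis and then expands
  the basis elements back. A relation has zero coordinates in the basis, so the first of these two
  maps already kills it.\<close>

lemma splitting_exists: "\<exists>P. splitting P"
proof -
  obtain \<gamma> \<beta> where F: "\<And>x i. x \<in> X \<Longrightarrow> F x i = (\<Sum>b\<in>B. \<gamma> x b * V b i)"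
    and V: "\<And>b i. b \<in> B \<Longrightarrow> V b i = (\<Sum>x\<in>X. \<beta> b x * F x i)" by (rule coords) (rule that)
  define P where "P = (\<lambda>x y. \<Sum>b\<in>B. \<gamma> x b * \<beta> b y)"
  have "F x i = (\<Sum>y\<in>X. P x y * F y i)" if "x \<in> X" for x i
    unfolding F[OF that] P_def sum_distrib_right
    by (subst sum.swap, intro sum.cong refl) (simp add: V sum_distrib_left mult.assoc)
  moreover have "(\<Sum>x\<in>X. k x * P x y) = 0" if k: "rel k" for k y
  proof -
    have "(\<Sum>b\<in>B. (\<Sum>x\<in>X. k x * \<gamma> x b) * V b i) = 0" for i
    proof -
      have "(\<Sum>b\<in>B. (\<Sum>x\<in>X. k x * \<gamma> x b) * V b i) = (\<Sum>x\<in>X. k x * F x i)"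
        unfolding sum_distrib_right
        by (subst sum.swap, intro sum.cong refl) (simp add: F sum_distrib_left mult.assoc)
      then show ?thesis using k by (simp add: rel_def)
    qed
    then have "(\<Sum>x\<in>X. k x * \<gamma> x b) = 0" if "b \<in> B" for b
      using coeff_eq[of "\<lambda>b. \<Sum>x\<in>X. k x * \<gamma> x b" "\<lambda>_. 0" b] that by simp
    moreover have "(\<Sum>x\<in>X. k x * P x y) = (\<Sum>b\<in>B. (\<Sum>x\<in>X. k x * \<gamma> x b) * \<beta> b y)"
      unfolding P_def sum_distrib_left sum_distrib_right by (subst sum.swap) (simp add: mult.assoc)
    ultimately show ?thesis by simp
  qed
  ultimately show ?thesis unfolding splitting_def by blast
qed

text \<open>A splitting is the projection onto a complement of the relations, so composing it with
  the permutation of \<open>X\<close> has the trace of the operator that permutes the basis \<open>B\<close>.\<close>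
theorem trace_splitting:
  assumes P: "splitting P"
  shows "(\<Sum>x\<in>X. P x (s x)) = real (card {b \<in> B. \<pi> b = b})"
proof -
  obtain \<gamma> \<beta> where F: "\<And>x i. x \<in> X \<Longrightarrow> F x i = (\<Sum>b\<in>B. \<gamma> x b * V b i)"
    and V: "\<And>b i. b \<in> B \<Longrightarrow> V b i = (\<Sum>x\<in>X. \<beta> b x * F x i)" by (rule coords) (rule that)
  \<comment> \<open>An arbitrary splitting need not be the matrix product of \<gamma> and \<beta>.
    With \<delta> as the product of \<beta> and \<open>P\<close>, it does factor as \<gamma> times
    \<delta>: the rows of the identity minus \<gamma> times \<beta> are relations, and
    \<open>P\<close> kills them.\<close>
  define \<delta> where "\<delta> = (\<lambda>b y. \<Sum>x\<in>X. \<beta> b x * P x y)"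
  have P1: "F x i = (\<Sum>y\<in>X. P x y * F y i)" if "x \<in> X" for x i
    using P that by (simp add: splitting_def)
  have P2: "rel k \<Longrightarrow> y \<in> X \<Longrightarrow> (\<Sum>x\<in>X. k x * P x y) = 0" for k y
    using P by (simp add: splitting_def)
  have V': "V b i = (\<Sum>x\<in>X. \<delta> b x * F x i)" if "b \<in> B" for b i
    unfolding V[OF that] \<delta>_def sum_distrib_right
    by (subst sum.swap, intro sum.cong refl) (simp add: P1 sum_distrib_left mult.assoc)
  have P': "P x y = (\<Sum>b\<in>B. \<gamma> x b * \<delta> b y)" if "x \<in> X" "y \<in> X" for x y
  proof -
    define k where "k = (\<lambda>z. (if z = x then 1 else 0) - (\<Sum>b\<in>B. \<gamma> x b * \<beta> b z))"
    have "(\<Sum>z\<in>X. (\<Sum>b\<in>B. \<gamma> x b * \<beta> b z) * F z i) = F x i" for i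
      unfolding F[OF that(1)] sum_distrib_right
      by (subst sum.swap, intro sum.cong refl) (simp add: V sum_distrib_left mult.assoc)
    then have "rel k"
      using that finX by (simp add: rel_def k_def left_diff_distrib sum_subtractf if_distrib[of "\<lambda>t. t * _"] cong: if_cong)
    then have "(\<Sum>z\<in>X. k z * P z y) = 0" using that by (rule_tac P2)
    moreover have "(\<Sum>z\<in>X. (\<Sum>b\<in>B. \<gamma> x b * \<beta> b z) * P z y) = (\<Sum>b\<in>B. \<gamma> x b * \<delta> b y)"
      unfolding \<delta>_def sum_distrib_left sum_distrib_right by (subst sum.swap) (simp add: mult.assoc)
    ultimately show ?thesis
      using that finX by (simp add: k_def left_diff_distrib sum_subtractf if_distrib[of "\<lambda>t. t * _"] cong: if_cong)
  qed
  \<comment> \<open>The product of \<delta> and \<gamma> in this order is the identity on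
    \<open>B\<close>. The rest is cyclic invariance of the trace, which leaves a permutation matrix
    on \<open>B\<close>.\<close>
  have dual: "(\<Sum>x\<in>X. \<delta> b x * \<gamma> x b') = (if b' = b then 1 else 0)" if b: "b \<in> B" "b' \<in> B" for b b'
  proof (rule coeff_eq[OF _ b(2)])
    fix i
    have "(\<Sum>b'\<in>B. (\<Sum>x\<in>X. \<delta> b x * \<gamma> x b') * V b' i) = V b i"
      unfolding V'[OF b(1)] sum_distrib_right
      by (subst sum.swap, intro sum.cong refl) (simp add: F sum_distrib_left mult.assoc)
    then show "(\<Sum>b'\<in>B. (\<Sum>x\<in>X. \<delta> b x * \<gamma> x b') * V b' i) = (\<Sum>b'\<in>B. (if b' = b then 1 else 0) * V b' i)"
      using b finB by (simp add: if_distrib[of "\<lambda>t. t * _"] cong: if_cong)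
  qed
  have sX: "s x \<in> X" if "x \<in> X" for x using s that by (auto simp: bij_betw_def)
  have piB: "\<pi> b \<in> B" if "b \<in> B" for b using \<pi> that by (auto simp: bij_betw_def)
  have equi: "\<gamma> (s x) (\<pi> b) = \<gamma> x b" if x: "x \<in> X" and b: "b \<in> B" for x b
  proof -
    define \<rho> where "\<rho> = inv_into B \<pi>"
    have \<rho>: "\<rho> (\<pi> b) = b" if "b \<in> B" for b
      unfolding \<rho>_def using \<pi> that by (simp add: bij_betw_inv_into_left)
    have "\<gamma> (s x) (\<pi> b) = \<gamma> x (\<rho> (\<pi> b))"
    proof (rule coeff_eq[OF _ piB[OF b]])
      fix i
      have "(\<Sum>b\<in>B. \<gamma> x (\<rho> b) * V b i) = (\<Sum>b\<in>B. \<gamma> x (\<rho> (\<pi> b)) * V (\<pi> b) i)"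
        by (rule sum.reindex_bij_betw[OF \<pi>, symmetric])
      also have "\<dots> = F x (\<theta> i)"
        unfolding F[OF x] by (intro sum.cong refl) (simp add: \<rho> V_act)
      finally show "(\<Sum>b\<in>B. \<gamma> (s x) b * V b i) = (\<Sum>b\<in>B. \<gamma> x (\<rho> b) * V b i)"
        using F_act[OF x, of i] F[OF sX[OF x], of i] by simp
    qed
    then show ?thesis using \<rho>[OF b] by simp
  qed
  have "(\<Sum>x\<in>X. P x (s x)) = (\<Sum>x\<in>X. \<Sum>b\<in>B. \<gamma> (s x) (\<pi> b) * \<delta> b (s x))"
    by (intro sum.cong refl) (simp add: P' sX equi)
  also have "\<dots> = (\<Sum>x\<in>X. \<Sum>b\<in>B. \<gamma> x (\<pi> b) * \<delta> b x)"
    by (rule sum.reindex_bij_betw[OF s, of "\<lambda>x. \<Sum>b\<in>B. \<gamma> x (\<pi> b) * \<delta> b x"])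
  also have "\<dots> = (\<Sum>b\<in>B. \<Sum>x\<in>X. \<delta> b x * \<gamma> x (\<pi> b))"
    by (subst sum.swap) (simp add: mult.commute)
  also have "\<dots> = (\<Sum>b\<in>B. if \<pi> b = b then 1 else 0)"
    by (intro sum.cong refl) (simp add: dual piB)
  also have "\<dots> = real (card {b \<in> B. \<pi> b = b})"
    using finB by (simp add: sum.If_cases Int_def)
  finally show ?thesis .
qed

text \<open>Erasing the entries between different degrees preserves both clauses of a splitting,
  because the homogeneous parts of a relation are relations. No homogeneity of \<open>B\<close>
  enters.\<close>

lemma graded_splitting_exists:
  assumes graded: "\<And>k d. rel k \<Longrightarrow> rel (\<lambda>x. if deg x = d then k x else 0)"
  shows "\<exists>P. splitting P \<and> (\<forall>x y. deg x \<noteq> deg y \<longrightarrow> P x y = 0)"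
proof -
  obtain P where P: "splitting P" using splitting_exists by blast
  define P' where "P' = (\<lambda>x y. if deg x = deg y then P x y else 0)"
  have "F x i = (\<Sum>y\<in>X. P' x y * F y i)" if x: "x \<in> X" for x i
  proof -
    have "rel (\<lambda>y. (if y = x then 1 else 0) - P x y)"
      using P x finX by (simp add: rel_def splitting_def left_diff_distrib sum_subtractf if_distrib[of "\<lambda>t. t * _"] cong: if_cong)
    from graded[OF this, of "deg x"]
    have "(\<Sum>y\<in>X. ((if y = x then 1 else 0) - P' x y) * F y i) = 0"
      unfolding rel_def P'_def by (elim allE[of _ i] back_subst[of "\<lambda>t. t = 0"]) (intro sum.cong refl, auto)
    then show ?thesis
      using x finX by (simp add: left_diff_distrib sum_subtractf if_distrib[of "\<lambda>t. t * _"] cong: if_cong)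
  qed
  moreover have "(\<Sum>x\<in>X. k x * P' x y) = 0" if k: "rel k" and y: "y \<in> X" for k y
  proof -
    have "(\<Sum>x\<in>X. k x * P' x y) = (\<Sum>x\<in>X. (if deg x = deg y then k x else 0) * P x y)"
      by (intro sum.cong refl) (auto simp: P'_def)
    also have "\<dots> = 0" using P graded[OF k] y unfolding splitting_def by blast
    finally show ?thesis .
  qed
  ultimately have "splitting P'" by (simp add: splitting_def)
  then show ?thesis by (intro exI[of _ P']) (auto simp: P'_def)
qed

text \<open>On an \<open>s\<close>-stable block \<open>Y\<close>, the identity minus a splitting is a projection onto the relations;
  the relations \<open>k i\<close> are the basis dual to evaluation at the pivots.\<close>
lemma block_trace:
  assumes P: "splitting P" and Y: "Y \<subseteq> X" "\<And>x. x \<in> X \<Longrightarrow> s x \<in> Y \<longleftrightarrow> x \<in> Y" "\<And>x. x \<in> Y \<Longrightarrow> s x \<noteq> x"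
    and PY: "\<And>x y. x \<in> Y \<Longrightarrow> y \<in> X - Y \<Longrightarrow> P x y = 0"
    and I: "I \<subseteq> Y" and k: "\<And>i. i \<in> I \<Longrightarrow> rel (k i)" "\<And>i y. i \<in> I \<Longrightarrow> y \<in> X - Y \<Longrightarrow> k i y = 0"
      "\<And>i j. i \<in> I \<Longrightarrow> j \<in> I \<Longrightarrow> k i j = (if i = j then 1 else 0)"
    and det: "\<And>l y. rel l \<Longrightarrow> (\<And>y. y \<in> X - Y \<Longrightarrow> l y = 0) \<Longrightarrow> (\<And>i. i \<in> I \<Longrightarrow> l i = 0) \<Longrightarrow> y \<in> Y \<Longrightarrow> l y = 0"
  shows "(\<Sum>x\<in>Y. P x (s x)) = - (\<Sum>i\<in>I. k i (s i))"
proof -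
  have fin: "finite Y" "finite I" using finX Y(1) I by (meson finite_subset)+
  \<comment> \<open>The complementary projection. Its rows are relations, and those with index in
    \<open>Y\<close> are supported in \<open>Y\<close>, hence are combinations of the
    \<open>k i\<close> with coefficients read off at the pivots.\<close>
  define N where "N = (\<lambda>x y. (if y = x then 1 else 0) - P x y)"
  have N: "N x y = (\<Sum>i\<in>I. N x i * k i y)" if x: "x \<in> Y" and y: "y \<in> Y" for x y
  proof -
    have "rel (N x)"
      using P x Y(1) finX
      by (auto simp: N_def rel_def splitting_def left_diff_distrib sum_subtractf if_distrib[of "\<lambda>t. t * _"] cong: if_cong)
    then have "rel (\<lambda>y. N x y - (\<Sum>i\<in>I. N x i * k i y))"
      by (intro rel_diff rel_sum k(1))
    moreover have "N x y - (\<Sum>i\<in>I. N x i * k i y) = 0" if "y \<in> X - Y" for y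
    proof -
      have "N x y = 0" using PY[OF x that] x that by (auto simp: N_def)
      then show ?thesis using k(2) that by simp
    qed
    moreover have "N x j - (\<Sum>i\<in>I. N x i * k i j) = 0" if "j \<in> I" for j
    proof -
      have "(\<Sum>i\<in>I. N x i * k i j) = (\<Sum>i\<in>I. if i = j then N x i else 0)"
        by (intro sum.cong refl) (simp add: k(3) that)
      then show ?thesis using that fin by simp
    qed
    ultimately have "N x y - (\<Sum>i\<in>I. N x i * k i y) = 0" by (rule det[OF _ _ _ y])
    then show ?thesis by simp
  qed
  \<comment> \<open>The composition of \<open>k i\<close> with \<open>s\<close> is again a relation,
    so \<open>P\<close> kills it and \<open>N\<close> leaves it unchanged.\<close>
  have shift: "(\<Sum>x\<in>Y. k i (s x) * N x i) = k i (s i)" if i: "i \<in> I" for i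
  proof -
    have iX: "i \<in> X" "i \<in> Y" using i I Y by auto
    have out: "k i (s x) = 0" if "x \<in> X - Y" for x
      using k(2)[OF i, of "s x"] that s Y(2)[of x] by (auto simp: bij_betw_def)
    have "(\<Sum>x\<in>X. k i (s x) * P x i) = 0"
      using P rel_shift[OF k(1)[OF i]] iX unfolding splitting_def by blast
    moreover have "(\<Sum>x\<in>X. k i (s x) * N x i) = k i (s i) - (\<Sum>x\<in>X. k i (s x) * P x i)"
      using iX finX by (simp add: N_def right_diff_distrib sum_subtractf if_distrib[of "\<lambda>t. _ * t"] cong: if_cong)
    moreover have "(\<Sum>x\<in>X. k i (s x) * N x i) = (\<Sum>x\<in>Y. k i (s x) * N x i)"
      using finX Y(1) out by (intro sum.mono_neutral_right) auto
    ultimately show ?thesis by simp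
  qed
  \<comment> \<open>\<open>s\<close> has no fixed point in \<open>Y\<close>, so the identity matrix
    contributes nothing at the entries \<open>(x, s x)\<close>.\<close>
  have "(\<Sum>x\<in>Y. P x (s x)) = - (\<Sum>x\<in>Y. N x (s x))"
    unfolding sum_negf[symmetric] using Y(3) by (intro sum.cong refl) (auto simp: N_def)
  also have "(\<Sum>x\<in>Y. N x (s x)) = (\<Sum>x\<in>Y. \<Sum>i\<in>I. N x i * k i (s x))"
    using Y by (intro sum.cong refl N) auto
  also have "\<dots> = (\<Sum>i\<in>I. k i (s i))"
    by (subst sum.swap, intro sum.cong refl) (simp only: shift mult.commute[of "N _ _"])
  finally show ?thesis .
qed

end

section \<open>Relabelling\<close>

text \<open>Vertex \<open>\<sigma> w\<close> of the new tree has parent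
  \<open>\<sigma> (p ! w)\<close>, hence the inverse in the position. A permutation of the vertices
  fixes \<open>n\<close>, so the mark of the root is preserved.\<close>

definition relabel :: "(nat \<Rightarrow> nat) \<Rightarrow> nat list \<Rightarrow> nat list" where
  "relabel \<sigma> p = map (\<lambda>w. \<sigma> (p ! inv \<sigma> w)) [0..<length p]"

lemma length_relabel [simp]: "length (relabel \<sigma> p) = length p"
  by (simp add: relabel_def)

context
  fixes \<sigma> :: "nat \<Rightarrow> nat" and n :: nat
  assumes \<sigma>: "\<sigma> permutes {0..<n}"
begin

lemma perm_less: "\<sigma> w < n \<longleftrightarrow> w < n"
  using permutes_in_image[OF \<sigma>, of w] by simp

lemma perm_eq_n: "\<sigma> w = n \<longleftrightarrow> w = n"
  using permutes_not_in[OF \<sigma>, of n] permutes_inj[OF \<sigma>] by (metis atLeastLessThan_iff injD less_irrefl)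

lemma perm_le: "\<sigma> w \<le> n \<longleftrightarrow> w \<le> n"
  using perm_less[of w] perm_eq_n[of w] by (simp add: le_less)

lemma relabel_nth: "length p = n \<Longrightarrow> w < n \<Longrightarrow> relabel \<sigma> p ! \<sigma> w = \<sigma> (p ! w)"
  using permutes_inverses[OF \<sigma>] perm_less by (simp add: relabel_def)

lemma relabel_eqI:
  assumes "length p = n" "length q = n" "\<And>w. w < n \<Longrightarrow> q ! \<sigma> w = \<sigma> (p ! w)"
  shows "q = relabel \<sigma> p"
proof (rule nth_equalityI)
  fix v assume "v < length q"
  moreover obtain w where "v = \<sigma> w" using permutes_surj[OF \<sigma>] by (meson surjD)
  ultimately show "q ! v = relabel \<sigma> p ! v" using assms perm_less[of w] relabel_nth[of p w] by simp
qed (simp add: assms)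

lemma ptree_relabel:
  assumes p: "ptree n p" shows "ptree n (relabel \<sigma> p)"
proof -
  note len = ptree_length[OF p]
  define q where "q = relabel \<sigma> p"
  have lenq: "length q = n" by (simp add: q_def len)
  have nth: "q ! \<sigma> w = \<sigma> (p ! w)" if "w < n" for w using relabel_nth[OF len that] by (simp add: q_def)
  have surj: "\<exists>w. v = \<sigma> w" for v using permutes_surj[OF \<sigma>] by (meson surjD)
  have "q ! v \<le> n" if v: "v < n" for v
  proof -
    obtain w where w: "v = \<sigma> w" using surj by blast
    then have "w < n" using v perm_less by simp
    then show ?thesis using nth w perm_le ptree_le[OF p] by simp
  qed
  then have "set q \<subseteq> {..n}" by (auto simp: in_set_conv_nth lenq)
  moreover have "\<exists>!r. r < n \<and> q ! r = n"
  proof (rule ex1I[of _ "\<sigma> (proot p)"])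
    show "\<sigma> (proot p) < n \<and> q ! \<sigma> (proot p) = n"
      using proot[OF p] nth perm_less perm_eq_n by simp
    fix r assume r: "r < n \<and> q ! r = n"
    obtain w where w: "r = \<sigma> w" using surj by blast
    then have "w < n" using r perm_less by simp
    then have "p ! w = n" using r w nth perm_eq_n by simp
    then show "r = \<sigma> (proot p)" using proot(3)[OF p \<open>w < n\<close>] w by simp
  qed
  moreover have "(par q ^^ n) v = n" if v: "v < n" for v
  proof -
    have par: "par q (\<sigma> w) = \<sigma> (par p w)" "par p w \<le> n" if "w \<le> n" for w
      using nth[of w] perm_less[of w] perm_eq_n[of n] ptree_le[OF p, of w] by (auto simp: par_def len lenq)
    have "(par q ^^ k) (\<sigma> w) = \<sigma> ((par p ^^ k) w) \<and> (par p ^^ k) w \<le> n" if "w \<le> n" for k w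
      by (induction k) (use that par in auto)
    moreover obtain w where w: "v = \<sigma> w" using surj by blast
    moreover have "w < n" using w v perm_less by simp
    moreover have "(par p ^^ n) w = n" using p \<open>w < n\<close> by (simp add: ptree_def)
    ultimately show ?thesis using perm_eq_n[of n] by (metis less_imp_le)
  qed
  ultimately show ?thesis using lenq unfolding ptree_def q_def[symmetric] by blast
qed

lemma tree_field_relabel': "ptree n p \<Longrightarrow> tree_field (relabel \<sigma> p) g = tree_field p (g \<circ> \<sigma>)"
  using tree_field_relabel[OF \<sigma> _ ptree_relabel] relabel_nth ptree_length by blast

lemma count_list_relabel:
  assumes "length p = n" shows "count_list (relabel \<sigma> p) (\<sigma> u) = count_list p u"
proof -
  have "relabel \<sigma> p = map \<sigma> (map (\<lambda>w. p ! inv \<sigma> w) [0..<n])"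
    by (simp add: relabel_def assms)
  moreover have "mset (map (\<lambda>w. p ! inv \<sigma> w) [0..<n]) = mset p"
  proof -
    have "image_mset (inv \<sigma>) (mset_set {0..<n}) = mset_set {0..<n}"
      using permutes_inv[OF \<sigma>] by (simp add: image_mset_mset_set permutes_inj_on permutes_image)
    then have "mset (map (\<lambda>w. p ! inv \<sigma> w) [0..<n]) = image_mset ((!) p) (mset_set {0..<n})"
      by (simp add: image_mset.compositionality[symmetric, unfolded o_def] flip: mset_upt)
    also have "\<dots> = mset (map ((!) p) [0..<n])" by simp
    also have "map ((!) p) [0..<n] = p" using map_nth[of p] assms by simp
    finally show ?thesis .
  qed
  ultimately show ?thesis
    using permutes_inj[OF \<sigma>] by (metis count_list_map_conv count_mset)
qed

end

section \<open>Relations and out-degrees\<close>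

definition relation :: "nat \<Rightarrow> (nat list \<Rightarrow> real) \<Rightarrow> bool" where
  "relation n k \<longleftrightarrow> (\<forall>S. \<forall>q\<in>trees n. (\<Sum>p | p \<in> trees n \<and> profile S p = profile S q. k p) = 0)"

lemma relation_altdef: "relation n k \<longleftrightarrow> (\<forall>g x. (\<Sum>p\<in>trees n. k p *\<^sub>R tree_field p g x) = 0)"
  unfolding relation_def relation_iff ..

lemma bij_relabel:
  assumes \<sigma>: "\<sigma> permutes {0..<n}"
  shows "bij_betw (relabel \<sigma>) (trees n) (trees n)"
proof -
  have "inj_on (relabel \<sigma>) (trees n)"
  proof (rule inj_onI)
    fix p q assume p: "p \<in> trees n" and q: "q \<in> trees n" and eq: "relabel \<sigma> p = relabel \<sigma> q"
    have "p ! w = q ! w" if "w < n" for w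
      using relabel_nth[OF \<sigma>, of p w] relabel_nth[OF \<sigma>, of q w] p q eq that permutes_inj[OF \<sigma>]
      by (simp add: ptree_length inj_eq)
    then show "p = q" using p q by (intro nth_equalityI) (simp_all add: ptree_length)
  qed
  moreover have "relabel \<sigma> ` trees n \<subseteq> trees n" using ptree_relabel[OF \<sigma>] by auto
  ultimately show ?thesis
    using endo_inj_surj[OF finite_ptree] by (simp add: bij_betw_def)
qed

lemma relation_relabel:
  assumes \<sigma>: "\<sigma> permutes {0..<n}" and k: "relation n k"
  shows "relation n (\<lambda>p. k (relabel \<sigma> p))"
  unfolding relation_altdef
proof (intro allI)
  fix g :: inputs and x
  define h where "h = g \<circ> inv \<sigma>"
  have "h \<circ> \<sigma> = g" using permutes_inverses[OF \<sigma>] by (simp add: h_def fun_eq_iff)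
  then have "(\<Sum>p\<in>trees n. k (relabel \<sigma> p) *\<^sub>R tree_field p g x) = (\<Sum>p\<in>trees n. k (relabel \<sigma> p) *\<^sub>R tree_field (relabel \<sigma> p) h x)"
    by (intro sum.cong refl) (simp add: tree_field_relabel'[OF \<sigma>])
  also have "\<dots> = (\<Sum>p\<in>trees n. k p *\<^sub>R tree_field p h x)"
    by (rule sum.reindex_bij_betw[OF bij_relabel[OF \<sigma>]])
  finally show "(\<Sum>p\<in>trees n. k (relabel \<sigma> p) *\<^sub>R tree_field p g x) = 0"
    using k by (simp add: relation_altdef)
qed

lemma count_list_plus_count: "count_list p u = plus_count p S u + plus_count p (- S) u"
proof -
  have "{w. w < length p \<and> p ! w = u} = {w. w < length p \<and> w \<in> S \<and> p ! w = u} \<union> {w. w < length p \<and> w \<in> - S \<and> p ! w = u}"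
    by auto
  then have "card {w. w < length p \<and> p ! w = u} = plus_count p S u + plus_count p (- S) u"
    unfolding plus_count_def by (simp only:) (rule card_Un_disjoint; auto)
  then show ?thesis
    by (simp add: count_list_eq_length_filter length_filter_conv_card eq_commute[of u])
qed

definition degrees :: "nat \<Rightarrow> nat list \<Rightarrow> nat list" where
  "degrees n p = map (count_list p) [0..<n]"

lemma profile_degrees: "profile S p = profile S q \<Longrightarrow> degrees n p = degrees n q"
  by (simp add: degrees_def profile_def count_list_plus_count[of _ _ S])

text \<open>A profile determines the out-degrees, since the children of both colours add up. Hence
  all trees of a row have the same degrees, and the truncation keeps a row sum entirely or removes
  it entirely.\<close>

lemma relation_graded:
  assumes "relation n k" shows "relation n (\<lambda>p. if degrees n p = d then k p else 0)"
  unfolding relation_def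
proof (intro allI ballI)
  fix S q assume q: "q \<in> trees n"
  have "(\<Sum>p | p \<in> trees n \<and> profile S p = profile S q. if degrees n p = d then k p else 0)
     = (\<Sum>p | p \<in> trees n \<and> profile S p = profile S q. if degrees n q = d then k p else 0)"
  proof (rule sum.cong[OF refl])
    fix p assume "p \<in> {p \<in> trees n. profile S p = profile S q}"
    then have "degrees n p = degrees n q" by (intro profile_degrees[of S]) simp
    then show "(if degrees n p = d then k p else 0) = (if degrees n q = d then k p else 0)" by simp
  qed
  then show "(\<Sum>p | p \<in> trees n \<and> profile S p = profile S q. if degrees n p = d then k p else 0) = 0"
    using assms q by (cases "degrees n q = d") (simp_all add: relation_def)
qed

definition block :: "nat \<Rightarrow> nat list \<Rightarrow> nat list set" where
  "block n d = {p \<in> trees n. degrees n p = d}"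

text \<open>The relations among the trees with out-degrees \<open>d\<close> form a space on which \<open>\<sigma>\<close> has trace \<open>c\<close>;
  the space is described by a basis dual to evaluation at a set \<open>I\<close> of pivot trees.\<close>
definition relation_trace :: "nat \<Rightarrow> (nat \<Rightarrow> nat) \<Rightarrow> nat list \<Rightarrow> real \<Rightarrow> bool" where
  "relation_trace n \<sigma> d c \<longleftrightarrow> (\<exists>I k. I \<subseteq> block n d \<and>
     (\<forall>i\<in>I. relation n (k i) \<and> (\<forall>y\<in>trees n - block n d. k i y = 0) \<and> (\<forall>j\<in>I. k i j = (if i = j then 1 else 0))) \<and>
     (\<forall>l. relation n l \<and> (\<forall>y\<in>trees n - block n d. l y = 0) \<and> (\<forall>i\<in>I. l i = 0) \<longrightarrow> (\<forall>y\<in>block n d. l y = 0)) \<and>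
     (\<Sum>i\<in>I. k i (relabel \<sigma> i)) = c)"

lemma relabel_compose:
  assumes \<sigma>: "\<sigma> permutes {0..<n}" and \<tau>: "\<tau> permutes {0..<n}" and p: "length p = n"
  shows "relabel \<sigma> (relabel \<tau> p) = relabel (\<sigma> \<circ> \<tau>) p"
proof (rule relabel_eqI[OF permutes_compose[OF \<tau> \<sigma>] p])
  fix w assume w: "w < n"
  show "relabel \<sigma> (relabel \<tau> p) ! (\<sigma> \<circ> \<tau>) w = (\<sigma> \<circ> \<tau>) (p ! w)"
    using relabel_nth[OF \<sigma>, of "relabel \<tau> p" "\<tau> w"] relabel_nth[OF \<tau> p w] perm_less[OF \<tau>] w p by simp
qed (simp add: p)

lemma relabel_id: "length p = n \<Longrightarrow> relabel id p = p"
  by (rule relabel_eqI[OF permutes_id, symmetric]) simp_all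

lemma degrees_relabel:
  assumes \<sigma>: "\<sigma> permutes {0..<n}" and p: "length p = n" and u: "u < n"
  shows "degrees n (relabel \<sigma> p) ! \<sigma> u = degrees n p ! u"
  using count_list_relabel[OF \<sigma> p] u perm_less[OF \<sigma>, of u] by (simp add: degrees_def)

lemma degrees_relabel_iff:
  assumes \<sigma>: "\<sigma> permutes {0..<n}" and p: "length p = n" and d: "length d = n" "length d' = n"
    and eq: "\<And>u. u < n \<Longrightarrow> d' ! \<sigma> u = d ! u"
  shows "degrees n (relabel \<sigma> p) = d' \<longleftrightarrow> degrees n p = d"
proof
  assume L: "degrees n (relabel \<sigma> p) = d'"
  show "degrees n p = d"
  proof (rule nth_equalityI)
    fix u assume "u < length (degrees n p)"
    then have "u < n" by (simp add: degrees_def)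
    then show "degrees n p ! u = d ! u" using degrees_relabel[OF \<sigma> p, of u] eq L by simp
  qed (simp add: degrees_def d)
next
  assume R: "degrees n p = d"
  show "degrees n (relabel \<sigma> p) = d'"
  proof (rule nth_equalityI)
    fix v assume "v < length (degrees n (relabel \<sigma> p))"
    moreover obtain u where v: "v = \<sigma> u" using permutes_surj[OF \<sigma>] by (meson surjD)
    ultimately have "u < n" using perm_less[OF \<sigma>] by (simp add: degrees_def)
    then show "degrees n (relabel \<sigma> p) ! v = d' ! v"
      unfolding v degrees_relabel[OF \<sigma> p \<open>u < n\<close>] R eq[OF \<open>u < n\<close>] by simp
  qed (simp add: degrees_def d)
qed

text \<open>The involution \<psi> carries pivots and dual relations from one block to the other, and
  the trace survives because \<psi> commutes with \<sigma>. Two of the five blocks thus need no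
  certificate of their own.\<close>

lemma relation_trace_transport:
  assumes \<sigma>: "\<sigma> permutes {0..<n}" and \<psi>: "\<psi> permutes {0..<n}" and inv: "\<psi> \<circ> \<psi> = id" and comm: "\<sigma> \<circ> \<psi> = \<psi> \<circ> \<sigma>"
    and d': "\<And>p. p \<in> trees n \<Longrightarrow> degrees n (relabel \<psi> p) = d' \<longleftrightarrow> degrees n p = d"
    and tr: "relation_trace n \<sigma> d c"
  shows "relation_trace n \<sigma> d' c"
proof -
  define m where "m = relabel \<psi>"
  obtain I k where H: "I \<subseteq> block n d \<and>
     (\<forall>i\<in>I. relation n (k i) \<and> (\<forall>y\<in>trees n - block n d. k i y = 0) \<and> (\<forall>j\<in>I. k i j = (if i = j then 1 else 0))) \<and>
     (\<forall>l. relation n l \<and> (\<forall>y\<in>trees n - block n d. l y = 0) \<and> (\<forall>i\<in>I. l i = 0) \<longrightarrow> (\<forall>y\<in>block n d. l y = 0)) \<and>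
     (\<Sum>i\<in>I. k i (relabel \<sigma> i)) = c"
    using tr unfolding relation_trace_def by (elim exE) (rule that)
  note I = H[THEN conjunct1] and ks = H[THEN conjunct2, THEN conjunct1]
    and dets = H[THEN conjunct2, THEN conjunct2, THEN conjunct1] and c = H[THEN conjunct2, THEN conjunct2, THEN conjunct2]
  have k: "relation n (k i)" "y \<in> trees n - block n d \<Longrightarrow> k i y = 0" "j \<in> I \<Longrightarrow> k i j = (if i = j then 1 else 0)"
    if "i \<in> I" for i j y using ks that by simp_all
  have det: "l y = 0" if "relation n l" "\<forall>y\<in>trees n - block n d. l y = 0" "\<forall>i\<in>I. l i = 0" "y \<in> block n d" for l y
    using dets that by blast
  have mT: "m p \<in> trees n" if "p \<in> trees n" for p using ptree_relabel[OF \<psi>] that by (simp add: m_def)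
  have mm: "m (m p) = p" if "p \<in> trees n" for p
    using that by (simp add: m_def relabel_compose[OF \<psi> \<psi>] inv ptree_length relabel_id)
  have ms: "m (relabel \<sigma> (m p)) = relabel \<sigma> p" if "p \<in> trees n" for p
  proof -
    have "m (relabel \<sigma> (m p)) = relabel (\<psi> \<circ> (\<sigma> \<circ> \<psi>)) p"
      using that by (simp add: m_def relabel_compose[OF \<sigma> \<psi>] relabel_compose[OF \<psi> permutes_compose[OF \<psi> \<sigma>]] ptree_length)
    also have "\<psi> \<circ> (\<sigma> \<circ> \<psi>) = \<sigma>" unfolding comm by (simp add: inv flip: comp_assoc)
    finally show ?thesis .
  qed
  have mb: "m p \<in> block n d' \<longleftrightarrow> p \<in> block n d" if "p \<in> trees n" for p
    using d'[OF that] mT[OF that] that by (simp add: block_def m_def)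
  have mb': "m p \<in> block n d \<longleftrightarrow> p \<in> block n d'" if "p \<in> trees n" for p
    using mb[OF mT[OF that]] mm[OF that] by simp
  have IT: "I \<subseteq> trees n" using I by (auto simp: block_def)
  have inj: "inj_on m I" by (rule inj_on_inverseI[of _ m]) (use mm IT in auto)
  define k' where "k' = (\<lambda>i y. k (m i) (m y))"
  show ?thesis
    unfolding relation_trace_def
  proof (intro exI[of _ "m ` I"] exI[of _ k'] conjI ballI allI impI)
    show "m ` I \<subseteq> block n d'" using I IT mb by auto
    fix i assume "i \<in> m ` I"
    then obtain i0 where i0: "i0 \<in> I" "i = m i0" "i0 \<in> trees n" using IT by auto
    have k'i: "k' i y = k i0 (m y)" for y using i0 mm by (simp add: k'_def)
    show "relation n (k' i)" unfolding k'i m_def by (rule relation_relabel[OF \<psi> k(1)[OF i0(1)]])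
    show "k' i y = 0" if "y \<in> trees n - block n d'" for y
      unfolding k'i using k(2)[OF i0(1)] mb' mT that by simp
    fix j assume "j \<in> m ` I"
    then obtain j0 where j0: "j0 \<in> I" "j = m j0" "j0 \<in> trees n" using IT by auto
    have "k' i j = k i0 j0" using k'i mm j0 by simp
    moreover have "i = j \<longleftrightarrow> i0 = j0" using mm i0 j0 by metis
    ultimately show "k' i j = (if i = j then 1 else 0)" using k(3) i0 j0 by simp
  next
    fix l y assume l: "relation n l \<and> (\<forall>y\<in>trees n - block n d'. l y = 0) \<and> (\<forall>i\<in>m ` I. l i = 0)" and y: "y \<in> block n d'"
    then have yT: "y \<in> trees n" by (simp add: block_def)
    have "l (m (m y)) = 0"
    proof (rule det[where l = "\<lambda>p. l (m p)" and y = "m y"])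
      show "relation n (\<lambda>p. l (m p))" unfolding m_def using l relation_relabel[OF \<psi>] by blast
      show "\<forall>y\<in>trees n - block n d. l (m y) = 0" using l mb mT by simp
      show "\<forall>i\<in>I. l (m i) = 0" using l by simp
      show "m y \<in> block n d" using mb'[OF yT] y by simp
    qed
    then show "l y = 0" using mm[OF yT] by simp
  next
    have "(\<Sum>i\<in>m ` I. k' i (relabel \<sigma> i)) = (\<Sum>i\<in>I. k (m (m i)) (m (relabel \<sigma> (m i))))"
      by (simp add: sum.reindex[OF inj] k'_def)
    also have "\<dots> = (\<Sum>i\<in>I. k i (relabel \<sigma> i))"
      using IT by (intro sum.cong refl) (auto simp: mm ms)
    finally show "(\<Sum>i\<in>m ` I. k' i (relabel \<sigma> i)) = c" using c by simp
  qed
qed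

section \<open>Certificates\<close>

text \<open>A computable name of a row: in a block with given out-degrees, the multiset of parents
  of \<open>S\<close> also determines that of the complement of \<open>S\<close>.\<close>

definition row_key :: "nat list \<Rightarrow> nat list \<Rightarrow> nat list" where
  "row_key S p = foldr insort (map ((!) p) S) []"

text \<open>Entries whose total becomes 0 are dropped, so an empty result certifies that all row
  sums vanish.\<close>

fun bump :: "nat list \<Rightarrow> int \<Rightarrow> (nat list \<times> int) list \<Rightarrow> (nat list \<times> int) list" where
  "bump k c [] = [(k, c)]"
| "bump k c ((k', c') # xs) =
    (if k = k' then (if c + c' = 0 then xs else (k, c + c') # xs) else (k', c') # bump k c xs)"

fun row_sums :: "nat list \<Rightarrow> (nat list \<times> int) list \<Rightarrow> (nat list \<times> int) list" where
  "row_sums S [] = []"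
| "row_sums S ((p, c) # r) = bump (row_key S p) c (row_sums S r)"

text \<open>A set of vertices and its complement define the same rows, so the sets that contain \<open>0\<close> suffice.\<close>
fun check_rows :: "(nat list \<times> int) list \<Rightarrow> nat list list \<Rightarrow> bool" where
  "check_rows r [] = True"
| "check_rows r (S # Ss) = (row_sums (0 # S) r = [] \<and> check_rows r Ss)"

fun reaches :: "nat \<Rightarrow> nat list \<Rightarrow> nat \<Rightarrow> bool" where
  "reaches 0 p v = (v = 7)"
| "reaches (Suc k) p v = (if v = 7 then True else reaches k p (p ! v))"

fun all_reach :: "nat list \<Rightarrow> nat list \<Rightarrow> bool" where
  "all_reach p [] = True"
| "all_reach p (w # ws) = (if reaches 7 p w then all_reach p ws else False)"

definition rooted :: "nat list \<Rightarrow> bool" where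
  "rooted p = all_reach p [0, 1, 2, 3, 4, 5, 6]"

text \<open>The entry 1 appended to \<open>d\<close> counts the occurrences of 7, the mark of the
  root; it forces the root to be unique.\<close>

fun check_keys :: "nat list \<Rightarrow> (nat list \<times> int) list \<Rightarrow> bool" where
  "check_keys d [] = True"
| "check_keys d ((p, c) # r) = (length p = 7 \<and> list_all (\<lambda>v. v \<le> 7) p \<and>
     map (count_list p) [0, 1, 2, 3, 4, 5, 6, 7] = d @ [1] \<and> rooted p \<and> check_keys d r)"

fun check_relations :: "nat list \<Rightarrow> (nat list \<times> (nat list \<times> int) list) list \<Rightarrow> bool" where
  "check_relations d [] = True"
| "check_relations d ((x, r) # rs) =
    (check_keys d r \<and> check_rows r (subseqs [1, 2, 3, 4, 5, 6]) \<and> check_relations d rs)"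

fun fresh :: "nat list \<Rightarrow> nat list \<Rightarrow> (nat list \<times> nat list) list \<Rightarrow> bool" where
  "fresh S k [] = True"
| "fresh S k ((u, U) # xs) = (row_key S u \<noteq> k \<and> fresh S k xs)"

fun check_order :: "(nat list \<times> nat list) list \<Rightarrow> bool" where
  "check_order [] = True"
| "check_order ((t, S) # xs) =
    (distinct S \<and> list_all (\<lambda>w. w < 7) S \<and> fresh S (row_key S t) xs \<and> check_order xs)"

fun narrow :: "nat \<Rightarrow> nat list list \<Rightarrow> nat list list" where
  "narrow i [] = []"
| "narrow i ([] # ts) = narrow i ts"
| "narrow i ((x # t) # ts) = (if x = i then t # narrow i ts else narrow i ts)"

text \<open>An exhaustive search for parent lists, from left to right: \<open>cs\<close> says how
  often each parent may still be used, \<open>p\<close> is the reversed prefix, and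
  \<open>ts\<close> holds the remainders of the listed trees with this prefix. Fixing the budget by
  the out-degrees leaves only the rearrangements of one multiset, and each of them must be listed or
  fail to be a tree.\<close>

fun cover :: "nat \<Rightarrow> nat list \<Rightarrow> nat list \<Rightarrow> nat list list \<Rightarrow> bool"
  and cover_digits :: "nat list \<Rightarrow> nat \<Rightarrow> nat list \<Rightarrow> nat list \<Rightarrow> nat list list \<Rightarrow> bool" where
  "cover 0 cs p ts = (if [] \<in> set ts then True else \<not> rooted (rev p))"
| "cover (Suc k) cs p ts = cover_digits [0, 1, 2, 3, 4, 5, 6, 7] k cs p ts"
| "cover_digits [] k cs p ts = True"
| "cover_digits (i # is) k cs p ts =
    ((if cs ! i = 0 then True else cover k (cs[i := cs ! i - 1]) (i # p) (narrow i ts)) \<and> cover_digits is k cs p ts)"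

fun lookup :: "('a \<times> int) list \<Rightarrow> 'a \<Rightarrow> int" where
  "lookup [] p = 0"
| "lookup ((q, c) # r) p = (if q = p then c + lookup r p else lookup r p)"

fun pivot_row :: "(nat list \<times> int) list \<Rightarrow> nat list list \<Rightarrow> (nat list \<times> int) list" where
  "pivot_row [] xs = []"
| "pivot_row ((q, c) # r) xs = (if q \<in> set xs then (q, c) # pivot_row r xs else pivot_row r xs)"

text \<open>Restricted to the pivots, a relation must be the unit vector at its own pivot. This is
  the required duality, and it places the pivot in the support of a relation, hence in the
  block.\<close>

fun check_pivots :: "(nat list \<times> (nat list \<times> int) list) list \<Rightarrow> nat list list \<Rightarrow> bool" where
  "check_pivots [] xs = True"
| "check_pivots ((x, r) # rs) xs = (pivot_row r xs = [(x, 1)] \<and> check_pivots rs xs)"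

text \<open>The list of positions on the right is the inverse of \<open>sigma7\<close>; the list on
  the left is \<open>sigma7\<close> with the root mark 7 as a fixed point.\<close>

definition rotate_tree :: "nat list \<Rightarrow> nat list" where
  "rotate_tree p = map ((!) [1, 2, 0, 4, 3, 6, 5, 7]) (map ((!) p) [2, 0, 1, 4, 3, 6, 5])"

fun cert_trace :: "(nat list \<times> (nat list \<times> int) list) list \<Rightarrow> int" where
  "cert_trace [] = 0"
| "cert_trace ((x, r) # rs) = lookup r (rotate_tree x) + cert_trace rs"

section \<open>Soundness of the checks\<close>

lemma row_key_sort: "row_key S p = sort (map ((!) p) S)"
  by (simp add: row_key_def sort_key_def)

lemma atMost7: "v \<le> 7 \<Longrightarrow> v \<in> {0, 1, 2, 3, 4, 5, 6, 7 :: nat}"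
  by auto

lemma upt7: "[0..<7] = [0, 1, 2, 3, 4, 5, 6]"
  by (simp add: upt_rec)

lemma rooted_iff:
  assumes "length p = 7" "\<And>v. v < 7 \<Longrightarrow> p ! v \<le> 7"
  shows "rooted p \<longleftrightarrow> (\<forall>w<7. (par p ^^ 7) w = 7)"
proof -
  have reaches: "reaches k p v \<longleftrightarrow> (par p ^^ k) v = 7" if "v \<le> 7" for k v
    using that
  proof (induction k arbitrary: v)
    case (Suc k)
    show ?case
    proof (cases "v = 7")
      case True
      then show ?thesis
        using par_funpow_stable[where p = p and k = 0 and w = 7 and l = "Suc k"] assms(1) by simp
    next
      case False
      then have "par p v = p ! v" "p ! v \<le> 7" using Suc.prems assms by (simp_all add: par_def)
      then show ?thesis
        using Suc.IH[of "p ! v"] False by (simp add: funpow_Suc_right del: funpow.simps(2))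
    qed
  qed simp
  have "all_reach p ws \<longleftrightarrow> (\<forall>w\<in>set ws. reaches 7 p w)" for ws
    by (induction ws) auto
  then have "rooted p \<longleftrightarrow> (\<forall>w\<in>set [0..<7]. reaches 7 p w)"
    by (simp add: rooted_def upt7)
  then show ?thesis using reaches by auto
qed

lemma block7I:
  assumes len: "length p = 7" and le: "list_all (\<lambda>v. v \<le> 7) p"
    and cnt: "map (count_list p) [0, 1, 2, 3, 4, 5, 6, 7] = d @ [1]" and root: "rooted p"
  shows "p \<in> block 7 d"
proof -
  have le': "p ! v \<le> 7" if "v < 7" for v using le len that by (simp add: list_all_length)
  have d: "degrees 7 p = d" and one: "count_list p 7 = 1"
    using arg_cong[OF cnt, of butlast] arg_cong[OF cnt, of last] by (simp_all add: degrees_def upt7)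
  have "card {i. i < length p \<and> p ! i = 7} = 1"
    using one by (simp add: count_list_eq_length_filter length_filter_conv_card eq_commute[of 7])
  then obtain r where "{i. i < length p \<and> p ! i = 7} = {r}" by (auto simp: card_1_singleton_iff)
  then have "\<exists>!r. r < 7 \<and> p ! r = 7" using len by (intro ex1I[of _ r]) auto
  moreover have "set p \<subseteq> {..7}" using le by (auto simp: list_all_iff)
  moreover have "\<forall>w<7. (par p ^^ 7) w = 7" using root rooted_iff[OF len le'] by simp
  ultimately show ?thesis using len d by (simp add: block_def ptree_def)
qed

lemma block7D:
  assumes "p \<in> block 7 d"
  shows "length p = 7" "\<And>v. v < 7 \<Longrightarrow> p ! v \<le> 7" "set p \<subseteq> {..7}" "rooted p" "degrees 7 p = d" "count_list p 7 = 1"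
proof -
  have p: "ptree 7 p" and d: "degrees 7 p = d" using assms by (simp_all add: block_def)
  show len: "length p = 7" using ptree_length[OF p] .
  show le: "\<And>v. v < 7 \<Longrightarrow> p ! v \<le> 7" using ptree_le[OF p] .
  show "rooted p" using p rooted_iff[OF len le] by (simp add: ptree_def)
  show "set p \<subseteq> {..7}" using p by (simp add: ptree_def)
  have "{i. i < length p \<and> p ! i = 7} = {proot p}" using proot[OF p] len by auto
  then show "count_list p 7 = 1"
    by (simp add: count_list_eq_length_filter length_filter_conv_card eq_commute[of 7])
qed (use assms in \<open>simp add: block_def\<close>)

lemma set_narrow: "set (narrow i ts) = {t. i # t \<in> set ts}"
  by (induction i ts rule: narrow.induct) auto

lemma cover_digits_iff:
  "cover_digits is k cs p ts \<longleftrightarrow>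
    (\<forall>i\<in>set is. cs ! i \<noteq> 0 \<longrightarrow> cover k (cs[i := cs ! i - 1]) (i # p) (narrow i ts))"
  by (induction "is") auto

lemma coverD:
  assumes "cover k cs p ts" "length w = k" "set w \<subseteq> {..7}" "length cs = 8"
    "\<And>x. x \<in> set w \<Longrightarrow> count_list w x \<le> cs ! x" "rooted (rev p @ w)"
  shows "w \<in> set ts"
  using assms
proof (induction k arbitrary: cs p ts w)
  case 0
  then show ?case by (auto split: if_splits)
next
  case (Suc k)
  obtain i v where w: "w = i # v" "length v = k" using Suc.prems(2) by (auto simp: length_Suc_conv)
  have i: "i \<le> 7" using Suc.prems(3) w by simp
  have c: "1 + count_list v i \<le> cs ! i" using Suc.prems(5)[of i] w by simp
  have "v \<in> set (narrow i ts)"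
  proof (rule Suc.IH)
    show "cover k (cs[i := cs ! i - 1]) (i # p) (narrow i ts)"
    proof -
      have "i \<in> set [0, 1, 2, 3, 4, 5, 6, 7]" unfolding set_simps by (rule atMost7[OF i])
      from bspec[OF Suc.prems(1)[unfolded cover.simps cover_digits_iff] this] show ?thesis using c by linarith
    qed
    show "count_list v x \<le> cs[i := cs ! i - 1] ! x" if "x \<in> set v" for x
      using Suc.prems(4) Suc.prems(5)[of x] that w c i by (cases "x = i") (auto split: if_splits)
  qed (use Suc.prems(2,3,4,6) w in auto)
  then show ?case by (simp add: set_narrow w)
qed

lemma block_subset_cover:
  assumes "cover 7 (d @ [1]) [] ts" "length d = 7"
  shows "block 7 d \<subseteq> set ts"
proof
  fix p assume p: "p \<in> block 7 d"
  note D = block7D[OF p]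
  show "p \<in> set ts"
  proof (rule coverD[OF assms(1) D(1,3)])
    fix x assume "x \<in> set p"
    then have "x \<le> 7" using D(3) by blast
    then consider "x < 7" | "x = 7" by linarith
    then show "count_list p x \<le> (d @ [1]) ! x"
    proof cases
      case 1
      then have "d ! x = count_list p x" unfolding D(5)[symmetric] degrees_def by simp
      then show ?thesis using 1 assms(2) by (simp add: nth_append)
    qed (use D(6) assms(2) in \<open>simp add: nth_append\<close>)
  qed (use assms D in auto)
qed

text \<open>Both trees have the same out-degrees and exactly one root, so the counts of parents over
  all vertices agree; subtracting those over \<open>S\<close> leaves those over the
  complement.\<close>

lemma profile_eq_iff:
  assumes S: "distinct S" "set S \<subseteq> {..<7}" and p: "p \<in> block 7 d" and q: "q \<in> block 7 d"
  shows "profile (set S) p = profile (set S) q \<longleftrightarrow> row_key S p = row_key S q"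
proof -
  note P = block7D[OF p] note Q = block7D[OF q]
  have cnt: "count (mset (map ((!) r) S)) u = plus_count r (set S) u" if "length r = 7" for r u
  proof -
    have "count (mset (map ((!) r) S)) u = card {w \<in> set S. r ! w = u}"
      unfolding count_mset count_list_eq_length_filter
      using S(1) by (simp add: filter_map o_def distinct_card[symmetric] eq_commute[of u])
    also have "{w \<in> set S. r ! w = u} = {w. w < length r \<and> w \<in> set S \<and> r ! w = u}"
      using S(2) that by auto
    finally show ?thesis by (simp add: plus_count_def)
  qed
  have "row_key S p = row_key S q \<longleftrightarrow> mset (map ((!) p) S) = mset (map ((!) q) S)"
    unfolding row_key_sort by (metis mset_sort sorted_list_of_multiset_mset)
  also have "\<dots> \<longleftrightarrow> plus_count p (set S) = plus_count q (set S)"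
    by (simp only: multiset_eq_iff cnt P(1) Q(1) fun_eq_iff)
  also have "\<dots> \<longleftrightarrow> profile (set S) p = profile (set S) q"
  proof -
    have all: "count_list p u = count_list q u" for u
    proof -
      consider "u < 7" | "u = 7" | "u > 7" by linarith
      then show ?thesis
      proof cases
        case 1
        then show ?thesis using arg_cong[OF trans[OF P(5) Q(5)[symmetric]], of "\<lambda>xs. xs ! u"] by (simp add: degrees_def)
      next
        case 3
        then have "u \<notin> set p" "u \<notin> set q" using P(3) Q(3) by auto
        then show ?thesis by simp
      qed (use P(6) Q(6) in simp)
    qed
    have "plus_count p (- set S) = plus_count q (- set S)" if "plus_count p (set S) = plus_count q (set S)"
    proof
      fix u show "plus_count p (- set S) u = plus_count q (- set S) u"
        using all[of u] that count_list_plus_count[of p u "set S"] count_list_plus_count[of q u "set S"] by simp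
    qed
    then show ?thesis by (auto simp: profile_def)
  qed
  finally show ?thesis by simp
qed

lemma lookup_bump: "lookup (bump k c xs) \<kappa> = (if k = \<kappa> then c else 0) + lookup xs \<kappa>"
  by (induction k c xs rule: bump.induct) auto

lemma lookup_row_sums: "lookup (row_sums S r) \<kappa> = (\<Sum>(p, c)\<leftarrow>r. if row_key S p = \<kappa> then c else 0)"
  by (induction S r rule: row_sums.induct) (auto simp: lookup_bump)

lemma sum_lookup:
  assumes "finite A" shows "(\<Sum>p\<in>A. lookup r p) = (\<Sum>(p, c)\<leftarrow>r. if p \<in> A then c else 0)"
proof (induction r)
  case (Cons a r)
  obtain q c where a: "a = (q, c)" by force
  have "(\<Sum>p\<in>A. lookup (a # r) p) = (\<Sum>p\<in>A. (if p = q then c else 0) + lookup r p)"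
    by (intro sum.cong refl) (simp add: a)
  then show ?case using assms Cons by (simp add: a sum.distrib)
qed simp

lemma check_rows_iff: "check_rows r Ss \<longleftrightarrow> (\<forall>S\<in>set Ss. row_sums (0 # S) r = [])"
  by (induction Ss) auto

lemma check_keysD: "check_keys d r \<Longrightarrow> (p, c) \<in> set r \<Longrightarrow> p \<in> block 7 d"
  by (induction d r rule: check_keys.induct) (auto intro: block7I)

lemma lookup_outside: "check_keys d r \<Longrightarrow> p \<notin> block 7 d \<Longrightarrow> lookup r p = 0"
  by (induction d r rule: check_keys.induct) (auto dest: block7I)

lemma relation_lookup:
  assumes keys: "check_keys d r" and rows: "check_rows r (subseqs [1, 2, 3, 4, 5, 6])"
  shows "relation 7 (\<lambda>p. real_of_int (lookup r p))"
proof -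
  have zero: "(\<Sum>p | p \<in> trees 7 \<and> profile S p = profile S q. lookup r p) = 0"
    if q: "q \<in> trees 7" and S: "0 \<in> S" for S q
  proof (cases "q \<in> block 7 d")
    case False
    have "lookup r p = 0" if "p \<in> trees 7" "profile S p = profile S q" for p
      using lookup_outside[OF keys, of p] profile_degrees[OF that(2), of 7] False q that(1) by (auto simp: block_def)
    then show ?thesis by (intro sum.neutral) simp
  next
    case True
    \<comment> \<open>A profile depends only on the vertices below 7, so the arbitrary set
      \<open>S\<close> is replaced by one of the finitely many sets that were checked.\<close>
    have "S \<inter> {1, 2, 3, 4, 5, 6} \<in> set ` set (subseqs [1, 2, 3, 4, 5, 6])"
      unfolding subseqs_powset by auto
    then obtain T where T: "set T = S \<inter> {1, 2, 3, 4, 5, 6}" "T \<in> set (subseqs [1, 2, 3, 4, 5, 6])"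
      by (elim imageE) (rule that, rule sym)
    have "distinct T" by (rule subseqs_distinctD[OF T(2)]) simp
    then have dT: "distinct (0 # T)" using T(1) by auto
    have "{..<7} = {0, 1, 2, 3, 4, 5, 6 :: nat}" by auto
    then have set: "set (0 # T) = S \<inter> {..<7}" using T(1) S by auto
    have prof: "profile S p = profile (set (0 # T)) p" if "p \<in> trees 7" for p
      using that set by (intro profile_cong) (auto simp: ptree_length)
    have key: "p \<in> {p \<in> trees 7. profile S p = profile S q} \<longleftrightarrow> row_key (0 # T) p = row_key (0 # T) q"
      if "p \<in> block 7 d" for p
    proof -
      have "set (0 # T) \<subseteq> {..<7}" unfolding set by blast
      then show ?thesis
        using profile_eq_iff[OF dT _ that True] prof[of p] prof[OF q] that by (simp add: block_def)
    qed
    have fin: "finite {p \<in> trees 7. profile S p = profile S q}" using finite_ptree by simp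
    have "(\<Sum>p | p \<in> trees 7 \<and> profile S p = profile S q. lookup r p)
       = (\<Sum>(p, c)\<leftarrow>r. if row_key (0 # T) p = row_key (0 # T) q then c else 0)"
      unfolding sum_lookup[OF fin]
      by (intro arg_cong[of _ _ sum_list] map_cong refl) (use key check_keysD[OF keys] in \<open>auto split del: if_split\<close>)
    also have "\<dots> = 0"
      using bspec[OF rows[unfolded check_rows_iff] T(2)] lookup_row_sums[of "0 # T" r "row_key (0 # T) q"] by simp
    finally show ?thesis .
  qed
  show ?thesis
    unfolding relation_def
  proof (intro allI ballI)
    fix S :: "nat set" and q assume q: "q \<in> trees 7"
    define S' where "S' = (if 0 \<in> S then S else - S)"
    have "profile S p = profile S q \<longleftrightarrow> profile S' p = profile S' q" for p
      by (auto simp: S'_def profile_def)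
    moreover have "0 \<in> S'" by (simp add: S'_def)
    ultimately have "(\<Sum>p | p \<in> trees 7 \<and> profile S p = profile S q. lookup r p) = 0"
      using zero[OF q, of S'] by simp
    then show "(\<Sum>p | p \<in> trees 7 \<and> profile S p = profile S q. real_of_int (lookup r p)) = 0"
      by (simp flip: of_int_sum)
  qed
qed

lemma of_int_sum_list: "real_of_int (sum_list (map f xs)) = sum_list (map (\<lambda>x. real_of_int (f x)) xs)"
  by (induction xs) simp_all

section \<open>The permutation and the trace of a certificate\<close>

definition sigma7 :: "nat \<Rightarrow> nat" where
  "sigma7 v = (if v < 7 then [1, 2, 0, 4, 3, 6, 5] ! v else v)"

lemma atLeastLessThan7: "{0..<7} = {0, 1, 2, 3, 4, 5, 6 :: nat}"
  by auto

lemma sigma7_permutes: "sigma7 permutes {0..<7}"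
proof (rule bij_imp_permutes)
  show "bij_betw sigma7 {0..<7} {0..<7}"
    unfolding atLeastLessThan7 bij_betw_def by (auto simp: sigma7_def inj_on_def)
qed (simp add: sigma7_def)

lemma rotate_tree_eq_relabel:
  assumes "p \<in> block 7 d" shows "rotate_tree p = relabel sigma7 p"
proof (rule relabel_eqI[OF sigma7_permutes])
  note D = block7D[OF assms]
  show "length p = 7" "length (rotate_tree p) = 7" using D by (simp_all add: rotate_tree_def)
  fix w :: nat assume w: "w < 7"
  have sigma: "sigma7 v = [1, 2, 0, 4, 3, 6, 5, 7] ! v" if "v \<le> 7" for v
    using atMost7[OF that] by (auto simp: sigma7_def)
  have "w \<in> {0, 1, 2, 3, 4, 5, 6}" using w unfolding atLeastLessThan7[symmetric] by simp
  then show "rotate_tree p ! sigma7 w = sigma7 (p ! w)"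
    unfolding sigma[OF D(2)[OF w]] by (auto simp: rotate_tree_def sigma7_def)
qed

lemma freshD: "fresh S k xs \<Longrightarrow> u \<in> set (map fst xs) \<Longrightarrow> row_key S u \<noteq> k"
  by (induction S k xs rule: fresh.induct) auto

text \<open>Each tree of the list is the only remaining one in one of its rows, so a relation \<open>l\<close> is
  determined by its values outside the list.\<close>
lemma check_orderD:
  assumes "check_order xs" and l: "relation 7 l" "\<And>y. y \<in> trees 7 - block 7 d \<Longrightarrow> l y = 0"
    and "\<And>y. y \<in> block 7 d \<Longrightarrow> y \<notin> set (map fst xs) \<Longrightarrow> l y = 0" and "y \<in> block 7 d"
  shows "l y = 0"
  using assms(1,4)
proof (induction xs)
  case Nil
  then show ?case using assms(5) by simp
next
  case (Cons a xs)
  obtain t S where a: "a = (t, S)" by force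
  have S: "distinct S" "set S \<subseteq> {..<7}" and fresh: "fresh S (row_key S t) xs" and xs: "check_order xs"
    using Cons.prems(1) by (auto simp: a list_all_iff)
  have lt: "l t = 0" if t: "t \<in> block 7 d"
  proof -
    define R where "R = {p. p \<in> trees 7 \<and> profile (set S) p = profile (set S) t}"
    have tT: "t \<in> trees 7" using t by (simp add: block_def)
    have "l p = 0" if p: "p \<in> R - {t}" for p
    proof (cases "p \<in> block 7 d")
      case True
      have "row_key S p = row_key S t" using profile_eq_iff[OF S True t] p by (simp add: R_def)
      then have "p \<notin> set (map fst xs)" using freshD[OF fresh] by blast
      then show ?thesis using Cons.prems(2)[OF True] p by (simp add: a)
    next
      case False
      then show ?thesis using l(2)[of p] p by (simp add: R_def)
    qed
    then have "(\<Sum>p\<in>R. l p) = (\<Sum>p\<in>{t}. l p)"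
      using finite_ptree[of 7] tT by (intro sum.mono_neutral_right) (auto simp: R_def)
    moreover have "(\<Sum>p\<in>R. l p) = 0" using l(1) tT unfolding relation_def R_def by blast
    ultimately show ?thesis by simp
  qed
  show ?case
  proof (rule Cons.IH[OF xs])
    fix y assume y: "y \<in> block 7 d" "y \<notin> set (map fst xs)"
    show "l y = 0"
    proof (cases "y = t")
      case True
      then show ?thesis using lt y(1) by simp
    next
      case False
      then show ?thesis using Cons.prems(2)[OF y(1)] y(2) by (simp add: a)
    qed
  qed
qed

lemma check_pivotsD: "check_pivots rs xs \<Longrightarrow> (x, r) \<in> set rs \<Longrightarrow> pivot_row r xs = [(x, 1)]"
  by (induction rs xs rule: check_pivots.induct) auto

lemma lookup_pivot_row: "j \<in> set xs \<Longrightarrow> lookup (pivot_row r xs) j = lookup r j"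
  by (induction r xs rule: pivot_row.induct) auto

lemma set_pivot_row: "set (pivot_row r xs) \<subseteq> set r"
  by (induction r xs rule: pivot_row.induct) auto

lemma check_relationsD:
  "check_relations d rs \<Longrightarrow> (x, r) \<in> set rs \<Longrightarrow> check_keys d r \<and> check_rows r (subseqs [1, 2, 3, 4, 5, 6])"
  by (induction d rs rule: check_relations.induct) (auto simp del: subseqs.simps)

lemma cert_trace_eq: "cert_trace rs = (\<Sum>(x, r)\<leftarrow>rs. lookup r (rotate_tree x))"
  by (induction rs rule: cert_trace.induct) auto

text \<open>The list \<open>rs\<close> pairs each pivot tree with the relation dual to it, and \<open>xs\<close> pairs each other tree
  with the vertices that define the row used to eliminate it.\<close>
theorem relation_trace_certificate:
  assumes d: "length d = 7" and cov: "cover 7 (d @ [1]) [] (map fst rs @ map fst xs)"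
    and order: "check_order xs" and rels: "check_relations d rs"
    and piv: "check_pivots rs (map fst rs)" and dist: "distinct (map fst rs)"
  shows "relation_trace 7 sigma7 d (real_of_int (cert_trace rs))"
proof -
  define I where "I = set (map fst rs)"
  define k where "k = (\<lambda>i p. real_of_int (lookup (the (map_of rs i)) p))"
  have k: "k i = (\<lambda>p. real_of_int (lookup r p))" if "(i, r) \<in> set rs" for i r
    using map_of_is_SomeI[OF dist that] by (simp add: k_def)
  have ex: "\<exists>r. (i, r) \<in> set rs" if "i \<in> I" for i using that by (auto simp: I_def)
  have IY: "I \<subseteq> block 7 d"
  proof
    fix i assume "i \<in> I"
    then obtain r where r: "(i, r) \<in> set rs" using ex by blast
    have "(i, 1) \<in> set r" using check_pivotsD[OF piv r] set_pivot_row[of r "map fst rs"] by auto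
    then show "i \<in> block 7 d" using check_relationsD[OF rels r] check_keysD by blast
  qed
  have "relation_trace 7 sigma7 d (\<Sum>i\<in>I. k i (relabel sigma7 i))"
    unfolding relation_trace_def
  proof (intro exI[of _ I] exI[of _ k] conjI ballI allI impI IY refl)
    fix i assume i: "i \<in> I"
    then obtain r where r: "(i, r) \<in> set rs" using ex by blast
    note R = check_relationsD[OF rels r]
    show "relation 7 (k i)" unfolding k[OF r] using R relation_lookup by blast
    show "k i y = 0" if "y \<in> trees 7 - block 7 d" for y
      using lookup_outside[of d r y] R that by (simp add: k[OF r])
    show "k i j = (if i = j then 1 else 0)" if "j \<in> I" for j
      using lookup_pivot_row[of j "map fst rs" r] check_pivotsD[OF piv r] that
      unfolding k[OF r] I_def by (cases "i = j") simp_all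
  next
    fix l y
    assume l: "relation 7 l \<and> (\<forall>y\<in>trees 7 - block 7 d. l y = 0) \<and> (\<forall>i\<in>I. l i = 0)" and y: "y \<in> block 7 d"
    show "l y = 0"
    proof (rule check_orderD[OF order, of l d])
      fix y assume "y \<in> block 7 d" "y \<notin> set (map fst xs)"
      \<comment> \<open>By the exhaustive enumeration, a tree of the block that \<open>xs\<close>
        does not eliminate is a pivot.\<close>
      then have "y \<in> I" using block_subset_cover[OF cov d] by (auto simp: I_def)
      then show "l y = 0" using l by blast
    qed (use l y in auto)
  qed
  also have "(\<Sum>i\<in>I. k i (relabel sigma7 i)) = (\<Sum>i\<in>I. real_of_int (lookup (the (map_of rs i)) (rotate_tree i)))"
    using IY rotate_tree_eq_relabel by (intro sum.cong refl) (auto simp: k_def)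
  also have "\<dots> = (\<Sum>i\<leftarrow>map fst rs. real_of_int (lookup (the (map_of rs i)) (rotate_tree i)))"
    unfolding I_def using dist by (simp only: sum_list_distinct_conv_sum_set)
  also have "\<dots> = real_of_int (\<Sum>(x, r)\<leftarrow>rs. lookup r (rotate_tree x))"
    unfolding of_int_sum_list list.map_comp
  proof (intro arg_cong[of _ _ sum_list] map_cong refl)
    fix a assume a: "a \<in> set rs"
    then have "map_of rs (fst a) = Some (snd a)" by (intro map_of_is_SomeI[OF dist]) simp
    then show "((\<lambda>i. real_of_int (lookup (the (map_of rs i)) (rotate_tree i))) \<circ> fst) a
        = real_of_int (case a of (x, r) \<Rightarrow> lookup r (rotate_tree x))"
      by (simp add: case_prod_unfold)
  qed
  finally show ?thesis by (simp only: cert_trace_eq)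
qed

section \<open>The blocks of stable out-degrees\<close>

text \<open>The block has 6! / (3! 3!) = 20 trees. All of them can be eliminated without pivots, so
  the only relation is 0.\<close>

definition cubic_order :: "(nat list \<times> nat list) list" where "cubic_order = [
  ([3,4,3,4,7,3,4],[0,2,5]), ([3,4,4,7,3,3,4],[0,3,5]), ([4,4,3,7,3,3,4],[0,1,6]), ([3,4,3,7,3,4,4],[1,6]),
  ([4,3,3,4,7,4,3],[0,3,5]), ([3,3,4,7,3,4,4],[0,1,3]), ([3,4,4,7,3,4,3],[0,3]), ([4,4,4,7,3,3,3],[0,1,2]),
  ([4,4,3,7,3,4,3],[1,3]), ([4,3,4,7,3,4,3],[3,6]), ([4,3,3,7,3,4,4],[0,5]), ([4,3,4,7,3,3,4],[3]),
  ([4,3,3,4,7,3,4],[0,6]), ([3,3,3,4,7,4,4],[1,2]), ([3,3,4,4,7,3,4],[6]), ([3,4,4,4,7,3,3],[0,5]),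
  ([4,3,4,4,7,3,3],[0,2]), ([4,4,3,4,7,3,3],[0]), ([3,3,4,4,7,4,3],[1]), ([3,4,3,4,7,4,3],[0])]"

text \<open>These 70 trees and the 20 pivots of \<open>quadratic_rels\<close> make up the block of
  6! / (2! 2! 2!) = 90 trees.\<close>

definition quadratic_order :: "(nat list \<times> nat list) list" where "quadratic_order = [
  ([2,0,7,2,1,1,0],[2,4,5]), ([7,0,0,2,1,1,2],[1,4,5]), ([7,2,0,0,1,1,2],[4,5]), ([7,2,0,0,1,2,1],[0,2,3]),
  ([7,0,0,2,1,2,1],[1,2,3]), ([7,2,0,2,1,0,1],[0,4,6]), ([2,2,7,0,1,0,1],[1,4,6]), ([7,2,0,2,0,1,1],[0,5,6]),
  ([2,2,7,0,0,1,1],[1,5,6]), ([2,0,7,2,1,0,1],[4,6]), ([2,0,7,2,0,1,1],[0,1,3]), ([2,0,7,0,2,1,1],[5,6]),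
  ([2,0,7,1,1,2,0],[0,2,5]), ([2,0,7,1,2,1,0],[0,1,6]), ([2,0,7,1,2,0,1],[0,2,4]), ([2,0,7,1,1,0,2],[0,1,5]),
  ([2,0,7,1,0,1,2],[0,1]), ([2,2,7,1,0,1,0],[2,3,5]), ([2,2,7,1,1,0,0],[0,1,6]), ([2,2,7,1,0,0,1],[0,1]),
  ([7,0,0,1,2,1,2],[1,3,5]), ([7,0,0,1,1,2,2],[1,3,4]), ([7,0,0,1,2,2,1],[1,2]), ([7,2,0,1,2,1,0],[0,2,4]),
  ([7,2,0,1,1,2,0],[0,2,6]), ([7,2,0,1,0,2,1],[3,6]), ([7,2,0,1,0,1,2],[3,5]), ([7,2,0,1,1,0,2],[0,2]),
  ([7,0,1,1,0,2,2],[0,3,4]), ([1,7,1,0,0,2,2],[2,5,6]), ([7,0,1,0,2,1,2],[0,3,5]), ([7,0,1,0,2,2,1],[0,3]),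
  ([7,0,1,1,2,2,0],[0,3]), ([1,7,1,0,2,2,0],[2,4,5]), ([1,7,1,0,2,0,2],[2,4,6]), ([7,0,1,2,1,0,2],[0,4]),
  ([7,0,1,2,0,1,2],[0,6]), ([7,0,1,2,2,1,0],[0,5]), ([7,0,1,2,2,0,1],[0,4]), ([7,0,1,2,0,2,1],[0]),
  ([1,7,1,2,0,2,0],[2,3,5]), ([1,7,1,2,2,0,0],[2,3,4]), ([1,7,1,2,0,0,2],[0,2]), ([1,2,7,0,1,0,2],[0,3,5]),
  ([1,2,7,1,2,0,0],[1,4]), ([1,2,7,2,1,0,0],[0,5,6]), ([1,2,7,0,1,2,0],[1,4]), ([1,2,7,2,0,1,0],[1,5]),
  ([1,2,7,1,0,2,0],[1,6]), ([1,2,7,1,0,0,2],[1,3]), ([1,2,7,2,0,0,1],[1,3]), ([1,2,7,0,0,2,1],[1]),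
  ([2,7,1,1,2,0,0],[5,6]), ([2,7,1,0,1,2,0],[3,6]), ([2,7,1,0,1,0,2],[2,4]), ([2,7,1,0,2,0,1],[0,4]),
  ([2,7,1,2,0,0,1],[0,5]), ([2,7,1,2,0,1,0],[0,3]), ([2,7,1,0,0,1,2],[0,6]), ([2,7,1,0,0,2,1],[0,3]),
  ([2,7,1,1,0,2,0],[0]), ([1,7,0,2,2,0,1],[3,4]), ([1,7,0,2,0,2,1],[3,5]), ([1,7,0,0,2,2,1],[6]),
  ([1,7,0,1,2,2,0],[6]), ([1,7,0,2,0,1,2],[3]), ([1,7,0,1,0,2,2],[4]), ([1,7,0,0,1,2,2],[4]),
  ([1,7,0,0,2,1,2],[3]), ([1,7,0,1,2,0,2],[0])]"

text \<open>In the second relation the vertices 3, 4, 6 receive the parents 0, 1, 2 in all six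
  orders, with the sign of the permutation; the other six-term relations are alternating sums of the
  same shape. Longer relations arise from the normalisation that each relation vanishes at the
  pivots of all others.\<close>

definition quadratic_rels :: "(nat list \<times> (nat list \<times> int) list) list" where "quadratic_rels = [
  ([2,2,7,0,1,1,0], [
    ([7,2,0,0,1,2,1],1), ([7,2,0,1,0,2,1],-1), ([7,0,1,2,0,2,1],1), ([7,0,0,1,2,1,2],-1),
    ([7,2,0,0,1,1,2],-1), ([7,2,0,1,0,1,2],1), ([7,0,0,1,2,2,1],1), ([7,0,1,0,2,2,1],-1),
    ([7,0,1,0,2,1,2],1), ([7,0,1,2,0,1,2],-1), ([7,0,0,2,1,1,2],1), ([7,0,0,2,1,2,1],-1),
    ([2,7,1,2,0,0,1],-1), ([1,7,1,2,0,0,2],1), ([2,7,1,0,1,2,0],-1), ([2,7,1,0,1,0,2],1),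
    ([1,7,1,0,2,0,2],-1), ([2,7,1,2,0,1,0],1), ([1,7,0,2,0,2,1],1), ([2,7,1,0,0,2,1],1),
    ([1,7,0,0,2,2,1],-1), ([1,7,1,2,0,2,0],-1), ([1,7,0,0,2,1,2],1), ([1,7,1,0,2,2,0],1),
    ([1,7,0,2,0,1,2],-1), ([2,7,1,0,0,1,2],-1), ([2,0,7,2,1,1,0],-1), ([2,2,7,1,0,1,0],-1),
    ([1,2,7,1,0,2,0],1), ([2,0,7,2,1,0,1],1), ([1,2,7,0,1,2,0],-1), ([1,2,7,0,1,0,2],1), ([2,0,7,1,2,1,0],1),
    ([2,2,7,1,0,0,1],1), ([1,2,7,1,0,0,2],-1), ([2,2,7,0,1,1,0],1), ([2,0,7,1,2,0,1],-1), ([2,2,7,0,1,0,1],-1)]),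
  ([2,0,7,0,1,1,2], [
    ([2,0,7,2,1,1,0],-1), ([2,0,7,2,0,1,1],1), ([2,0,7,0,1,1,2],1), ([2,0,7,0,2,1,1],-1),
    ([2,0,7,1,0,1,2],-1), ([2,0,7,1,2,1,0],1)]),
  ([7,2,0,2,1,1,0], [
    ([7,2,0,2,1,1,0],1), ([7,2,0,0,1,2,1],1), ([7,2,0,0,1,1,2],-1), ([7,2,0,1,1,2,0],-1),
    ([7,2,0,2,1,0,1],-1), ([7,2,0,1,1,0,2],1)]),
  ([7,2,0,0,2,1,1], [
    ([7,2,0,0,1,2,1],-1), ([7,2,0,2,0,1,1],-1), ([7,2,0,0,2,1,1],1), ([7,2,0,1,0,1,2],1),
    ([7,2,0,1,1,2,0],1), ([7,2,0,2,1,0,1],1), ([7,2,0,1,2,1,0],-1), ([7,2,0,1,1,0,2],-1)]),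
  ([7,0,0,2,2,1,1], [
    ([7,2,0,2,0,1,1],-1), ([7,0,0,1,1,2,2],1), ([7,0,1,1,0,2,2],-1), ([7,0,1,1,2,2,0],1),
    ([7,0,1,2,0,2,1],1), ([7,0,1,2,2,1,0],-1), ([7,0,0,1,2,1,2],-1), ([7,0,0,2,2,1,1],1),
    ([7,2,0,1,0,1,2],1), ([7,0,1,0,2,2,1],-1), ([7,0,1,0,2,1,2],1), ([7,2,0,2,1,0,1],1),
    ([7,2,0,1,1,0,2],-1), ([7,0,0,2,1,2,1],-1), ([2,7,1,1,2,0,0],-1), ([1,7,1,0,0,2,2],1),
    ([1,7,0,2,2,0,1],-1), ([1,7,1,0,2,0,2],-1), ([2,7,1,0,2,0,1],1), ([1,7,0,2,0,2,1],1),
    ([2,7,1,0,0,2,1],-1), ([1,7,0,1,0,2,2],-1), ([1,7,1,2,2,0,0],1), ([1,7,1,2,0,2,0],-1),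
    ([2,7,1,1,0,2,0],1), ([1,7,0,1,2,0,2],1), ([2,0,7,2,0,1,1],-1), ([2,2,7,1,1,0,0],1), ([1,2,7,2,0,0,1],1),
    ([2,2,7,1,0,1,0],-1), ([2,0,7,1,0,1,2],1), ([1,2,7,1,0,2,0],1), ([2,2,7,0,0,1,1],1),
    ([1,2,7,0,0,2,1],-1), ([2,0,7,2,1,0,1],1), ([1,2,7,0,1,0,2],1), ([2,0,7,1,1,0,2],-1),
    ([1,2,7,1,0,0,2],-1), ([2,2,7,0,1,0,1],-1), ([1,2,7,2,1,0,0],-1)]),
  ([2,0,7,0,1,2,1], [
    ([2,0,7,0,1,2,1],1), ([2,0,7,2,0,1,1],1), ([2,0,7,0,2,1,1],-1), ([2,0,7,1,0,1,2],-1),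
    ([2,0,7,1,1,2,0],-1), ([2,0,7,2,1,0,1],-1), ([2,0,7,1,2,1,0],1), ([2,0,7,1,1,0,2],1)]),
  ([2,0,7,1,0,2,1], [
    ([2,0,7,1,0,2,1],1), ([2,0,7,1,0,1,2],-1), ([2,0,7,1,1,2,0],-1), ([2,0,7,1,2,1,0],1),
    ([2,0,7,1,1,0,2],1), ([2,0,7,1,2,0,1],-1)]),
  ([7,2,0,1,2,0,1], [
    ([7,2,0,1,0,2,1],-1), ([7,2,0,1,0,1,2],1), ([7,2,0,1,1,2,0],1), ([7,2,0,1,2,1,0],-1),
    ([7,2,0,1,1,0,2],-1), ([7,2,0,1,2,0,1],1)]),
  ([7,0,1,0,1,2,2], [
    ([7,0,1,2,1,0,2],-1), ([7,0,1,1,0,2,2],-1), ([7,0,1,1,2,2,0],1), ([7,0,1,2,2,1,0],-1),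
    ([7,0,1,2,2,0,1],1), ([7,0,1,0,2,2,1],-1), ([7,0,1,2,0,1,2],1), ([7,0,1,0,1,2,2],1)]),
  ([7,0,1,1,2,0,2], [
    ([7,0,1,1,2,2,0],-1), ([7,0,1,1,2,0,2],1), ([7,0,1,2,2,1,0],1), ([7,0,1,2,2,0,1],-1),
    ([7,0,1,0,2,2,1],1), ([7,0,1,0,2,1,2],-1)]),
  ([7,0,1,2,1,2,0], [
    ([7,0,1,2,1,0,2],-1), ([7,0,1,2,0,2,1],-1), ([7,0,1,2,2,1,0],-1), ([7,0,1,2,2,0,1],1),
    ([7,0,1,2,0,1,2],1), ([7,0,1,2,1,2,0],1)]),
  ([1,2,7,0,2,0,1], [
    ([1,2,7,2,0,0,1],-1), ([1,2,7,0,1,0,2],-1), ([1,2,7,0,2,0,1],1), ([1,2,7,1,0,0,2],1),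
    ([1,2,7,2,1,0,0],1), ([1,2,7,1,2,0,0],-1)]),
  ([1,2,7,0,2,1,0], [
    ([1,2,7,1,0,2,0],1), ([1,2,7,0,1,2,0],-1), ([1,2,7,2,0,1,0],-1), ([1,2,7,0,2,1,0],1),
    ([1,2,7,2,1,0,0],1), ([1,2,7,1,2,0,0],-1)]),
  ([1,2,7,0,0,1,2], [
    ([1,2,7,0,0,1,2],1), ([1,2,7,2,0,0,1],1), ([1,2,7,1,0,2,0],1), ([1,2,7,0,0,2,1],-1),
    ([1,2,7,1,0,0,2],-1), ([1,2,7,2,0,1,0],-1)]),
  ([2,7,1,2,1,0,0], [
    ([2,7,1,2,1,0,0],1), ([2,7,1,1,2,0,0],-1), ([2,7,1,0,1,0,2],-1), ([2,7,1,0,2,0,1],1),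
    ([2,7,1,2,0,1,0],-1), ([2,7,1,0,0,2,1],-1), ([2,7,1,1,0,2,0],1), ([2,7,1,0,0,1,2],1)]),
  ([2,7,1,0,2,1,0], [
    ([2,7,1,0,2,1,0],1), ([2,7,1,0,1,2,0],-1), ([2,7,1,0,1,0,2],1), ([2,7,1,0,2,0,1],-1),
    ([2,7,1,0,0,2,1],1), ([2,7,1,0,0,1,2],-1)]),
  ([2,7,1,1,0,0,2], [
    ([2,7,1,2,0,0,1],-1), ([2,7,1,2,0,1,0],1), ([2,7,1,0,0,2,1],1), ([2,7,1,1,0,2,0],-1),
    ([2,7,1,1,0,0,2],1), ([2,7,1,0,0,1,2],-1)]),
  ([1,7,0,2,2,1,0], [
    ([1,7,0,2,2,1,0],1), ([1,7,0,2,2,0,1],-1), ([1,7,0,0,2,2,1],1), ([1,7,0,0,2,1,2],-1),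
    ([1,7,0,1,2,2,0],-1), ([1,7,0,1,2,0,2],1)]),
  ([1,7,0,2,1,2,0], [
    ([1,7,0,2,1,2,0],1), ([1,7,0,2,0,2,1],-1), ([1,7,0,1,0,2,2],1), ([1,7,0,0,2,2,1],1),
    ([1,7,0,0,1,2,2],-1), ([1,7,0,1,2,2,0],-1)]),
  ([1,7,0,2,1,0,2], [
    ([1,7,0,2,1,0,2],1), ([1,7,0,1,0,2,2],1), ([1,7,0,0,1,2,2],-1), ([1,7,0,0,2,1,2],1),
    ([1,7,0,2,0,1,2],-1), ([1,7,0,1,2,0,2],-1)])]"

text \<open>These 125 trees and the 55 pivots of \<open>mixed_rels\<close> make up the block of 6! /
  (2! 2!) = 180 trees.\<close>

definition mixed_order :: "(nat list \<times> nat list) list" where "mixed_order = [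
  ([6,3,5,5,7,6,4],[0,5,6]), ([6,5,3,6,5,7,4],[1,4,5]), ([6,4,6,5,5,7,3],[0,2,6]), ([6,5,5,7,6,4,3],[1,2,3]),
  ([5,5,4,7,6,6,3],[4,5,6]), ([3,5,6,5,6,4,7],[1,3,5]), ([6,3,6,5,7,4,5],[0,2,4]), ([6,5,4,7,6,3,5],[1,5,6]),
  ([6,5,4,5,6,7,3],[0,4,6]), ([4,6,5,5,6,7,3],[2,3,5]), ([4,5,6,5,6,7,3],[0,4,6]), ([5,4,6,5,6,7,3],[2,4,6]),
  ([5,5,6,7,3,6,4],[0,1,3]), ([5,6,5,7,3,6,4],[0,2,3]), ([5,6,6,5,3,7,4],[4,6]), ([5,6,4,5,6,7,3],[4,6]),
  ([5,3,5,6,6,4,7],[0,2,5]), ([6,5,5,4,6,3,7],[0,4,6]), ([5,5,6,4,6,3,7],[1,3,5]), ([6,5,5,6,3,4,7],[1,2,5]),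
  ([6,3,4,5,6,7,5],[0,2,4]), ([6,3,5,6,5,7,4],[0,3,6]), ([4,5,5,6,6,3,7],[1,2,5]), ([6,3,6,5,5,7,4],[0,2,6]),
  ([6,4,6,7,5,3,5],[0,2,3]), ([5,3,6,5,7,6,4],[1,3,4]), ([3,5,6,5,7,6,4],[2,5,6]), ([4,5,3,5,6,6,7],[0,4,5]),
  ([6,3,6,4,5,7,5],[0,2]), ([6,5,4,7,5,6,3],[1,3]), ([3,5,5,6,7,6,4],[1,2,4]), ([6,4,5,7,5,6,3],[0,5,6]),
  ([6,4,5,7,6,3,5],[1,2,3]), ([5,4,6,7,6,3,5],[1,3]), ([5,5,6,4,7,6,3],[1,3,4]), ([5,6,5,4,7,6,3],[3,4,6]),
  ([6,3,5,4,6,7,5],[0,2,4]), ([5,6,6,4,7,3,5],[3,4]), ([5,6,4,7,6,3,5],[0,5,6]), ([5,6,5,4,6,3,7],[3,5]),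
  ([5,5,6,6,3,4,7],[3,4,5]), ([5,5,3,6,6,4,7],[0,1,5]), ([4,6,5,7,6,3,5],[0,3,4]), ([5,6,4,7,5,6,3],[3,6]),
  ([6,6,4,7,5,3,5],[2,3]), ([4,6,6,7,5,3,5],[0,3]), ([6,6,3,5,5,7,4],[0,6]), ([6,6,5,7,3,4,5],[0,3]),
  ([5,6,6,7,3,4,5],[3,4]), ([5,6,6,7,5,3,4],[3]), ([3,6,6,5,5,7,4],[1,2,6]), ([5,3,6,6,5,7,4],[2,6]),
  ([5,3,5,6,7,6,4],[1,6]), ([5,5,3,6,7,6,4],[0,1,4]), ([5,6,5,6,7,3,4],[0,1,2]), ([5,4,5,6,6,3,7],[0,2,5]),
  ([5,5,4,6,6,3,7],[0,1,5]), ([6,6,3,5,7,4,5],[0,1,4]), ([5,6,3,5,7,6,4],[2,3,4]), ([3,6,5,5,7,6,4],[4,6]),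
  ([3,6,6,5,7,4,5],[0,3,4]), ([5,6,6,5,7,4,3],[3,4]), ([5,6,3,5,6,4,7],[0,3,5]), ([3,6,5,5,6,4,7],[3,5]),
  ([5,6,3,6,7,4,5],[1,4]), ([5,3,6,6,7,4,5],[0,4]), ([3,5,6,6,7,4,5],[0,4]), ([6,5,3,6,7,4,5],[1,4]),
  ([6,3,5,6,7,4,5],[4]), ([5,6,3,6,5,7,4],[6]), ([6,6,4,5,5,7,3],[2,6]), ([6,6,5,4,5,7,3],[0,6]),
  ([5,6,6,4,5,7,3],[3,6]), ([4,6,6,5,5,7,3],[6]), ([4,5,6,6,5,3,7],[0,1,5]), ([4,6,5,6,5,3,7],[0,5]),
  ([6,4,5,6,5,3,7],[1,5]), ([6,5,4,6,5,3,7],[1,5]), ([5,6,4,6,5,3,7],[5]), ([3,6,6,4,5,7,5],[1,2]),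
  ([6,6,3,4,5,7,5],[0,1,2]), ([6,6,4,5,3,7,5],[0,1]), ([4,6,3,5,6,7,5],[0,3,5]), ([6,4,3,5,6,7,5],[0,1,4]),
  ([6,5,3,4,6,7,5],[0,4]), ([3,5,6,4,6,7,5],[3,5]), ([3,4,6,5,6,7,5],[2,4]), ([3,6,4,5,6,7,5],[1,4]),
  ([4,3,5,6,6,7,5],[0,4]), ([4,6,3,6,5,7,5],[0,4,5]), ([5,3,4,6,6,7,5],[0,1,5]), ([6,3,4,6,5,7,5],[1,5]),
  ([3,6,4,6,5,7,5],[0,1,3]), ([4,6,5,6,3,7,5],[0,5]), ([5,6,4,6,3,7,5],[1,3]), ([6,5,4,6,3,7,5],[1,5]),
  ([5,4,3,6,6,7,5],[0,5]), ([3,4,5,6,6,7,5],[3,4]), ([6,4,5,6,3,7,5],[2,5]), ([6,4,3,6,5,7,5],[0,3]),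
  ([3,4,6,6,5,7,5],[5]), ([3,5,5,4,6,6,7],[1,2]), ([5,5,4,6,3,6,7],[0,1]), ([5,4,5,6,3,6,7],[3,4]),
  ([5,3,5,4,6,6,7],[0,2]), ([5,3,4,6,5,6,7],[1,3]), ([6,4,5,5,3,6,7],[1,4]), ([4,6,5,5,3,6,7],[0,4]),
  ([3,4,5,5,6,6,7],[2,3]), ([5,4,3,5,6,6,7],[1,4]), ([5,3,4,5,6,6,7],[0,2]), ([3,5,4,5,6,6,7],[4]),
  ([6,5,4,5,3,6,7],[4]), ([6,5,3,4,5,6,7],[0,1]), ([6,3,5,4,5,6,7],[0,2]), ([4,5,3,6,5,6,7],[0,3]),
  ([5,4,3,6,5,6,7],[0]), ([6,3,4,5,5,6,7],[0]), ([4,3,6,5,5,6,7],[1]), ([4,6,3,5,5,6,7],[0]),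
  ([3,4,6,5,5,6,7],[1]), ([3,6,4,5,5,6,7],[3]), ([3,6,5,4,5,6,7],[1]), ([3,5,6,4,5,6,7],[2]),
  ([3,5,4,6,5,6,7],[0])]"

definition mixed_rels :: "(nat list \<times> (nat list \<times> int) list) list" where "mixed_rels = [
  ([6,5,5,7,3,6,4], [
    ([5,6,4,7,6,3,5],-1), ([6,5,5,7,3,6,4],1), ([6,5,5,7,6,4,3],-1), ([5,6,6,7,5,3,4],1),
    ([5,6,4,7,5,6,3],1), ([5,6,6,7,3,4,5],-1), ([6,3,5,5,7,6,4],-1), ([5,6,5,4,7,6,3],-1),
    ([5,6,6,4,7,3,5],1), ([6,5,3,6,7,4,5],1), ([5,6,6,5,7,4,3],-1), ([5,6,5,6,7,3,4],1),
    ([5,6,3,5,7,6,4],-1), ([5,3,6,6,7,4,5],1), ([3,6,5,5,7,6,4],1), ([3,5,6,6,7,4,5],-1),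
    ([5,6,3,6,5,7,4],-1), ([5,4,6,5,6,7,3],1), ([6,5,4,6,3,7,5],-1), ([6,3,4,6,5,7,5],1),
    ([3,6,4,6,5,7,5],-1), ([6,5,4,5,6,7,3],1), ([4,3,5,6,6,7,5],-1), ([6,4,5,6,3,7,5],-1),
    ([4,6,3,5,6,7,5],1), ([3,4,5,6,6,7,5],1), ([5,6,6,5,3,7,4],-1), ([6,5,3,4,6,7,5],1),
    ([6,4,3,5,6,7,5],-1), ([4,5,6,5,6,7,3],-1), ([4,6,5,6,3,7,5],1), ([5,6,6,4,5,7,3],1),
    ([5,3,4,5,6,6,7],2), ([4,6,5,5,3,6,7],-1), ([5,6,5,4,6,3,7],-1), ([5,3,4,6,5,6,7],-1),
    ([6,5,5,6,3,4,7],1), ([3,5,4,5,6,6,7],-2), ([4,3,6,5,5,6,7],-1), ([5,3,5,4,6,6,7],1),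
    ([3,6,5,4,5,6,7],1), ([3,5,5,4,6,6,7],-1), ([4,5,3,5,6,6,7],1), ([6,4,5,6,5,3,7],-1),
    ([6,4,5,5,3,6,7],1), ([3,5,4,6,5,6,7],1), ([5,4,3,5,6,6,7],-1), ([5,6,3,5,6,4,7],1), ([6,5,4,5,3,6,7],1),
    ([6,5,3,4,5,6,7],-1), ([5,6,4,6,5,3,7],-1), ([3,4,6,5,5,6,7],1), ([4,6,5,6,5,3,7],1), ([6,3,5,4,5,6,7],-1)]),
  ([6,5,3,5,7,6,4], [
    ([6,3,5,5,7,6,4],-1), ([5,3,6,5,7,6,4],1), ([6,5,3,5,7,6,4],1), ([3,5,6,5,7,6,4],-1),
    ([5,6,3,5,7,6,4],-1), ([3,6,5,5,7,6,4],1)]),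
  ([6,5,6,4,5,7,3], [
    ([6,3,5,6,5,7,4],1), ([6,4,3,6,5,7,5],1), ([6,4,6,5,5,7,3],-1), ([6,3,4,6,5,7,5],-1),
    ([6,5,3,6,5,7,4],-1), ([6,6,5,4,5,7,3],-1), ([6,5,6,4,5,7,3],1), ([6,6,4,5,5,7,3],1)]),
  ([3,5,6,6,5,7,4], [
    ([6,3,5,6,5,7,4],1), ([6,5,3,6,5,7,4],-1), ([6,6,5,4,5,7,3],-1), ([5,3,6,6,5,7,4],-1),
    ([3,6,4,6,5,7,5],-1), ([6,6,4,5,5,7,3],1), ([3,5,6,6,5,7,4],1), ([4,6,3,6,5,7,5],1),
    ([4,6,6,5,5,7,3],-1), ([5,6,6,4,5,7,3],1)]),
  ([6,5,6,5,7,4,3], [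
    ([6,3,6,5,7,4,5],-1), ([3,6,6,5,7,4,5],1), ([6,5,6,5,7,4,3],1), ([5,3,6,5,7,6,4],1),
    ([5,6,6,5,7,4,3],-1), ([3,5,6,5,7,6,4],-1), ([5,6,4,6,3,7,5],1), ([5,3,4,6,6,7,5],-1),
    ([6,4,6,5,5,7,3],-1), ([6,5,4,6,3,7,5],-1), ([6,3,6,4,5,7,5],1), ([3,6,4,5,6,7,5],1),
    ([4,3,5,6,6,7,5],1), ([6,4,5,6,3,7,5],1), ([3,4,6,5,6,7,5],-1), ([4,6,3,5,6,7,5],-1),
    ([3,6,6,4,5,7,5],-1), ([6,4,3,5,6,7,5],1), ([4,6,6,5,5,7,3],1), ([4,6,5,6,3,7,5],-1),
    ([6,3,5,4,6,7,5],-1), ([3,5,6,4,6,7,5],1), ([4,6,5,5,3,6,7],1), ([5,6,5,4,6,3,7],-1),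
    ([3,5,4,5,6,6,7],1), ([4,3,6,5,5,6,7],-1), ([5,5,4,6,6,3,7],-1), ([5,4,5,6,6,3,7],1),
    ([3,5,6,5,6,4,7],-1), ([6,4,5,5,3,6,7],-1), ([5,5,6,4,6,3,7],1), ([5,4,3,5,6,6,7],-1),
    ([5,6,3,5,6,4,7],1), ([3,6,4,5,5,6,7],-1), ([3,4,6,5,5,6,7],1), ([6,3,4,5,5,6,7],1)]),
  ([4,5,5,7,6,6,3], [
    ([4,5,5,7,6,6,3],1), ([5,4,6,7,6,3,5],-1), ([5,5,4,7,6,6,3],-1), ([6,5,5,7,6,4,3],-1),
    ([6,4,5,7,6,3,5],1), ([5,6,6,7,5,3,4],1), ([5,6,4,7,5,6,3],1), ([5,5,6,7,3,6,4],1), ([5,6,6,7,3,4,5],-1),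
    ([4,6,5,7,6,3,5],-1), ([5,6,5,4,7,6,3],-1), ([5,6,6,4,7,3,5],1), ([5,3,6,5,7,6,4],-1),
    ([5,6,6,5,7,4,3],-1), ([5,6,5,6,7,3,4],1), ([5,3,6,6,7,4,5],1), ([5,6,3,6,5,7,4],-1),
    ([5,4,6,5,6,7,3],1), ([5,6,4,6,3,7,5],1), ([6,4,3,6,5,7,5],1), ([5,3,4,6,6,7,5],-1),
    ([6,5,4,6,3,7,5],-1), ([6,3,4,6,5,7,5],1), ([3,6,4,6,5,7,5],-1), ([3,4,6,6,5,7,5],-1),
    ([6,5,4,5,6,7,3],1), ([6,4,5,6,3,7,5],-1), ([4,6,3,5,6,7,5],1), ([3,4,5,6,6,7,5],1),
    ([5,6,6,5,3,7,4],-1), ([6,4,3,5,6,7,5],-1), ([4,5,6,5,6,7,3],-1), ([5,6,6,4,5,7,3],1),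
    ([3,5,6,4,6,7,5],1), ([5,3,4,5,6,6,7],1), ([5,6,5,4,6,3,7],-1), ([5,3,4,6,5,6,7],-1),
    ([6,5,5,6,3,4,7],1), ([4,6,3,5,5,6,7],-1), ([5,3,5,4,6,6,7],1), ([3,6,5,4,5,6,7],1),
    ([3,5,5,4,6,6,7],-1), ([6,4,5,6,5,3,7],-1), ([6,4,5,5,3,6,7],1), ([3,5,4,6,5,6,7],1),
    ([5,6,3,5,6,4,7],1), ([3,5,6,4,5,6,7],-1), ([3,4,5,5,6,6,7],-1), ([5,6,4,6,5,3,7],-1),
    ([3,4,6,5,5,6,7],1), ([4,6,5,6,5,3,7],1), ([6,3,5,4,5,6,7],-1)]),
  ([5,4,5,7,6,6,3], [
    ([5,6,4,7,6,3,5],1), ([5,4,6,7,6,3,5],-1), ([5,6,5,7,3,6,4],-1), ([5,5,4,7,6,6,3],-1),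
    ([5,4,5,7,6,6,3],1), ([5,5,6,7,3,6,4],1), ([5,6,3,6,7,4,5],-1), ([5,3,6,5,7,6,4],-1),
    ([5,6,3,5,7,6,4],1), ([5,3,6,6,7,4,5],1), ([6,4,3,6,5,7,5],1), ([6,5,4,6,3,7,5],1), ([6,3,4,6,5,7,5],-1),
    ([3,6,4,6,5,7,5],1), ([3,4,6,6,5,7,5],-1), ([3,6,4,5,6,7,5],-1), ([6,4,5,6,3,7,5],-1),
    ([3,4,6,5,6,7,5],1), ([6,5,3,4,6,7,5],-1), ([6,3,5,4,6,7,5],1), ([3,5,4,5,6,6,7],1), ([4,3,6,5,5,6,7],1),
    ([4,6,3,5,5,6,7],-1), ([3,6,5,4,5,6,7],1), ([6,4,5,5,3,6,7],1), ([6,5,4,5,3,6,7],-1),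
    ([3,5,6,4,5,6,7],-1), ([3,4,5,5,6,6,7],-1), ([6,5,3,4,5,6,7],1), ([6,3,5,4,5,6,7],-1)]),
  ([6,5,3,5,6,4,7], [
    ([4,5,5,6,6,3,7],1), ([3,5,4,5,6,6,7],1), ([6,5,5,4,6,3,7],-1), ([5,5,4,6,6,3,7],-1),
    ([4,5,3,5,6,6,7],-1), ([6,5,3,5,6,4,7],1), ([3,5,6,5,6,4,7],-1), ([5,5,6,4,6,3,7],1)]),
  ([6,5,6,4,7,3,5], [
    ([5,6,4,7,6,3,5],1), ([6,4,5,7,5,6,3],-1), ([6,5,4,7,6,3,5],-1), ([6,6,5,7,3,4,5],1),
    ([6,5,4,7,5,6,3],1), ([6,6,4,7,5,3,5],-1), ([6,4,5,7,6,3,5],1), ([4,6,6,7,5,3,5],1),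
    ([5,6,6,7,3,4,5],-1), ([4,6,5,7,6,3,5],-1), ([6,3,6,5,7,4,5],-1), ([3,6,6,5,7,4,5],1),
    ([6,3,5,6,7,4,5],-1), ([5,6,6,4,7,3,5],-1), ([6,5,3,6,7,4,5],1), ([5,3,6,5,7,6,4],1),
    ([3,5,6,5,7,6,4],-1), ([5,6,3,5,7,6,4],-1), ([5,3,6,6,7,4,5],1), ([3,6,5,5,7,6,4],1),
    ([3,5,6,6,7,4,5],-1), ([6,5,6,4,7,3,5],1), ([6,5,4,6,3,7,5],-1), ([3,6,4,6,5,7,5],1),
    ([3,6,4,5,6,7,5],-1), ([6,4,5,6,3,7,5],1), ([4,6,3,5,6,7,5],1), ([4,6,3,6,5,7,5],-1),
    ([6,5,3,4,6,7,5],1), ([6,4,3,5,6,7,5],-1), ([6,3,4,5,6,7,5],1), ([6,3,5,4,6,7,5],-1),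
    ([4,3,6,5,5,6,7],-1), ([4,6,3,5,5,6,7],1), ([6,4,5,5,3,6,7],-1), ([6,5,4,5,3,6,7],1),
    ([6,5,3,4,5,6,7],-1), ([3,6,4,5,5,6,7],-1), ([3,4,6,5,5,6,7],1), ([6,3,5,4,5,6,7],1)]),
  ([4,5,6,7,6,3,5], [
    ([5,6,4,7,6,3,5],1), ([5,4,6,7,6,3,5],-1), ([6,5,4,7,6,3,5],-1), ([6,4,5,7,6,3,5],1),
    ([4,5,6,7,6,3,5],1), ([4,6,5,7,6,3,5],-1)]),
  ([6,4,5,5,6,7,3], [
    ([5,4,6,5,6,7,3],-1), ([6,4,5,5,6,7,3],1), ([6,5,4,5,6,7,3],-1), ([4,6,5,5,6,7,3],-1),
    ([5,6,4,5,6,7,3],1), ([4,5,6,5,6,7,3],1)]),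
  ([6,6,5,5,3,7,4], [
    ([6,6,5,5,3,7,4],1), ([3,6,4,5,6,7,5],-1), ([4,6,5,5,6,7,3],-1), ([4,6,3,5,6,7,5],1),
    ([6,6,3,5,5,7,4],-1), ([5,6,6,5,3,7,4],-1), ([5,6,4,5,6,7,3],1), ([3,6,6,5,5,7,4],1)]),
  ([6,5,6,5,3,7,4], [
    ([6,3,6,5,5,7,4],-1), ([5,4,6,5,6,7,3],1), ([6,5,6,5,3,7,4],1), ([3,6,4,5,6,7,5],-1),
    ([4,6,3,5,6,7,5],1), ([5,6,6,5,3,7,4],-1), ([6,4,3,5,6,7,5],-1), ([3,6,6,5,5,7,4],1),
    ([6,3,4,5,6,7,5],1), ([4,5,6,5,6,7,3],-1)]),
  ([5,5,6,7,6,4,3], [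
    ([5,5,6,7,6,4,3],1), ([5,6,4,7,6,3,5],1), ([5,6,6,7,5,3,4],-1), ([5,6,4,7,5,6,3],-1),
    ([5,5,6,7,3,6,4],-1), ([5,6,6,7,3,4,5],1), ([5,6,5,4,7,6,3],1), ([5,6,6,4,7,3,5],-1),
    ([5,3,6,5,7,6,4],1), ([5,6,6,5,7,4,3],1), ([5,6,5,6,7,3,4],-1), ([5,3,6,6,7,4,5],-1),
    ([5,6,3,6,5,7,4],1), ([5,4,6,5,6,7,3],-1), ([5,6,4,6,3,7,5],-1), ([6,4,3,6,5,7,5],-1),
    ([6,5,4,6,3,7,5],1), ([6,3,4,6,5,7,5],-1), ([3,6,4,6,5,7,5],1), ([3,4,6,6,5,7,5],1), ([4,3,5,6,6,7,5],1),
    ([6,4,5,6,3,7,5],1), ([4,6,3,5,6,7,5],-1), ([3,4,5,6,6,7,5],-2), ([5,6,6,5,3,7,4],1),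
    ([6,5,3,4,6,7,5],-1), ([6,4,3,5,6,7,5],1), ([5,4,3,6,6,7,5],1), ([5,6,6,4,5,7,3],-1),
    ([5,3,4,5,6,6,7],-2), ([6,5,4,6,5,3,7],-1), ([5,6,5,4,6,3,7],1), ([5,3,4,6,5,6,7],1),
    ([5,4,5,6,3,6,7],-1), ([3,5,4,5,6,6,7],1), ([4,3,6,5,5,6,7],1), ([4,5,3,6,5,6,7],-1),
    ([6,4,5,6,5,3,7],1), ([5,5,4,6,3,6,7],1), ([5,4,3,5,6,6,7],1), ([5,6,3,5,6,4,7],-1),
    ([6,5,4,5,3,6,7],-1), ([4,5,6,6,5,3,7],1), ([6,5,3,4,5,6,7],1), ([5,6,4,6,5,3,7],1),
    ([5,5,6,6,3,4,7],-1), ([3,4,6,5,5,6,7],-1), ([4,6,5,6,5,3,7],-1)]),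
  ([5,6,5,7,6,4,3], [
    ([5,6,4,7,6,3,5],1), ([5,6,5,7,3,6,4],-1), ([5,6,5,7,6,4,3],1), ([5,6,6,7,5,3,4],-1),
    ([5,6,4,7,5,6,3],-1), ([5,6,6,7,3,4,5],1), ([5,6,3,6,7,4,5],-1), ([5,6,5,4,7,6,3],1),
    ([5,6,6,4,7,3,5],-1), ([5,6,6,5,7,4,3],1), ([5,6,5,6,7,3,4],-1), ([5,6,3,5,7,6,4],1),
    ([5,6,3,6,5,7,4],1), ([6,5,4,6,3,7,5],1), ([6,3,4,6,5,7,5],-1), ([3,6,4,6,5,7,5],1), ([4,3,5,6,6,7,5],1),
    ([4,6,3,5,6,7,5],-1), ([3,4,5,6,6,7,5],-1), ([5,6,6,5,3,7,4],1), ([5,6,4,5,6,7,3],-1),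
    ([6,5,3,4,6,7,5],-1), ([6,4,3,5,6,7,5],1), ([5,6,6,4,5,7,3],-1), ([5,3,4,5,6,6,7],-1),
    ([6,5,4,6,5,3,7],-1), ([5,6,5,4,6,3,7],1), ([5,3,4,6,5,6,7],1), ([3,5,4,5,6,6,7],1), ([4,3,6,5,5,6,7],1),
    ([4,5,3,6,5,6,7],-1), ([5,5,3,6,6,4,7],1), ([6,4,5,6,5,3,7],1), ([5,6,3,5,6,4,7],-1),
    ([6,5,4,5,3,6,7],-1), ([4,5,6,6,5,3,7],1), ([6,5,3,4,5,6,7],1), ([5,6,4,6,5,3,7],1),
    ([5,5,6,6,3,4,7],-1), ([3,4,6,5,5,6,7],-1), ([4,6,5,6,5,3,7],-1), ([5,3,5,6,6,4,7],-1)]),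
  ([5,6,5,6,3,4,7], [
    ([6,5,4,6,5,3,7],-1), ([5,3,4,6,5,6,7],1), ([5,5,3,6,6,4,7],1), ([6,4,5,6,5,3,7],1), ([5,6,5,6,3,4,7],1),
    ([4,5,6,6,5,3,7],1), ([5,5,6,6,3,4,7],-1), ([4,6,5,6,5,3,7],-1), ([5,4,3,6,5,6,7],-1),
    ([5,3,5,6,6,4,7],-1)]),
  ([6,3,5,5,6,4,7], [
    ([6,3,5,5,6,4,7],1), ([5,3,4,5,6,6,7],-1), ([4,5,5,6,6,3,7],1), ([5,6,5,4,6,3,7],1), ([3,5,4,5,6,6,7],1),
    ([6,5,5,4,6,3,7],-1), ([5,4,5,6,6,3,7],-1), ([4,5,3,5,6,6,7],-1), ([5,4,3,5,6,6,7],1),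
    ([3,6,5,5,6,4,7],-1)]),
  ([5,3,6,5,6,4,7], [
    ([5,3,4,5,6,6,7],-1), ([5,6,5,4,6,3,7],1), ([5,5,4,6,6,3,7],1), ([5,3,6,5,6,4,7],1),
    ([5,4,5,6,6,3,7],-1), ([5,5,6,4,6,3,7],-1), ([5,4,3,5,6,6,7],1), ([5,6,3,5,6,4,7],-1)]),
  ([3,5,5,6,6,4,7], [
    ([6,5,4,6,5,3,7],1), ([6,5,5,6,3,4,7],-1), ([4,5,3,6,5,6,7],1), ([5,5,3,6,6,4,7],-1),
    ([3,5,4,6,5,6,7],-1), ([4,5,6,6,5,3,7],-1), ([5,5,6,6,3,4,7],1), ([3,5,5,6,6,4,7],1)]),
  ([4,3,6,5,6,7,5], [
    ([4,3,6,5,6,7,5],1), ([3,6,4,5,6,7,5],1), ([3,4,6,5,6,7,5],-1), ([4,6,3,5,6,7,5],-1),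
    ([6,4,3,5,6,7,5],1), ([6,3,4,5,6,7,5],-1)]),
  ([6,5,5,6,7,3,4], [
    ([5,6,3,6,7,4,5],1), ([6,5,5,6,7,3,4],1), ([6,5,3,6,7,4,5],-1), ([5,6,5,6,7,3,4],-1),
    ([5,3,6,6,7,4,5],-1), ([3,5,6,6,7,4,5],1), ([3,5,5,6,7,6,4],-1), ([5,3,5,6,7,6,4],1),
    ([5,6,3,6,5,7,4],1), ([6,3,5,6,5,7,4],-1), ([6,6,5,4,5,7,3],1), ([3,6,4,6,5,7,5],1),
    ([6,6,4,5,5,7,3],-1), ([4,3,5,6,6,7,5],1), ([6,4,5,6,3,7,5],1), ([3,4,5,6,6,7,5],-1),
    ([4,6,3,6,5,7,5],-1), ([4,6,6,5,5,7,3],1), ([4,6,5,6,3,7,5],-1), ([5,6,6,4,5,7,3],-1),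
    ([4,6,5,5,3,6,7],1), ([4,5,5,6,6,3,7],-1), ([5,3,5,4,6,6,7],-1), ([3,6,5,4,5,6,7],-1),
    ([3,5,5,4,6,6,7],1), ([5,4,5,6,6,3,7],1), ([6,4,5,5,3,6,7],-1), ([6,3,5,4,5,6,7],1)]),
  ([6,5,6,7,5,3,4], [
    ([6,4,5,7,5,6,3],1), ([6,5,6,7,5,3,4],1), ([6,4,6,7,5,3,5],-1), ([6,6,5,7,3,4,5],-1),
    ([6,5,4,7,5,6,3],-1), ([6,6,4,7,5,3,5],1), ([5,6,6,7,5,3,4],-1), ([5,6,6,7,3,4,5],1),
    ([6,3,5,6,7,4,5],1), ([6,5,3,6,7,4,5],-1), ([5,6,3,5,7,6,4],1), ([5,3,6,6,7,4,5],-1),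
    ([3,6,5,5,7,6,4],-1), ([3,5,6,6,7,4,5],1), ([6,3,6,5,5,7,4],-1), ([5,6,4,6,3,7,5],1),
    ([5,3,4,6,6,7,5],-1), ([6,3,6,4,5,7,5],1), ([3,6,4,6,5,7,5],-1), ([3,6,4,5,6,7,5],1),
    ([4,3,5,6,6,7,5],1), ([3,4,6,5,6,7,5],-1), ([4,6,3,5,6,7,5],-1), ([4,6,3,6,5,7,5],1),
    ([6,5,3,4,6,7,5],-1), ([3,6,6,4,5,7,5],-1), ([6,4,3,5,6,7,5],1), ([3,6,6,5,5,7,4],1),
    ([4,6,5,6,3,7,5],-1), ([3,5,6,4,6,7,5],1), ([5,3,4,5,6,6,7],-1), ([4,6,5,5,3,6,7],1),
    ([6,5,4,6,5,3,7],-1), ([3,5,4,5,6,6,7],1), ([4,3,6,5,5,6,7],1), ([4,6,3,5,5,6,7],-1),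
    ([6,4,5,6,5,3,7],1), ([6,5,4,5,3,6,7],-1), ([6,5,3,4,5,6,7],1), ([5,6,4,6,5,3,7],1),
    ([3,4,6,5,5,6,7],-1), ([4,6,5,6,5,3,7],-1), ([6,3,4,5,5,6,7],1), ([6,3,5,4,5,6,7],-1)]),
  ([6,5,6,7,3,4,5], [
    ([6,4,5,7,5,6,3],1), ([6,4,6,7,5,3,5],-1), ([6,6,5,7,3,4,5],-1), ([6,5,4,7,5,6,3],-1),
    ([6,6,4,7,5,3,5],1), ([6,5,6,7,3,4,5],1), ([6,3,5,6,7,4,5],1), ([6,5,3,6,7,4,5],-1),
    ([5,3,6,5,7,6,4],-1), ([3,5,6,5,7,6,4],1), ([5,6,3,5,7,6,4],1), ([3,6,5,5,7,6,4],-1),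
    ([6,4,3,6,5,7,5],1), ([6,5,4,6,3,7,5],1), ([6,3,4,6,5,7,5],-1), ([6,4,5,6,3,7,5],-1),
    ([6,5,3,4,6,7,5],-1), ([6,3,5,4,6,7,5],1), ([4,3,6,5,5,6,7],1), ([4,6,3,5,5,6,7],-1),
    ([6,4,5,5,3,6,7],1), ([6,5,4,5,3,6,7],-1), ([6,5,3,4,5,6,7],1), ([3,6,4,5,5,6,7],1),
    ([3,4,6,5,5,6,7],-1), ([6,3,5,4,5,6,7],-1)]),
  ([4,3,5,5,6,6,7], [
    ([5,3,4,5,6,6,7],-1), ([3,5,4,5,6,6,7],1), ([4,3,5,5,6,6,7],1), ([4,5,3,5,6,6,7],-1),
    ([5,4,3,5,6,6,7],1), ([3,4,5,5,6,6,7],-1)]),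
  ([6,4,6,5,3,7,5], [
    ([6,5,4,6,3,7,5],1), ([6,6,3,4,5,7,5],1), ([6,4,6,5,3,7,5],1), ([6,3,6,4,5,7,5],-1),
    ([6,6,4,5,3,7,5],-1), ([6,4,5,6,3,7,5],-1), ([6,5,3,4,6,7,5],-1), ([6,3,5,4,6,7,5],1)]),
  ([4,5,6,7,5,6,3], [
    ([5,6,4,7,6,3,5],1), ([6,4,5,7,5,6,3],1), ([5,4,6,7,6,3,5],-1), ([6,6,5,7,3,4,5],-1),
    ([6,5,4,7,5,6,3],-1), ([6,6,4,7,5,3,5],1), ([5,6,4,7,5,6,3],-1), ([4,6,6,7,5,3,5],-1),
    ([5,6,6,7,3,4,5],1), ([4,5,6,7,5,6,3],1), ([5,6,3,6,7,4,5],-1), ([6,3,5,6,7,4,5],1), ([5,6,5,4,7,6,3],1),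
    ([6,5,3,6,7,4,5],-1), ([5,5,3,6,7,6,4],1), ([5,5,6,4,7,6,3],-1), ([5,6,3,5,7,6,4],1),
    ([3,6,5,5,7,6,4],-1), ([3,5,6,6,7,4,5],1), ([5,3,5,6,7,6,4],-1), ([5,6,4,6,3,7,5],1),
    ([6,4,3,6,5,7,5],1), ([5,3,4,6,6,7,5],-1), ([6,5,4,6,3,7,5],1), ([6,3,4,6,5,7,5],-1),
    ([3,4,6,6,5,7,5],-1), ([4,3,5,6,6,7,5],1), ([6,4,5,6,3,7,5],-1), ([4,6,3,5,6,7,5],-1),
    ([4,6,3,6,5,7,5],1), ([6,5,3,4,6,7,5],-2), ([6,4,3,5,6,7,5],1), ([4,6,5,6,3,7,5],-1),
    ([6,3,5,4,6,7,5],1), ([3,5,6,4,6,7,5],1), ([5,3,4,5,6,6,7],-2), ([4,6,5,5,3,6,7],1), ([5,3,4,6,5,6,7],1),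
    ([3,5,4,5,6,6,7],2), ([4,3,6,5,5,6,7],2), ([4,6,3,5,5,6,7],-2), ([4,5,3,6,5,6,7],-1),
    ([6,4,5,5,3,6,7],1), ([5,4,3,5,6,6,7],1), ([6,5,4,5,3,6,7],-2), ([3,5,6,4,5,6,7],-1),
    ([3,4,5,5,6,6,7],-1), ([6,5,3,4,5,6,7],2), ([3,6,4,5,5,6,7],1), ([3,4,6,5,5,6,7],-1), ([6,3,5,4,5,6,7],-1)]),
  ([6,5,5,4,7,6,3], [
    ([6,4,5,7,5,6,3],-1), ([6,6,5,7,3,4,5],1), ([6,6,4,7,5,3,5],-1), ([6,4,5,7,6,3,5],1),
    ([5,6,4,7,5,6,3],1), ([4,6,6,7,5,3,5],1), ([5,6,6,7,3,4,5],-1), ([4,6,5,7,6,3,5],-1),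
    ([5,6,3,6,7,4,5],1), ([6,3,5,6,7,4,5],-1), ([5,6,5,4,7,6,3],-1), ([6,5,5,4,7,6,3],1),
    ([5,6,3,5,7,6,4],-1), ([3,6,5,5,7,6,4],1), ([3,5,5,6,7,6,4],-1), ([5,3,5,6,7,6,4],1),
    ([6,5,4,6,3,7,5],-1), ([6,3,4,6,5,7,5],1), ([6,4,5,6,3,7,5],1), ([4,6,3,5,6,7,5],1),
    ([4,6,3,6,5,7,5],-1), ([6,5,3,4,6,7,5],1), ([6,4,3,5,6,7,5],-1), ([6,3,5,4,6,7,5],-1),
    ([5,3,4,5,6,6,7],1), ([5,3,4,6,5,6,7],-1), ([3,5,4,5,6,6,7],-1), ([4,3,6,5,5,6,7],-1),
    ([4,6,3,5,5,6,7],1), ([6,4,5,5,3,6,7],-1), ([3,5,4,6,5,6,7],1), ([6,5,4,5,3,6,7],1),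
    ([6,5,3,4,5,6,7],-1), ([3,6,4,5,5,6,7],-1), ([3,4,6,5,5,6,7],1), ([6,3,5,4,5,6,7],1)]),
  ([5,4,6,7,5,6,3], [
    ([5,4,6,7,5,6,3],1), ([5,6,4,7,6,3,5],1), ([5,4,6,7,6,3,5],-1), ([5,6,4,7,5,6,3],-1),
    ([5,6,3,6,7,4,5],-1), ([5,6,5,4,7,6,3],1), ([5,5,3,6,7,6,4],1), ([5,5,6,4,7,6,3],-1),
    ([5,3,6,6,7,4,5],1), ([5,3,5,6,7,6,4],-1), ([6,4,3,6,5,7,5],1), ([6,5,4,6,3,7,5],1),
    ([6,3,4,6,5,7,5],-1), ([3,6,4,6,5,7,5],1), ([3,4,6,6,5,7,5],-1), ([3,6,4,5,6,7,5],-1),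
    ([6,4,5,6,3,7,5],-1), ([3,4,6,5,6,7,5],1), ([6,5,3,4,6,7,5],-1), ([6,3,5,4,6,7,5],1),
    ([5,3,4,5,6,6,7],-1), ([5,3,4,6,5,6,7],1), ([3,5,4,5,6,6,7],1), ([4,3,6,5,5,6,7],1),
    ([4,6,3,5,5,6,7],-1), ([3,6,5,4,5,6,7],1), ([6,4,5,5,3,6,7],1), ([5,4,3,5,6,6,7],1),
    ([6,5,4,5,3,6,7],-1), ([3,5,6,4,5,6,7],-1), ([3,4,5,5,6,6,7],-1), ([6,5,3,4,5,6,7],1),
    ([5,4,3,6,5,6,7],-1), ([6,3,5,4,5,6,7],-1)]),
  ([5,3,6,4,6,7,5], [
    ([5,3,6,4,6,7,5],1), ([5,3,4,6,6,7,5],-1), ([3,6,4,5,6,7,5],1), ([4,3,5,6,6,7,5],1),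
    ([3,4,6,5,6,7,5],-1), ([4,6,3,5,6,7,5],-1), ([6,4,3,5,6,7,5],1), ([6,3,5,4,6,7,5],-1)]),
  ([6,6,5,4,7,3,5], [
    ([5,6,4,7,6,3,5],1), ([6,6,5,7,3,4,5],1), ([6,6,4,7,5,3,5],-1), ([4,6,6,7,5,3,5],1),
    ([5,6,6,7,3,4,5],-1), ([4,6,5,7,6,3,5],-1), ([3,6,6,5,7,4,5],1), ([6,3,5,6,7,4,5],-1),
    ([5,6,6,4,7,3,5],-1), ([6,6,3,5,7,4,5],-1), ([6,5,3,6,7,4,5],1), ([5,3,6,6,7,4,5],1),
    ([6,6,5,4,7,3,5],1), ([3,5,6,6,7,4,5],-1), ([3,6,4,6,5,7,5],1), ([3,6,4,5,6,7,5],-1),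
    ([4,6,3,5,6,7,5],1), ([4,6,3,6,5,7,5],-1)]),
  ([4,6,5,7,5,6,3], [
    ([6,6,5,7,3,4,5],-1), ([6,6,4,7,5,3,5],1), ([4,6,5,7,5,6,3],1), ([5,6,4,7,5,6,3],-1),
    ([4,6,6,7,5,3,5],-1), ([5,6,6,7,3,4,5],1), ([6,3,5,6,7,4,5],1), ([6,5,3,6,7,4,5],-1),
    ([5,6,3,5,7,6,4],1), ([5,3,6,6,7,4,5],-1), ([3,6,5,5,7,6,4],-1), ([3,5,6,6,7,4,5],1),
    ([5,6,4,6,3,7,5],1), ([5,3,4,6,6,7,5],-1), ([3,6,4,6,5,7,5],-1), ([3,6,4,5,6,7,5],1),
    ([4,3,5,6,6,7,5],1), ([3,4,6,5,6,7,5],-1), ([4,6,3,5,6,7,5],-1), ([4,6,3,6,5,7,5],1),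
    ([6,5,3,4,6,7,5],-1), ([6,4,3,5,6,7,5],1), ([4,6,5,6,3,7,5],-1), ([3,5,6,4,6,7,5],1),
    ([5,3,4,5,6,6,7],-1), ([4,6,5,5,3,6,7],1), ([3,5,4,5,6,6,7],1), ([4,3,6,5,5,6,7],1),
    ([4,6,3,5,5,6,7],-1), ([3,6,5,4,5,6,7],-1), ([4,5,3,6,5,6,7],-1), ([6,5,4,5,3,6,7],-1),
    ([6,5,3,4,5,6,7],1), ([3,6,4,5,5,6,7],1), ([3,4,6,5,5,6,7],-1), ([5,4,3,6,5,6,7],1)]),
  ([6,6,5,7,5,3,4], [
    ([6,6,5,7,5,3,4],1), ([6,6,5,7,3,4,5],-1), ([5,6,6,7,5,3,4],-1), ([5,6,6,7,3,4,5],1),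
    ([6,3,5,6,7,4,5],1), ([6,5,3,6,7,4,5],-1), ([5,6,3,5,7,6,4],1), ([5,3,6,6,7,4,5],-1),
    ([3,6,5,5,7,6,4],-1), ([3,5,6,6,7,4,5],1), ([5,6,4,6,3,7,5],1), ([5,3,4,6,6,7,5],-1),
    ([6,6,3,4,5,7,5],1), ([3,6,4,6,5,7,5],-1), ([3,6,4,5,6,7,5],1), ([4,3,5,6,6,7,5],1),
    ([3,4,6,5,6,7,5],-1), ([4,6,3,5,6,7,5],-1), ([4,6,3,6,5,7,5],1), ([6,6,3,5,5,7,4],-1),
    ([6,5,3,4,6,7,5],-1), ([3,6,6,4,5,7,5],-1), ([6,4,3,5,6,7,5],1), ([3,6,6,5,5,7,4],1),
    ([4,6,5,6,3,7,5],-1), ([3,5,6,4,6,7,5],1), ([5,3,4,5,6,6,7],-1), ([4,6,5,5,3,6,7],1),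
    ([3,5,4,5,6,6,7],1), ([6,5,4,5,3,6,7],-1), ([5,6,4,6,5,3,7],1), ([3,6,4,5,5,6,7],-1),
    ([4,6,5,6,5,3,7],-1), ([6,3,4,5,5,6,7],1)]),
  ([5,5,6,6,7,3,4], [
    ([5,6,3,6,7,4,5],1), ([5,5,3,6,7,6,4],-1), ([5,6,5,6,7,3,4],-1), ([5,5,6,6,7,3,4],1),
    ([5,3,6,6,7,4,5],-1), ([5,3,5,6,7,6,4],1), ([5,6,3,6,5,7,4],1), ([5,6,4,6,3,7,5],-1),
    ([6,4,3,6,5,7,5],-1), ([5,3,4,6,6,7,5],1), ([5,3,6,6,5,7,4],-1), ([3,4,6,6,5,7,5],1),
    ([6,4,5,6,3,7,5],1), ([3,4,5,6,6,7,5],-1), ([5,4,5,6,3,6,7],-1), ([5,5,4,6,6,3,7],-1),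
    ([5,4,5,6,6,3,7],1), ([5,5,4,6,3,6,7],1)]),
  ([6,6,5,5,7,4,3], [
    ([3,6,6,5,7,4,5],1), ([6,6,3,5,7,4,5],-1), ([6,6,5,5,7,4,3],1), ([5,6,6,5,7,4,3],-1),
    ([5,6,3,5,7,6,4],1), ([3,6,5,5,7,6,4],-1), ([5,6,4,6,3,7,5],1), ([5,3,4,6,6,7,5],-1),
    ([6,6,3,4,5,7,5],1), ([6,6,4,5,5,7,3],-1), ([3,6,4,5,6,7,5],1), ([4,3,5,6,6,7,5],1),
    ([3,4,6,5,6,7,5],-1), ([4,6,3,5,6,7,5],-1), ([6,5,3,4,6,7,5],-1), ([3,6,6,4,5,7,5],-1),
    ([6,4,3,5,6,7,5],1), ([4,6,6,5,5,7,3],1), ([4,6,5,6,3,7,5],-1), ([3,5,6,4,6,7,5],1),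
    ([5,3,4,5,6,6,7],-1), ([4,6,5,5,3,6,7],1), ([3,5,4,5,6,6,7],1), ([4,6,3,5,5,6,7],-1),
    ([5,6,3,5,6,4,7],1), ([6,5,4,5,3,6,7],-1), ([3,6,5,5,6,4,7],-1), ([6,3,4,5,5,6,7],1)]),
  ([3,6,5,6,7,4,5], [
    ([5,6,3,6,7,4,5],-1), ([6,3,5,6,7,4,5],-1), ([6,5,3,6,7,4,5],1), ([3,6,5,6,7,4,5],1),
    ([5,3,6,6,7,4,5],1), ([3,5,6,6,7,4,5],-1)]),
  ([3,6,5,6,5,7,4], [
    ([5,6,3,6,5,7,4],-1), ([6,6,5,4,5,7,3],-1), ([3,6,4,6,5,7,5],-1), ([6,6,4,5,5,7,3],1),
    ([3,6,5,6,5,7,4],1), ([4,6,3,6,5,7,5],1), ([4,6,6,5,5,7,3],-1), ([5,6,6,4,5,7,3],1)]),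
  ([5,4,6,6,5,3,7], [
    ([5,4,6,6,5,3,7],1), ([6,5,4,6,5,3,7],1), ([6,4,5,6,5,3,7],-1), ([4,5,6,6,5,3,7],-1),
    ([5,6,4,6,5,3,7],-1), ([4,6,5,6,5,3,7],1)]),
  ([4,6,6,5,3,7,5], [
    ([5,6,4,6,3,7,5],1), ([5,3,4,6,6,7,5],-1), ([6,6,3,4,5,7,5],1), ([6,6,4,5,3,7,5],-1),
    ([3,6,4,5,6,7,5],1), ([4,3,5,6,6,7,5],1), ([3,4,6,5,6,7,5],-1), ([4,6,3,5,6,7,5],-1),
    ([6,5,3,4,6,7,5],-1), ([3,6,6,4,5,7,5],-1), ([6,4,3,5,6,7,5],1), ([4,6,6,5,3,7,5],1),
    ([4,6,5,6,3,7,5],-1), ([3,5,6,4,6,7,5],1)]),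
  ([5,6,3,4,6,7,5], [
    ([5,6,4,6,3,7,5],-1), ([6,5,4,6,3,7,5],1), ([6,3,4,6,5,7,5],-1), ([3,6,4,6,5,7,5],1),
    ([4,3,5,6,6,7,5],1), ([4,6,3,5,6,7,5],-1), ([3,4,5,6,6,7,5],-1), ([6,5,3,4,6,7,5],-1),
    ([6,4,3,5,6,7,5],1), ([5,6,3,4,6,7,5],1)]),
  ([3,6,5,4,6,7,5], [
    ([5,6,4,6,3,7,5],-1), ([3,6,5,4,6,7,5],1), ([5,3,4,6,6,7,5],1), ([6,5,4,6,3,7,5],1),
    ([6,3,4,6,5,7,5],-1), ([3,6,4,6,5,7,5],1), ([3,6,4,5,6,7,5],-1), ([3,4,6,5,6,7,5],1),
    ([3,4,5,6,6,7,5],-1), ([3,5,6,4,6,7,5],-1)]),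
  ([4,5,3,6,6,7,5], [
    ([5,6,4,6,3,7,5],1), ([6,5,4,6,3,7,5],-1), ([4,5,3,6,6,7,5],1), ([6,3,4,6,5,7,5],1),
    ([3,6,4,6,5,7,5],-1), ([4,3,5,6,6,7,5],-1), ([3,4,5,6,6,7,5],1), ([5,4,3,6,6,7,5],-1)]),
  ([4,3,6,6,5,7,5], [
    ([6,4,3,6,5,7,5],1), ([6,3,4,6,5,7,5],-1), ([3,6,4,6,5,7,5],1), ([3,4,6,6,5,7,5],-1),
    ([4,3,6,6,5,7,5],1), ([4,6,3,6,5,7,5],-1)]),
  ([3,5,4,6,6,7,5], [
    ([5,6,4,6,3,7,5],1), ([5,3,4,6,6,7,5],-1), ([6,5,4,6,3,7,5],-1), ([6,3,4,6,5,7,5],1),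
    ([3,6,4,6,5,7,5],-1), ([3,5,4,6,6,7,5],1)]),
  ([4,5,6,6,3,7,5], [
    ([5,6,4,6,3,7,5],1), ([6,4,3,6,5,7,5],1), ([6,5,4,6,3,7,5],-1), ([3,4,6,6,5,7,5],-1),
    ([3,4,5,6,6,7,5],1), ([4,5,6,6,3,7,5],1), ([5,4,3,6,6,7,5],-1), ([4,6,5,6,3,7,5],-1)]),
  ([5,4,6,6,3,7,5], [
    ([5,4,6,6,3,7,5],1), ([6,4,3,6,5,7,5],1), ([3,4,6,6,5,7,5],-1), ([6,4,5,6,3,7,5],-1),
    ([3,4,5,6,6,7,5],1), ([5,4,3,6,6,7,5],-1)]),
  ([4,5,5,6,3,6,7], [
    ([4,6,5,5,3,6,7],-1), ([5,4,5,6,3,6,7],-1), ([5,3,5,4,6,6,7],1), ([3,6,5,4,5,6,7],1),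
    ([3,5,5,4,6,6,7],-1), ([4,5,5,6,3,6,7],1), ([6,4,5,5,3,6,7],1), ([6,3,5,4,5,6,7],-1)]),
  ([5,5,3,4,6,6,7], [
    ([5,3,4,5,6,6,7],1), ([5,4,5,6,3,6,7],1), ([3,5,4,5,6,6,7],-1), ([4,3,6,5,5,6,7],-1),
    ([5,5,3,4,6,6,7],1), ([4,6,3,5,5,6,7],1), ([5,3,5,4,6,6,7],-1), ([3,6,5,4,5,6,7],-1),
    ([5,5,4,6,3,6,7],-1), ([6,4,5,5,3,6,7],-1), ([5,4,3,5,6,6,7],-1), ([6,5,4,5,3,6,7],1),
    ([3,5,6,4,5,6,7],1), ([3,4,5,5,6,6,7],1), ([6,5,3,4,5,6,7],-1), ([6,3,5,4,5,6,7],1)]),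
  ([4,3,5,6,5,6,7], [
    ([5,3,4,6,5,6,7],-1), ([4,3,5,6,5,6,7],1), ([3,6,5,4,5,6,7],-1), ([4,5,3,6,5,6,7],-1),
    ([3,5,6,4,5,6,7],1), ([3,6,4,5,5,6,7],1), ([3,4,6,5,5,6,7],-1), ([5,4,3,6,5,6,7],1)]),
  ([5,4,6,5,3,6,7], [
    ([4,3,6,5,5,6,7],-1), ([4,6,3,5,5,6,7],1), ([6,4,5,5,3,6,7],-1), ([5,4,3,5,6,6,7],-1),
    ([5,4,6,5,3,6,7],1), ([3,4,5,5,6,6,7],1), ([3,6,4,5,5,6,7],-1), ([6,3,4,5,5,6,7],1)]),
  ([4,5,6,5,3,6,7], [
    ([5,3,4,5,6,6,7],1), ([4,6,5,5,3,6,7],-1), ([3,5,4,5,6,6,7],-1), ([4,3,6,5,5,6,7],-1),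
    ([4,5,6,5,3,6,7],1), ([4,6,3,5,5,6,7],1), ([5,4,3,5,6,6,7],-1), ([3,4,5,5,6,6,7],1)]),
  ([5,6,4,5,3,6,7], [
    ([5,3,4,5,6,6,7],-1), ([3,5,4,5,6,6,7],1), ([6,5,4,5,3,6,7],-1), ([5,6,4,5,3,6,7],1),
    ([3,6,4,5,5,6,7],-1), ([6,3,4,5,5,6,7],1)]),
  ([5,6,3,4,5,6,7], [
    ([4,3,6,5,5,6,7],-1), ([4,5,3,6,5,6,7],1), ([6,5,3,4,5,6,7],-1), ([3,6,4,5,5,6,7],-1),
    ([3,4,6,5,5,6,7],1), ([6,3,4,5,5,6,7],1), ([5,4,3,6,5,6,7],-1), ([5,6,3,4,5,6,7],1)]),
  ([5,3,6,4,5,6,7], [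
    ([4,3,6,5,5,6,7],-1), ([5,3,6,4,5,6,7],1), ([3,6,5,4,5,6,7],1), ([4,5,3,6,5,6,7],1),
    ([3,5,6,4,5,6,7],-1), ([3,6,4,5,5,6,7],-1), ([3,4,6,5,5,6,7],1), ([6,3,4,5,5,6,7],1),
    ([5,4,3,6,5,6,7],-1), ([6,3,5,4,5,6,7],-1)]),
  ([6,4,3,5,5,6,7], [
    ([6,4,3,5,5,6,7],1), ([4,3,6,5,5,6,7],1), ([4,6,3,5,5,6,7],-1), ([3,6,4,5,5,6,7],1),
    ([3,4,6,5,5,6,7],-1), ([6,3,4,5,5,6,7],-1)]),
  ([3,4,5,6,5,6,7], [
    ([3,6,5,4,5,6,7],-1), ([3,5,4,6,5,6,7],-1), ([3,5,6,4,5,6,7],1), ([3,6,4,5,5,6,7],1),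
    ([3,4,6,5,5,6,7],-1), ([3,4,5,6,5,6,7],1)])]"

section \<open>Evaluation of the certificates\<close>

lemma cubic_cover: "cover 7 ([0, 0, 0, 3, 3, 0, 0] @ [1]) [] (map fst cubic_order)"
  by code_simp

lemma cubic_check_order: "check_order cubic_order"
  by code_simp

lemma cubic_trace: "relation_trace 7 sigma7 [0, 0, 0, 3, 3, 0, 0] 0"
  using relation_trace_certificate[of "[0, 0, 0, 3, 3, 0, 0]" "[]" cubic_order] cubic_cover cubic_check_order
  by simp

lemma quadratic_cover: "cover 7 ([2, 2, 2, 0, 0, 0, 0] @ [1]) [] (map fst quadratic_rels @ map fst quadratic_order)"
  by code_simp

lemma quadratic_check_order: "check_order quadratic_order"
  by code_simp

lemma quadratic_check_relations: "check_relations [2, 2, 2, 0, 0, 0, 0] quadratic_rels"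
  by code_simp

lemma quadratic_check_pivots: "check_pivots quadratic_rels (map fst quadratic_rels)"
  by code_simp

lemma quadratic_distinct: "distinct (map fst quadratic_rels)"
  by code_simp

lemma quadratic_cert_trace: "cert_trace quadratic_rels = 2"
  by code_simp

lemma quadratic_trace: "relation_trace 7 sigma7 [2, 2, 2, 0, 0, 0, 0] 2"
  using relation_trace_certificate[OF _ quadratic_cover quadratic_check_order quadratic_check_relations quadratic_check_pivots quadratic_distinct]
  by (simp add: quadratic_cert_trace)

lemma mixed_cover: "cover 7 ([0, 0, 0, 1, 1, 2, 2] @ [1]) [] (map fst mixed_rels @ map fst mixed_order)"
  by code_simp

lemma mixed_check_order: "check_order mixed_order"
  by code_simp

lemma mixed_check_relations: "check_relations [0, 0, 0, 1, 1, 2, 2] mixed_rels"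
  by code_simp

lemma mixed_check_pivots: "check_pivots mixed_rels (map fst mixed_rels)"
  by code_simp

lemma mixed_distinct: "distinct (map fst mixed_rels)"
  by code_simp

lemma mixed_cert_trace: "cert_trace mixed_rels = 1"
  by code_simp

lemma mixed_trace: "relation_trace 7 sigma7 [0, 0, 0, 1, 1, 2, 2] 1"
  using relation_trace_certificate[OF _ mixed_cover mixed_check_order mixed_check_relations mixed_check_pivots mixed_distinct]
  by (simp add: mixed_cert_trace)

text \<open>The involution exchanges the cycles (3 4) and (5 6) of \<open>sigma7\<close>, hence
  commutes with it and interchanges the mirrored blocks.\<close>

definition psi7 :: "nat \<Rightarrow> nat" where
  "psi7 v = (if v < 7 then [0, 1, 2, 5, 6, 3, 4] ! v else v)"

lemma less7: "v < 7 \<Longrightarrow> v \<in> {0, 1, 2, 3, 4, 5, 6 :: nat}"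
  by auto

lemma psi7_permutes: "psi7 permutes {0..<7}"
proof (rule bij_imp_permutes)
  show "bij_betw psi7 {0..<7} {0..<7}"
    unfolding atLeastLessThan7 bij_betw_def by (auto simp: psi7_def inj_on_def)
qed (simp add: psi7_def)

lemma psi7_involution: "psi7 \<circ> psi7 = id"
proof
  fix v show "(psi7 \<circ> psi7) v = id v"
    by (cases "v < 7") (use less7[of v] in \<open>auto simp: psi7_def\<close>)
qed

lemma sigma7_psi7: "sigma7 \<circ> psi7 = psi7 \<circ> sigma7"
proof
  fix v show "(sigma7 \<circ> psi7) v = (psi7 \<circ> sigma7) v"
    by (cases "v < 7") (use less7[of v] in \<open>auto simp: psi7_def sigma7_def\<close>)
qed

lemma relation_trace_mirror:
  assumes "relation_trace 7 sigma7 [a, a, a, b, b, e, e] c"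
  shows "relation_trace 7 sigma7 [a, a, a, e, e, b, b] c"
proof (rule relation_trace_transport[OF sigma7_permutes psi7_permutes psi7_involution sigma7_psi7 _ assms])
  fix p assume "p \<in> trees 7"
  then show "degrees 7 (relabel psi7 p) = [a, a, a, e, e, b, b] \<longleftrightarrow> degrees 7 p = [a, a, a, b, b, e, e]"
    by (intro degrees_relabel_iff[OF psi7_permutes]) (auto simp: ptree_length psi7_def dest!: less7)
qed

text \<open>A permutation that fixes a tree must fix its root, but \<open>sigma7\<close> moves every
  vertex.\<close>

lemma sigma7_no_fixed_tree:
  assumes "p \<in> trees 7" shows "relabel sigma7 p \<noteq> p"
proof
  assume fixed: "relabel sigma7 p = p"
  have p: "ptree 7 p" using assms by simp
  have "p ! sigma7 (proot p) = sigma7 (p ! proot p)"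
    using relabel_nth[OF sigma7_permutes ptree_length[OF p] proot(1)[OF p]] fixed by simp
  also have "\<dots> = 7" using proot(2)[OF p] by (simp add: sigma7_def)
  finally have "sigma7 (proot p) = proot p"
    using proot(1,3)[OF p] perm_less[OF sigma7_permutes] by blast
  then show False
    using less7[OF proot(1)[OF p]] by (auto simp: sigma7_def)
qed

section \<open>Out-degrees invariant under the permutation\<close>

definition stable_degrees :: "nat list set" where
  "stable_degrees = {[0, 0, 0, 3, 3, 0, 0], [0, 0, 0, 0, 0, 3, 3], [2, 2, 2, 0, 0, 0, 0],
     [0, 0, 0, 1, 1, 2, 2], [0, 0, 0, 2, 2, 1, 1]}"

text \<open>Invariant out-degrees are constant on the cycles of \<open>sigma7\<close>. A tree on
  seven vertices has six edges, so the three values solve \<open>3 a + 2 b + 2 e = 6\<close>, which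
  has exactly five solutions in natural numbers.\<close>

lemma degrees_stable:
  assumes p: "p \<in> trees 7" and eq: "degrees 7 (relabel sigma7 p) = degrees 7 p"
  shows "degrees 7 p \<in> stable_degrees"
proof -
  define c where "c = count_list p"
  have pb: "p \<in> block 7 (degrees 7 p)" using p by (simp add: block_def)
  have s: "c (sigma7 u) = c u" if "u < 7" for u
  proof -
    have "degrees 7 p ! sigma7 u = degrees 7 p ! u"
      using degrees_relabel[OF sigma7_permutes block7D(1)[OF pb] that] eq by simp
    then show ?thesis using that perm_less[OF sigma7_permutes, of u] by (simp add: degrees_def c_def)
  qed
  have e: "c 1 = c 0" "c 2 = c 0" "c 4 = c 3" "c 6 = c 5"
    using s[of 0] s[of 1] s[of 3] s[of 5] by (simp_all add: sigma7_def)
  have "sum c {..7} = 7"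
    using sum_count_set[OF block7D(3)[OF pb]] block7D(1)[OF pb] by (simp add: c_def)
  moreover have "{..7} = {0, 1, 2, 3, 4, 5, 6, 7 :: nat}" by auto
  ultimately have "3 * c 0 + 2 * c 3 + 2 * c 5 = 6"
    using block7D(6)[OF pb] e by (simp add: c_def)
  then have "c 0 = 0 \<and> c 3 = 3 \<and> c 5 = 0 \<or> c 0 = 0 \<and> c 3 = 0 \<and> c 5 = 3 \<or> c 0 = 2 \<and> c 3 = 0 \<and> c 5 = 0 \<or>
      c 0 = 0 \<and> c 3 = 1 \<and> c 5 = 2 \<or> c 0 = 0 \<and> c 3 = 2 \<and> c 5 = 1"
    by presburger
  moreover have "degrees 7 p = [c 0, c 0, c 0, c 3, c 3, c 5, c 5]"
    using e by (simp add: degrees_def upt7 c_def)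
  ultimately show ?thesis by (auto simp: stable_degrees_def)
qed

lemma block_stable:
  assumes "d \<in> stable_degrees" "p \<in> trees 7"
  shows "relabel sigma7 p \<in> block 7 d \<longleftrightarrow> p \<in> block 7 d"
proof -
  have "degrees 7 (relabel sigma7 p) = d \<longleftrightarrow> degrees 7 p = d"
    by (rule degrees_relabel_iff[OF sigma7_permutes])
      (use assms in \<open>auto simp: stable_degrees_def ptree_length sigma7_def dest!: less7\<close>)
  then show ?thesis using ptree_relabel[OF sigma7_permutes] assms(2) by (simp add: block_def)
qed

section \<open>Tree maps as a spanning family, and the contradiction\<close>

lemma Fmap_in_W2: "p \<in> trees 7 \<Longrightarrow> tree_field p \<in> W2 7"
proof -
  assume p: "p \<in> trees 7"
  have "tree_field p = Fmap 7 (edges p)" using p by (simp add: tree_field_def ptree_length)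
  moreover have "edges p \<in> RT 7" using p edges_in_RT by simp
  ultimately have "{tree_field p} \<subseteq> Fmap 7 ` RT 7" by auto
  moreover have "tree_field p = lincomb {tree_field p} (\<lambda>_. 1)" by (simp add: lincomb_def)
  ultimately show ?thesis unfolding W2_def rspan_def by blast
qed

lemma W2_expand:
  assumes "b \<in> W2 7"
  shows "\<exists>c. \<forall>g x. b g x = (\<Sum>p\<in>trees 7. c p *\<^sub>R tree_field p g x)"
proof -
  have "Fmap 7 ` RT 7 = tree_field ` trees 7"
    unfolding RT_image image_image by (rule image_cong[OF refl]) (simp add: tree_field_def ptree_length)
  then obtain S c where S: "finite S" "S \<subseteq> tree_field ` trees 7" "b = lincomb S c"
    using assms by (auto simp: W2_def rspan_def)
  \<comment> \<open>A combination is indexed by maps, and different trees could a priori give the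
    same map; \<open>T\<close> selects one tree for each map.\<close>
  then obtain T where T: "T \<subseteq> trees 7" "inj_on tree_field T" "S = tree_field ` T"
    by (auto simp: subset_image_inj)
  define c' where "c' = (\<lambda>p. if p \<in> T then c (tree_field p) else 0)"
  have "b g x = (\<Sum>p\<in>trees 7. c' p *\<^sub>R tree_field p g x)" for g x
  proof -
    have "(\<Sum>p\<in>trees 7. c' p *\<^sub>R tree_field p g x) = (\<Sum>p\<in>T. c' p *\<^sub>R tree_field p g x)"
      using T(1) finite_ptree by (intro sum.mono_neutral_right) (auto simp: c'_def)
    also have "\<dots> = (\<Sum>p\<in>T. c (tree_field p) *\<^sub>R tree_field p g x)" by (intro sum.cong refl) (simp add: c'_def)
    also have "\<dots> = b g x"
      unfolding S(3) lincomb_def T(3) by (simp add: sum.reindex[OF T(2)])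
    finally show ?thesis by simp
  qed
  then show ?thesis by blast
qed

theorem theorem4p8:
  fixes CD :: "nat \<Rightarrow> 'c set"
    and act :: "nat \<Rightarrow> (nat \<Rightarrow> nat) \<Rightarrow> 'c \<Rightarrow> 'c"
    and H :: "nat \<Rightarrow> 'c \<Rightarrow> nmap"
  shows "\<not> is_faithful_comb_description CD act H"
proof
  assume faithful: "is_faithful_comb_description CD act H"
  define B where "B = H 7 ` CD 7"
  have desc: "is_Sn_action 7 (CD 7) (act 7) \<and> H 7 ` CD 7 \<subseteq> W2 7 \<and>
      (\<forall>\<sigma> x. \<sigma> permutes {0..<7} \<and> x \<in> CD 7 \<longrightarrow> H 7 (act 7 \<sigma> x) = perm_act \<sigma> (H 7 x)) \<and>
      rspan (H 7 ` CD 7) = W2 7"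
    using faithful[unfolded is_faithful_comb_description_def is_comb_description_def, THEN conjunct1, rule_format, of 7]
    by simp
  have indep: "rindep B"
    using faithful[unfolded is_faithful_comb_description_def, THEN conjunct2, rule_format, of 7] by (simp add: B_def)
  have span: "rspan B = W2 7" and BW: "B \<subseteq> W2 7" using desc by (simp_all add: B_def)
  have closed: "perm_act \<sigma> b \<in> B" if \<sigma>: "\<sigma> permutes {0..<7}" and b: "b \<in> B" for \<sigma> b
  proof -
    obtain x where x: "x \<in> CD 7" "b = H 7 x" using b by (auto simp: B_def)
    then have "act 7 \<sigma> x \<in> CD 7" using desc \<sigma> unfolding is_Sn_action_def by blast
    moreover have "perm_act \<sigma> b = H 7 (act 7 \<sigma> x)" using desc \<sigma> x by simp
    ultimately show ?thesis by (simp add: B_def)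
  qed
  note invs = permutes_inv_o[OF sigma7_permutes] permutes_inv[OF sigma7_permutes]
  have "perm_act (inv sigma7) (perm_act sigma7 b) = b" "perm_act sigma7 (perm_act (inv sigma7) b) = b" for b
    by (simp_all add: perm_act_def comp_assoc invs)
  then have bij: "bij_betw (perm_act sigma7) B B"
    by (intro bij_betw_byWitness[where f' = "perm_act (inv sigma7)"])
      (use closed sigma7_permutes invs in auto)
  \<comment> \<open>Indices that consist of inputs, a point and a coordinate turn linear identities
    between maps into identities between real functions; permuting the inputs becomes precomposition
    with \<theta>.\<close>
  define FF where "FF = (\<lambda>p (g, x, i). tree_field p g x $ i)"
  define VV where "VV = (\<lambda>b :: nmap. \<lambda>(g, x, i). b g x $ i)"
  define \<theta> :: "inputs \<times> R2 \<times> 2 \<Rightarrow> inputs \<times> R2 \<times> 2" where "\<theta> = (\<lambda>(g, x, i). (g \<circ> sigma7, x, i))"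
  interpret permuted_basis "trees 7" FF "relabel sigma7" B VV "perm_act sigma7" \<theta>
  proof
    show "finite (trees 7)" by (rule finite_ptree)
  next
    show "\<forall>B' c. finite B' \<and> B' \<subseteq> B \<and> (\<forall>i. (\<Sum>b\<in>B'. c b * VV b i) = 0) \<longrightarrow> (\<forall>b\<in>B'. c b = 0)"
    proof (intro allI impI)
      fix B' c
      assume B': "finite B' \<and> B' \<subseteq> B \<and> (\<forall>i. (\<Sum>b\<in>B'. c b * VV b i) = 0)"
      have "lincomb B' c = (\<lambda>g x. 0)"
      proof (intro ext)
        fix g x
        have "lincomb B' c g x $ i = 0" for i
          using B'[THEN conjunct2, THEN conjunct2, THEN spec, of "(g, x, i)"] by (simp add: lincomb_def VV_def)
        then show "lincomb B' c g x = 0" by (simp add: vec_eq_iff)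
      qed
      then have "finite B' \<and> B' \<subseteq> B \<and> lincomb B' c = (\<lambda>g x. 0)" using B' by simp
      then show "\<forall>b\<in>B'. c b = 0" by (rule indep[unfolded rindep_def, THEN spec, THEN spec, THEN mp])
    qed
  next
    fix p assume p: "p \<in> trees 7"
    show "\<exists>B' c. finite B' \<and> B' \<subseteq> B \<and> (\<forall>i. FF p i = (\<Sum>b\<in>B'. c b * VV b i))"
    proof -
      have "tree_field p \<in> rspan B" unfolding span by (rule Fmap_in_W2[OF p])
      then have "\<exists>B' c. finite B' \<and> B' \<subseteq> B \<and> tree_field p = lincomb B' c"
        unfolding rspan_def by blast
      then obtain B' c where Bc: "finite B'" "B' \<subseteq> B" "tree_field p = lincomb B' c"
        by (elim exE conjE) (rule that)
      have "FF p i = (\<Sum>b\<in>B'. c b * VV b i)" for i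
        unfolding FF_def Bc(3) by (simp add: VV_def lincomb_def split: prod.split)
      then show ?thesis using Bc(1,2) by blast
    qed
    show "FF (relabel sigma7 p) i = FF p (\<theta> i)" for i
      using tree_field_relabel'[OF sigma7_permutes, of p] p by (cases i) (simp add: FF_def \<theta>_def)
  next
    fix b assume b: "b \<in> B"
    show "VV (perm_act sigma7 b) i = VV b (\<theta> i)" for i
      by (cases i) (simp add: VV_def \<theta>_def perm_act_def)
    show "\<exists>c. \<forall>i. VV b i = (\<Sum>p\<in>trees 7. c p * FF p i)"
    proof -
      obtain c where "\<forall>g x. b g x = (\<Sum>p\<in>trees 7. c p *\<^sub>R tree_field p g x)"
        using W2_expand[of b] BW b by blast
      then show ?thesis by (intro exI[of _ c]) (auto simp: VV_def FF_def)
    qed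
  next
    show "surj \<theta>"
    proof (rule surjI[of _ "\<lambda>(g, x, i). (g \<circ> inv sigma7, x, i)"])
      show "\<theta> (case y of (g, x, i) \<Rightarrow> (g \<circ> inv sigma7, x, i)) = y" for y
        by (cases y) (simp add: \<theta>_def comp_assoc invs)
    qed
  qed (use bij bij_relabel[OF sigma7_permutes] in simp_all)
  have rel_iff: "rel k \<longleftrightarrow> relation 7 k" for k
  proof -
    have "rel k \<longleftrightarrow> (\<forall>g x i. (\<Sum>p\<in>trees 7. k p *\<^sub>R tree_field p g x) $ i = 0)"
      unfolding rel_def by (simp add: FF_def)
    then show ?thesis by (simp only: relation_altdef vec_eq_iff zero_index)
  qed
  obtain P where P: "splitting P" "\<And>x y. degrees 7 x \<noteq> degrees 7 y \<Longrightarrow> P x y = 0"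
    using graded_splitting_exists[of "degrees 7"] relation_graded unfolding rel_iff by blast
  have block: "(\<Sum>x\<in>block 7 d. P x (relabel sigma7 x)) = - c"
    if d: "d \<in> stable_degrees" and tr: "relation_trace 7 sigma7 d c" for d c
  proof -
    obtain I k where H: "I \<subseteq> block 7 d \<and>
       (\<forall>i\<in>I. relation 7 (k i) \<and> (\<forall>y\<in>trees 7 - block 7 d. k i y = 0) \<and> (\<forall>j\<in>I. k i j = (if i = j then 1 else 0))) \<and>
       (\<forall>l. relation 7 l \<and> (\<forall>y\<in>trees 7 - block 7 d. l y = 0) \<and> (\<forall>i\<in>I. l i = 0) \<longrightarrow> (\<forall>y\<in>block 7 d. l y = 0)) \<and>
       (\<Sum>i\<in>I. k i (relabel sigma7 i)) = c"
      using tr unfolding relation_trace_def by (elim exE) (rule that)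
    have "(\<Sum>x\<in>block 7 d. P x (relabel sigma7 x)) = - (\<Sum>i\<in>I. k i (relabel sigma7 i))"
    proof (rule block_trace[OF P(1)])
      show "block 7 d \<subseteq> trees 7" by (auto simp: block_def)
      show "relabel sigma7 x \<in> block 7 d \<longleftrightarrow> x \<in> block 7 d" if "x \<in> trees 7" for x
        by (rule block_stable[OF d that])
      show "relabel sigma7 x \<noteq> x" if "x \<in> block 7 d" for x
        using that sigma7_no_fixed_tree by (simp add: block_def)
      show "P x y = 0" if "x \<in> block 7 d" "y \<in> trees 7 - block 7 d" for x y
        using that by (intro P(2)) (auto simp: block_def)
      show "I \<subseteq> block 7 d" using H by simp
      show "rel (k i)" if "i \<in> I" for i unfolding rel_iff using H that by simp
      show "k i y = 0" if "i \<in> I" "y \<in> trees 7 - block 7 d" for i y using H that by simp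
      show "k i j = (if i = j then 1 else 0)" if "i \<in> I" "j \<in> I" for i j using H that by simp
      show "l y = 0" if "rel l" "\<And>y. y \<in> trees 7 - block 7 d \<Longrightarrow> l y = 0" "\<And>i. i \<in> I \<Longrightarrow> l i = 0" "y \<in> block 7 d" for l y
        using H that unfolding rel_iff by blast
    qed
    then show ?thesis using H by simp
  qed
  define D where "D = stable_degrees"
  \<comment> \<open>\<open>P\<close> is homogeneous, so its entry from a tree to the rotated tree
    vanishes unless both have the same out-degrees, that is, unless the out-degrees are
    stable.\<close>
  have "(\<Sum>x\<in>trees 7. P x (relabel sigma7 x)) = (\<Sum>x\<in>(\<Union>d\<in>D. block 7 d). P x (relabel sigma7 x))"
  proof (rule sum.mono_neutral_right[OF finite_ptree])
    show "(\<Union>d\<in>D. block 7 d) \<subseteq> trees 7" by (auto simp: block_def)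
    show "\<forall>x\<in>trees 7 - (\<Union>d\<in>D. block 7 d). P x (relabel sigma7 x) = 0"
    proof
      fix x assume x: "x \<in> trees 7 - (\<Union>d\<in>D. block 7 d)"
      then have "degrees 7 x \<notin> stable_degrees" by (auto simp: D_def block_def)
      then have "degrees 7 x \<noteq> degrees 7 (relabel sigma7 x)" using degrees_stable[of x] x by auto
      then show "P x (relabel sigma7 x) = 0" by (rule P(2))
    qed
  qed
  also have "\<dots> = (\<Sum>d\<in>D. \<Sum>x\<in>block 7 d. P x (relabel sigma7 x))"
  proof (rule sum.UNION_disjoint)
    show "finite D" by (simp add: D_def stable_degrees_def)
    show "\<forall>d\<in>D. finite (block 7 d)"
      using finite_ptree[of 7] by (auto simp: block_def intro: finite_subset[rotated])
  qed (auto simp: block_def)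
  also have "\<dots> = - 4"
  proof -
    have "(\<Sum>d\<in>D. f d) = f [0, 0, 0, 3, 3, 0, 0] + (f [0, 0, 0, 0, 0, 3, 3] + (f [2, 2, 2, 0, 0, 0, 0] +
        (f [0, 0, 0, 1, 1, 2, 2] + f [0, 0, 0, 2, 2, 1, 1])))" for f :: "nat list \<Rightarrow> real"
      by (simp add: D_def stable_degrees_def)
    moreover note block[OF _ cubic_trace] block[OF _ relation_trace_mirror[OF cubic_trace]]
      block[OF _ quadratic_trace] block[OF _ mixed_trace] block[OF _ relation_trace_mirror[OF mixed_trace]]
    ultimately show ?thesis by (simp add: stable_degrees_def)
  qed
  \<comment> \<open>By \<open>trace_splitting\<close> the same sum counts fixed elements of
    \<open>B\<close>, so it cannot be negative.\<close>
  finally show False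
    using trace_splitting[OF P(1)] by simp
qed

end
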